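(* Let $G=(V,m,E,a)$ be an undirected weighted graph with a collection of undirected clusters $\{\hat E_i\}_{i\in I}$, $\hat E=\bigcup_{i\in I}\hat E_i$, and let $G_\beta=(V,m,E,a_\beta)$, $\beta\in[0,\infty)$, be a family of undirected graphs with $a_0=a$, such that for $\tilde\beta>\beta$ one has $a_{\tilde\beta}(i,j)=a(i,j)$ if $(i,j)\in E\setminus\hat E$ and $a_{\tilde\beta}(i,j)>a_\beta(i,j)$ if $(i,j)\in\hat E$, and such that $a_\beta(i,j)\to\infty$ as $\beta\to\infty$ for every $(i,j)\in\hat E$. Let $L_\beta$ be the Laplacian of $G_\beta$, $L_{\hat E,\beta}$ the Laplacian of $(V,m,\hat E,a_\beta\chi_{\hat E})$ with spectral gap $\gamma(L_{\hat E,\beta})$, and $\underline L$ the Laplacian of the reduced graph $\underline G$. Then for every $t>0$ there are a constant $C>0$ independent of $\beta$ and a bounded continuous function $F:[0,\infty)\to[0,\infty)$ with $F(\gamma)\to0$ as $\gamma\to\infty$ such that for all $\beta$ $$\big\|e^{-tL_\beta}-J_\uparrow e^{-t\underline L}J_\downarrow\big\|\le C\,F\big(\gamma(L_{\hat E,\beta})\big).$$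
   Context: A weighted graph $G=(V,m,E,a)$ consists of an at most countably infinite vertex set $V$, node masses $m:V\to(0,\infty)$, a locally finite edge set $E\subseteq V\times V$, and a weight function $a:V\times V\to[0,\infty)$ with $a(v,w)>0$ iff $(v,w)\in E$. It is undirected if $E$ and $a$ are symmetric. $\ell^2(G)=\{f:V\to\mathbb C:\sum_v|f(v)|^2m(v)<\infty\}$ with $\langle f,g\rangle_{\ell^2(G)}=\sum_x\overline{f(x)}g(x)m(x)$. The graph Laplacian of an undirected graph is $[Lf](x)=\frac1{m(x)}\big(d(x)f(x)-\sum_{y}a(x,y)f(y)\big)$ with $d(x)=\sum_y a(x,y)$. Standing assumption: for each graph considered ($G$ and every $G_\beta$) there is a constant $C>0$ (possibly depending on the graph) with $d(v)\le C\,m(v)$ for all $v$; thus all Laplacians are bounded on $\ell^2(G)$. Collection of undirected clusters: a countable family of (symmetric, nonempty) edge sets $\hat E_i\subseteq E$, $i\in I$, with node sets $V_i$ (the set of vertices incident to an edge of $\hat E_i$), such that (i) $\sum_{v\in V_i}m(v)<\infty$ for each $i$; (ii) the $V_i$ are pairwise disjoint; (iii) each $(V_i,\hat E_i)$ is connected. Reduced graph $\underline G=(\underline V,\underline m,\underline E,\underline a)$: $\underline V$ is the set of connected components $C\subseteq V$ of $(V,\hat E)$ (a component may be a single vertex not incident to any edge of $\hat E$); $\underline m(C)=\sum_{v\in C}m(v)$; $\underline a(C,D)=\sum_{v\in C,\,w\in D}a(v,w)$; $\underline E=\{(C,D):\underline a(C,D)>0\}$. Its Laplacian $\underline L$ acts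 on $\ell^2(\underline G)$ by the same formula. $J_\downarrow:\ell^2(G)\to\ell^2(\underline G)$, $[J_\downarrow f](C)=\langle\chi_C,f\rangle_{\ell^2(G)}/\underline m(C)$, and $J_\uparrow:\ell^2(\underline G)\to\ell^2(G)$, $J_\uparrow\underline f=\sum_{C\in\underline V}\underline f(C)\chi_C$, where $\chi_C$ is the indicator function of $C$. The spectral gap of a non-negative operator $L$ is $\gamma(L)=\inf(\sigma(L)\setminus\{0\})$, where it is understood that $L_{\hat E,\beta}\neq0$. *)

theory Defs
  imports "HOL-Analysis.Analysis"
begin

section \<open>Weighted graphs\<close>

record 'v wgraph =
  verts :: "'v set"
  mass :: "'v \<Rightarrow> real"
  edges :: "('v \<times> 'v) set"
  weight :: "'v \<Rightarrow> 'v \<Rightarrow> real"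

definition weighted_graph :: "'v wgraph \<Rightarrow> bool" where
  "weighted_graph G \<longleftrightarrow>
     countable (verts G) \<and>
     (\<forall>v\<in>verts G. mass G v > 0) \<and>
     edges G \<subseteq> verts G \<times> verts G \<and>
     (\<forall>v\<in>verts G. finite {e \<in> edges G. fst e = v \<or> snd e = v}) \<and>
     (\<forall>v\<in>verts G. \<forall>w\<in>verts G. weight G v w \<ge> 0 \<and> (weight G v w > 0 \<longleftrightarrow> (v, w) \<in> edges G))"

definition undirected :: "'v wgraph \<Rightarrow> bool" where
  "undirected G \<longleftrightarrow>
     sym (edges G) \<and> (\<forall>v\<in>verts G. \<forall>w\<in>verts G. weight G v w = weight G w v)"

definition degree :: "'v wgraph \<Rightarrow> 'v \<Rightarrow> real" where
  "degree G x = (\<Sum>\<^sub>\<infinity>y\<in>verts G. weight G x y)"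

definition degree_bounded :: "'v wgraph \<Rightarrow> bool" where
  "degree_bounded G \<longleftrightarrow> (\<exists>C>0. \<forall>v\<in>verts G. degree G v \<le> C * mass G v)"

section \<open>The weighted sequence space and operators on it\<close>

text \<open>A function on the vertex set is represented by a total function vanishing off the vertex set,
  so that equality in \<^term>\<open>ell2 G\<close> is equality of functions.\<close>

definition ell2 :: "'v wgraph \<Rightarrow> ('v \<Rightarrow> complex) set" where
  "ell2 G = {f. (\<forall>x. x \<notin> verts G \<longrightarrow> f x = 0) \<and>
                (\<lambda>x. (cmod (f x))\<^sup>2 * mass G x) summable_on verts G}"

definition ell2_inner :: "'v wgraph \<Rightarrow> ('v \<Rightarrow> complex) \<Rightarrow> ('v \<Rightarrow> complex) \<Rightarrow> complex" where
  "ell2_inner G f g = (\<Sum>\<^sub>\<infinity>x\<in>verts G. cnj (f x) * g x * of_real (mass G x))"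

definition ell2_norm :: "'v wgraph \<Rightarrow> ('v \<Rightarrow> complex) \<Rightarrow> real" where
  "ell2_norm G f = sqrt (\<Sum>\<^sub>\<infinity>x\<in>verts G. (cmod (f x))\<^sup>2 * mass G x)"

definition bounded_operator ::
  "'v wgraph \<Rightarrow> (('v \<Rightarrow> complex) \<Rightarrow> ('v \<Rightarrow> complex)) \<Rightarrow> bool" where
  "bounded_operator G T \<longleftrightarrow>
     (\<forall>f\<in>ell2 G. T f \<in> ell2 G) \<and>
     (\<forall>f\<in>ell2 G. \<forall>g\<in>ell2 G. T (\<lambda>x. f x + g x) = (\<lambda>x. T f x + T g x)) \<and>
     (\<forall>c. \<forall>f\<in>ell2 G. T (\<lambda>x. c * f x) = (\<lambda>x. c * T f x)) \<and>
     (\<exists>K. \<forall>f\<in>ell2 G. ell2_norm G (T f) \<le> K * ell2_norm G f)"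

text \<open>As for \<^const>\<open>onorm\<close>, this is meaningful for bounded operators only.\<close>

definition operator_norm ::
  "'v wgraph \<Rightarrow> (('v \<Rightarrow> complex) \<Rightarrow> ('v \<Rightarrow> complex)) \<Rightarrow> real" where
  "operator_norm G T = (SUP f\<in>ell2 G. ell2_norm G (T f) / ell2_norm G f)"

text \<open>The exponential series of an operator. For bounded \<open>T\<close> it converges in operator norm, hence,
  point evaluations being continuous, at every \<open>f\<close> and \<open>x\<close>.\<close>

definition operator_exp ::
  "(('v \<Rightarrow> complex) \<Rightarrow> ('v \<Rightarrow> complex)) \<Rightarrow> ('v \<Rightarrow> complex) \<Rightarrow> ('v \<Rightarrow> complex)" where
  "operator_exp T f = (\<lambda>x. \<Sum>n. (T ^^ n) f x / fact n)"

definition spectrum ::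
  "'v wgraph \<Rightarrow> (('v \<Rightarrow> complex) \<Rightarrow> ('v \<Rightarrow> complex)) \<Rightarrow> complex set" where
  "spectrum G T = {z. \<nexists>R. bounded_operator G R \<and>
     (\<forall>f\<in>ell2 G. R (\<lambda>x. T f x - z * f x) = f \<and> (\<lambda>x. T (R f) x - z * R f x) = f)}"

text \<open>Only used for non-negative operators, whose spectrum is contained in the reals. The infimum is
  over a nonempty set as soon as \<open>T\<close> is not zero.\<close>

definition spectral_gap ::
  "'v wgraph \<Rightarrow> (('v \<Rightarrow> complex) \<Rightarrow> ('v \<Rightarrow> complex)) \<Rightarrow> real" where
  "spectral_gap G T = Inf {r::real. complex_of_real r \<in> spectrum G T - {0}}"

definition laplacian :: "'v wgraph \<Rightarrow> ('v \<Rightarrow> complex) \<Rightarrow> ('v \<Rightarrow> complex)" where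
  "laplacian G f = (\<lambda>x. if x \<in> verts G
     then 1 / of_real (mass G x) *
       (of_real (degree G x) * f x - (\<Sum>\<^sub>\<infinity>y\<in>verts G. of_real (weight G x y) * f y))
     else 0)"

definition heat :: "'v wgraph \<Rightarrow> real \<Rightarrow> ('v \<Rightarrow> complex) \<Rightarrow> ('v \<Rightarrow> complex)" where
  "heat G t = operator_exp (\<lambda>f x. - of_real t * laplacian G f x)"

section \<open>Clusters and the reduced graph\<close>

text \<open>\<^term>\<open>Field F\<close> is the set of vertices incident to an edge of \<open>F\<close>.\<close>

definition undirected_clusters ::
  "'v wgraph \<Rightarrow> 'i set \<Rightarrow> ('i \<Rightarrow> ('v \<times> 'v) set) \<Rightarrow> bool" where
  "undirected_clusters G I Eh \<longleftrightarrow>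
     countable I \<and>
     (\<forall>i\<in>I. Eh i \<noteq> {} \<and> Eh i \<subseteq> edges G \<and> sym (Eh i)) \<and>
     (\<forall>i\<in>I. mass G summable_on Field (Eh i)) \<and>
     disjoint_family_on (\<lambda>i. Field (Eh i)) I \<and>
     (\<forall>i\<in>I. \<forall>u\<in>Field (Eh i). \<forall>w\<in>Field (Eh i). (u, w) \<in> (Eh i)\<^sup>*)"

definition restrict_edges :: "'v wgraph \<Rightarrow> ('v \<times> 'v) set \<Rightarrow> 'v wgraph" where
  "restrict_edges G F =
     G\<lparr>edges := F, weight := (\<lambda>v w. weight G v w * indicator F (v, w))\<rparr>"

text \<open>For symmetric \<open>F\<close>, the relation \<^term>\<open>F\<^sup>*\<close> is an equivalence relation.\<close>

definition components :: "'v set \<Rightarrow> ('v \<times> 'v) set \<Rightarrow> 'v set set" where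
  "components V F = (\<lambda>v. {w \<in> V. (v, w) \<in> F\<^sup>*}) ` V"

definition reduced_weight :: "'v wgraph \<Rightarrow> 'v set \<Rightarrow> 'v set \<Rightarrow> real" where
  "reduced_weight G C D = (\<Sum>\<^sub>\<infinity>(v, w)\<in>C \<times> D. weight G v w)"

definition reduced_graph :: "'v wgraph \<Rightarrow> ('v \<times> 'v) set \<Rightarrow> 'v set wgraph" where
  "reduced_graph G F =
     \<lparr>verts = components (verts G) F,
      mass = (\<lambda>C. \<Sum>\<^sub>\<infinity>v\<in>C. mass G v),
      edges = {(C, D). C \<in> components (verts G) F \<and> D \<in> components (verts G) F \<and>
                       reduced_weight G C D > 0},
      weight = reduced_weight G\<rparr>"

definition J_down ::
  "'v wgraph \<Rightarrow> ('v \<times> 'v) set \<Rightarrow> ('v \<Rightarrow> complex) \<Rightarrow> ('v set \<Rightarrow> complex)" where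
  "J_down G F f = (\<lambda>C. if C \<in> verts (reduced_graph G F)
     then ell2_inner G (indicator C) f / of_real (mass (reduced_graph G F) C) else 0)"

definition J_up ::
  "'v wgraph \<Rightarrow> ('v \<times> 'v) set \<Rightarrow> ('v set \<Rightarrow> complex) \<Rightarrow> ('v \<Rightarrow> complex)" where
  "J_up G F g = (\<lambda>x. \<Sum>\<^sub>\<infinity>C\<in>verts (reduced_graph G F). g C * indicator C x)"

end

theory Submission
  imports Defs
begin

text \<open>Write \<open>L\<^sub>\<beta> = A + B\<^sub>\<beta>\<close> with \<open>B\<^sub>\<beta>\<close> the Laplacian of the cluster edges. The projection
  \<open>P = J\<^sub>\<up> J\<^sub>\<down>\<close> onto cluster-constant functions is the projection onto the kernel of \<open>B\<^sub>\<beta>\<close>, so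
  \<open>L\<^sub>\<beta> P = L\<^sub>0 P\<close> is bounded uniformly in \<open>\<beta>\<close>, and \<open>J\<^sub>\<up> exp (- t L) J\<^sub>\<down>\<close> for the reduced Laplacian
  is \<open>exp (- t P L\<^sub>\<beta> P) P\<close>. A spectral gap \<open>\<gamma>\<close> gives \<open>\<gamma> \<parallel>u - P u\<parallel>\<^sup>2 \<le> 2 \<langle>L\<^sub>\<beta> u, u\<rangle>\<close>; along the heat flow
  the energy on the right is at most \<open>\<parallel>f\<parallel>\<^sup>2 / (2 s)\<close> at time \<open>s\<close>, so \<open>u - P u\<close> is of order \<open>1 / sqrt (\<gamma> s)\<close>,
  which is integrable at \<open>0\<close>. Duhamel's formula then yields the rate \<open>1 / sqrt \<gamma>\<close>, while for small \<open>\<gamma>\<close>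
  both semigroups are contractions.\<close>

section \<open>Positive operators and spectral gaps\<close>

text \<open>No spectral theorem or functional calculus is used. A spectral gap is known only through
  bounded resolvents; a quadratic polynomial argument turns it into
  \<open>\<gamma> B \<le> B^2\<close>, and an iteration turns that into coercivity off the kernel.
  The factor \<open>2\<close> in the gap inequality is the loss in the decay rate of this iteration.
  All estimates live in a real Hilbert space, complex sequences with the real part of the inner
  product. Symmetry is therefore a separate clause of positivity, since on a real space it does not
  follow from a nonnegative form, and complex linearity is recovered separately wherever an operator
  on the graph has to be bounded in the complex sense. The norm of \<open>L\<^sub>\<beta>\<close> is
  not bounded uniformly in \<open>\<beta>\<close>, so in Duhamel's formula the full generator may
  only ever meet vectors in the range of \<open>P\<close>; symmetry is what moves it there. A
  cluster may be infinite, and then a vertex of the reduced graph may have infinitely many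
  neighbours. The reduced Laplacian is thus never studied by itself: its powers are expressed
  through a compressed operator on the original graph.\<close>

definition positive_operator :: "('a::real_inner \<Rightarrow> 'a) \<Rightarrow> bool" where
  "positive_operator T \<longleftrightarrow>
     bounded_linear T \<and> (\<forall>x y. T x \<bullet> y = x \<bullet> T y) \<and> (\<forall>x. 0 \<le> T x \<bullet> x)"

lemma positive_operatorD:
  assumes "positive_operator T"
  shows "bounded_linear T" "T x \<bullet> y = x \<bullet> T y" "0 \<le> T x \<bullet> x"
  using assms by (auto simp: positive_operator_def)

text \<open>The quadratic polynomial \<open>r \<mapsto> T (x - r y) \<bullet> (x - r y)\<close> is
  nonnegative, so its discriminant is not positive. The form may be degenerate, so a vanishing
  leading coefficient is treated apart.\<close>

lemma positive_operator_Cauchy_Schwarz: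
  assumes "positive_operator T"
  shows "(T x \<bullet> y)\<^sup>2 \<le> (T x \<bullet> x) * (T y \<bullet> y)"
proof -
  interpret T: bounded_linear T by (rule positive_operatorD[OF assms])
  let ?a = "T x \<bullet> x" and ?b = "T x \<bullet> y" and ?c = "T y \<bullet> y"
  have adj: "T y \<bullet> x = ?b"
    by (metis assms inner_commute positive_operatorD(2))
  have quad: "0 \<le> ?a - 2 * r * ?b + r\<^sup>2 * ?c" for r
  proof -
    have "0 \<le> T (x - r *\<^sub>R y) \<bullet> (x - r *\<^sub>R y)"
      by (rule positive_operatorD[OF assms])
    also have "\<dots> = ?a - 2 * r * ?b + r\<^sup>2 * ?c"
      by (simp add: T.diff T.scaleR inner_diff_left inner_diff_right adj power2_eq_square algebra_simps)
    finally show ?thesis .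
  qed
  show ?thesis
  proof (cases "?c = 0")
    case True
    have "?b = 0"
    proof (rule ccontr)
      assume "?b \<noteq> 0"
      \<comment> \<open>Without its leading term the polynomial is linear in \<open>r\<close>, and
        this \<open>r\<close> gives it the value \<open>-1\<close>.\<close>
      then show False using quad[of "(?a + 1) / (2 * ?b)"] True by (simp add: field_simps)
    qed
    then show ?thesis using True by simp
  next
    case False
    then have c: "?c > 0" using positive_operatorD(3)[OF assms, of y] by simp
    have "0 \<le> ?a - ?b\<^sup>2 / ?c"
      using quad[of "?b / ?c"] c by (simp add: field_simps power2_eq_square)
    then show ?thesis using c by (simp add: field_simps)
  qed
qed

text \<open>The form inequality \<open>T^2 \<le> K T\<close>, obtained without square roots of
  operators: Cauchy-Schwarz for the form of \<open>T\<close> at the pair \<open>x\<close>,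
  \<open>T x\<close> produces an extra factor \<open>norm (T x)^2\<close> on both sides, which
  cancels.\<close>

lemma positive_operator_norm_image:
  assumes T: "positive_operator T" and K: "\<And>x. norm (T x) \<le> K * norm x"
  shows "(norm (T x))\<^sup>2 \<le> K * (T x \<bullet> x)"
proof (cases "T x = 0")
  case False
  let ?n = "(norm (T x))\<^sup>2"
  have "?n\<^sup>2 = (T x \<bullet> T x)\<^sup>2" by (simp add: dot_square_norm)
  also have "\<dots> \<le> (T x \<bullet> x) * (T (T x) \<bullet> T x)"
    by (rule positive_operator_Cauchy_Schwarz[OF T])
  also have "\<dots> \<le> (T x \<bullet> x) * (norm (T (T x)) * norm (T x))"
    by (intro mult_left_mono norm_cauchy_schwarz positive_operatorD[OF T])
  also have "\<dots> \<le> (T x \<bullet> x) * (K * norm (T x) * norm (T x))"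
    by (intro mult_left_mono mult_right_mono K positive_operatorD[OF T]) auto
  also have "\<dots> = ?n * (K * (T x \<bullet> x))" by (simp add: power2_eq_square)
  finally have "?n * ?n \<le> ?n * (K * (T x \<bullet> x))" by (simp only: power2_eq_square[of ?n])
  moreover have "?n > 0" using False by simp
  ultimately show ?thesis by (simp only: mult_le_cancel_left_pos)
qed (use positive_operatorD(3)[OF T, of x] in simp)

text \<open>Because \<open>norm (T x)^2 \<le> K * (T x \<bullet> x)\<close>, a lower bound in norm
  passes to the quadratic form, with constant \<open>c^2 / K\<close>.\<close>

lemma positive_operator_coercive:
  assumes T: "positive_operator T" and c: "c > 0" "\<And>x. c * norm x \<le> norm (T x)"
  obtains d where "d > 0" "\<And>x. d * (norm x)\<^sup>2 \<le> T x \<bullet> x"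
proof -
  obtain K where K: "K > 0" "\<And>x. norm (T x) \<le> norm x * K"
    using bounded_linear.pos_bounded[OF positive_operatorD(1)[OF T]] by blast
  show ?thesis
  proof
    show "c\<^sup>2 / K > 0" using c K by simp
    fix x
    have "c\<^sup>2 * (norm x)\<^sup>2 \<le> (norm (T x))\<^sup>2"
      using power_mono[OF c(2)[of x], of 2] c(1) by (simp add: power_mult_distrib)
    also have "\<dots> \<le> K * (T x \<bullet> x)"
      by (rule positive_operator_norm_image[OF T]) (use K in \<open>simp add: mult.commute\<close>)
    finally show "c\<^sup>2 / K * (norm x)\<^sup>2 \<le> T x \<bullet> x" using K by (simp add: field_simps)
  qed
qed

lemma quadratic_form_ge:
  assumes "bounded_linear B" and m: "\<And>x. norm x = 1 \<Longrightarrow> m \<le> B x \<bullet> x"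
  shows "m * (norm x)\<^sup>2 \<le> B x \<bullet> x"
proof (cases "x = 0")
  case True then show ?thesis using bounded_linear.linear[OF assms(1)] by (simp add: linear_0)
next
  case False
  interpret B: bounded_linear B by fact
  have "m \<le> B (sgn x) \<bullet> sgn x" by (rule m) (simp add: norm_sgn False)
  also have "\<dots> = (B x \<bullet> x) / (norm x)\<^sup>2"
    by (simp add: sgn_div_norm B.scaleR power2_eq_square divide_inverse)
  finally show ?thesis using False by (simp add: field_simps)
qed

text \<open>If the form of \<open>B\<^sup>2 - \<gamma> B\<close> had a negative infimum \<open>\<mu>\<close>, then \<open>B\<^sup>2 - \<gamma> B - \<mu>\<close> would not be
  bounded below in norm; but either it is a sum of squares, or it factors as
  \<open>(B - z\<^sub>1) (B - z\<^sub>2)\<close> with both roots in the gap.\<close>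

lemma positive_operator_gap_square:
  assumes B: "positive_operator B" and g: "\<gamma> > 0"
    and gap: "\<And>z. 0 < z \<Longrightarrow> z < \<gamma> \<Longrightarrow> \<exists>c>0. \<forall>x. c * norm x \<le> norm (B x - z *\<^sub>R x)"
  shows "\<gamma> * (B x \<bullet> x) \<le> B x \<bullet> B x"
proof (rule ccontr)
  assume neg: "\<not> ?thesis"
  interpret B: bounded_linear B by (rule positive_operatorD[OF B])
  note adj = positive_operatorD(2)[OF B]
  define Q where "Q x = B (B x) - \<gamma> *\<^sub>R B x" for x
  have blQ: "bounded_linear Q" unfolding Q_def
    by (intro bounded_linear_sub bounded_linear_compose[of B B] bounded_linear_const_scaleR B.bounded_linear_axioms)
  have Qx: "Q x \<bullet> x = B x \<bullet> B x - \<gamma> * (B x \<bullet> x)" for x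
    by (simp add: Q_def inner_diff_left adj)
  obtain K where K: "K > 0" "\<And>x. norm (B x) \<le> norm x * K" using B.pos_bounded by blast
  define X where "X = (\<lambda>x. Q x \<bullet> x) ` {x. norm x = 1}"
  define \<mu> where "\<mu> = Inf X"
  have x0: "x \<noteq> 0" using neg by (auto simp: B.zero)
  have "Q x \<bullet> x < 0" using neg Qx by simp
  have bdd: "bdd_below X"
  proof (rule bdd_belowI)
    fix y assume "y \<in> X"
    then obtain x where x: "norm x = 1" "y = Q x \<bullet> x" by (auto simp: X_def)
    have "B x \<bullet> x \<le> norm (B x) * norm x" by (rule norm_cauchy_schwarz)
    then have "B x \<bullet> x \<le> K" using K(2)[of x] x by simp
    then have "\<gamma> * (B x \<bullet> x) \<le> \<gamma> * K" using g by simp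
    then show "- \<gamma> * K \<le> y" unfolding x Qx
      using inner_ge_zero[of "B x"] by linarith
  qed
  have "Q (sgn x) \<bullet> sgn x \<in> X" by (auto simp: X_def norm_sgn x0)
  then have "\<mu> \<le> Q (sgn x) \<bullet> sgn x" unfolding \<mu>_def using bdd by (rule cInf_lower)
  also have "\<dots> = (Q x \<bullet> x) * (inverse (norm x))\<^sup>2"
    by (simp add: sgn_div_norm bounded_linear.linear[OF blQ] linear_scale power2_eq_square)
  also have "\<dots> < 0" using x0 \<open>Q x \<bullet> x < 0\<close> by (simp add: mult_neg_pos)
  finally have mu: "\<mu> < 0" .
  define S where "S x = Q x - \<mu> *\<^sub>R x" for x
  have Qmu: "\<mu> * (norm x)\<^sup>2 \<le> Q x \<bullet> x" for x
    by (rule quadratic_form_ge[OF blQ])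
      (auto simp: \<mu>_def X_def intro!: cInf_lower bdd[unfolded X_def])
  have S: "positive_operator S" unfolding positive_operator_def
  proof (intro conjI allI)
    show "bounded_linear S" unfolding S_def
      by (intro bounded_linear_sub blQ bounded_linear_const_scaleR bounded_linear_ident)
    show "S x \<bullet> y = x \<bullet> S y" for x y
      by (simp add: S_def Q_def inner_diff_left inner_diff_right adj)
    show "0 \<le> S x \<bullet> x" for x using Qmu[of x]
      by (simp add: S_def inner_diff_left dot_square_norm)
  qed
  have "\<exists>c>0. \<forall>x. c * norm x \<le> norm (S x)"
  proof (cases "\<gamma>\<^sup>2 / 4 + \<mu> < 0")
    case True
    \<comment> \<open>Completing the square gives \<open>S = (B - \<gamma> / 2)^2 + c\<close> with
      \<open>c > 0\<close>.\<close>
    define c where "c = - (\<gamma>\<^sup>2 / 4 + \<mu>)"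
    have "c * norm x \<le> norm (S x)" for x
    proof (cases "x = 0")
      case False
      have "c * (norm x)\<^sup>2 \<le> (norm (B x - (\<gamma> / 2) *\<^sub>R x))\<^sup>2 + c * (norm x)\<^sup>2" by simp
      also have "\<dots> = S x \<bullet> x"
        unfolding S_def c_def power2_norm_eq_inner
        by (simp add: inner_diff_left inner_diff_right Qx inner_commute[of x "B x"] power2_eq_square field_simps)
      also have "\<dots> \<le> norm (S x) * norm x" by (rule norm_cauchy_schwarz)
      finally show ?thesis using False by (simp add: power2_eq_square)
    qed auto
    then show ?thesis using True by (intro exI[of _ c]) (auto simp: c_def)
  next
    case False
    \<comment> \<open>The roots of \<open>z^2 - \<gamma> z - \<mu>\<close> are
      \<open>\<gamma> / 2 - \<delta>\<close> and \<open>\<gamma> / 2 + \<delta>\<close>. As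
      \<open>\<mu>\<close> is negative, \<open>\<delta> < \<gamma> / 2\<close>, so both lie strictly
      inside the gap.\<close>
    define \<delta> where "\<delta> = sqrt (\<gamma>\<^sup>2 / 4 + \<mu>)"
    have d2: "\<delta>\<^sup>2 = \<gamma>\<^sup>2 / 4 + \<mu>" "\<delta> \<ge> 0" using False by (auto simp: \<delta>_def)
    have "\<delta>\<^sup>2 < (\<gamma> / 2)\<^sup>2" using mu d2 by (simp add: power_divide)
    then have d: "\<delta> < \<gamma> / 2" using g d2(2) by (intro power2_less_imp_less[of \<delta> "\<gamma>/2"]) auto
    obtain c1 where c1: "c1 > 0" "\<And>x. c1 * norm x \<le> norm (B x - (\<gamma> / 2 - \<delta>) *\<^sub>R x)"
      using gap[of "\<gamma> / 2 - \<delta>"] d d2(2) g by auto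
    obtain c2 where c2: "c2 > 0" "\<And>x. c2 * norm x \<le> norm (B x - (\<gamma> / 2 + \<delta>) *\<^sub>R x)"
      using gap[of "\<gamma> / 2 + \<delta>"] d d2(2) g by auto
    have "c1 * c2 * norm x \<le> norm (S x)" for x
    proof -
      define y where "y = B x - (\<gamma> / 2 + \<delta>) *\<^sub>R x"
      have "B y - (\<gamma> / 2 - \<delta>) *\<^sub>R y =
          B (B x) - (\<gamma> / 2 + \<delta>) *\<^sub>R B x - (\<gamma> / 2 - \<delta>) *\<^sub>R B x + ((\<gamma> / 2 - \<delta>) * (\<gamma> / 2 + \<delta>)) *\<^sub>R x"
        by (simp add: y_def B.diff B.scaleR scaleR_diff_right)
      also have "(\<gamma> / 2 - \<delta>) * (\<gamma> / 2 + \<delta>) = - \<mu>"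
        using d2 by (simp add: algebra_simps power2_eq_square)
      also have "B (B x) - (\<gamma> / 2 + \<delta>) *\<^sub>R B x - (\<gamma> / 2 - \<delta>) *\<^sub>R B x + (- \<mu>) *\<^sub>R x = S x"
        by (simp add: S_def Q_def algebra_simps flip: scaleR_add_left)
      finally have "S x = B y - (\<gamma> / 2 - \<delta>) *\<^sub>R y" by simp
      then have "c1 * norm y \<le> norm (S x)" using c1(2)[of y] by simp
      moreover have "c1 * (c2 * norm x) \<le> c1 * norm y"
        using c2(2)[of x] c1(1) by (simp add: y_def)
      ultimately show ?thesis by (simp add: mult.assoc)
    qed
    then show ?thesis using c1 c2 by (intro exI[of _ "c1 * c2"]) auto
  qed
  then obtain c where "c > 0" "\<And>x. c * norm x \<le> norm (S x)" by blast
  then obtain d where d: "d > 0" "\<And>x. d * (norm x)\<^sup>2 \<le> S x \<bullet> x"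
    using positive_operator_coercive[OF S] by metis
  \<comment> \<open>Coercivity of \<open>S\<close> lifts every value of the form of \<open>Q\<close>
    on the unit sphere by \<open>d\<close> above its infimum.\<close>
  have "\<mu> + d \<le> \<mu>" unfolding \<mu>_def
  proof (rule cInf_greatest)
    show "X \<noteq> {}" using \<open>Q (sgn x) \<bullet> sgn x \<in> X\<close> by auto
    fix y assume "y \<in> X"
    then obtain x where x: "norm x = 1" "y = Q x \<bullet> x" by (auto simp: X_def)
    show "Inf X + d \<le> y" using d(2)[of x] x
      by (simp add: S_def inner_diff_left dot_square_norm \<mu>_def)
  qed
  then show False using d by simp
qed

text \<open>The Landweber iteration \<open>u\<^sub>n\<^sub>+\<^sub>1 = u\<^sub>n - B u\<^sub>n / K\<close> converges to the projection onto the kernel,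
  here \<open>0\<close>, and the energy decreases geometrically along it.\<close>

lemma positive_operator_gap_orthogonal:
  fixes B :: "'a::{real_inner,banach} \<Rightarrow> 'a"
  assumes B: "positive_operator B" and g: "\<gamma> > 0"
    and sq: "\<And>x. \<gamma> * (B x \<bullet> x) \<le> B x \<bullet> B x"
    and orth: "\<And>y. B y = 0 \<Longrightarrow> x \<bullet> y = 0"
  shows "\<gamma> * (norm x)\<^sup>2 \<le> 2 * (B x \<bullet> x)"
proof -
  interpret B: bounded_linear B by (rule positive_operatorD[OF B])
  note adj = positive_operatorD(2)[OF B] and pos = positive_operatorD(3)[OF B]
  obtain K0 where K0: "K0 > 0" "\<And>x. norm (B x) \<le> norm x * K0" using B.pos_bounded by blast
  \<comment> \<open>The summand \<open>1\<close> makes \<open>K\<close> strictly larger than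
    \<open>\<gamma>\<close>, so that \<open>q = 1 - \<gamma> / K\<close> is positive.\<close>
  define K where "K = max K0 \<gamma> + 1"
  have K: "K > 0" "\<gamma> < K" using K0 g by (auto simp: K_def)
  have KB: "norm (B x) \<le> K * norm x" for x
  proof -
    have "norm (B x) \<le> norm x * K0" by (rule K0)
    also have "\<dots> \<le> norm x * K" by (rule mult_left_mono) (auto simp: K_def)
    finally show ?thesis by (simp add: mult.commute)
  qed
  define c where "c = 1 / K"
  define q where "q = 1 - c * \<gamma>"
  have c: "c > 0" and q: "0 < q" "q < 1" using K g by (auto simp: c_def q_def field_simps)
  define u where "u n = ((\<lambda>v. v - c *\<^sub>R B v) ^^ n) x" for n
  have u0: "u 0 = x" and uS: "u (Suc n) = u n - c *\<^sub>R B (u n)" for n by (auto simp: u_def)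
  define \<phi> where "\<phi> n = B (u n) \<bullet> u n" for n
  have nB: "(norm (B v))\<^sup>2 \<le> K * (B v \<bullet> v)" for v
    by (rule positive_operator_norm_image[OF B KB])
  \<comment> \<open>After expansion the coefficient of \<open>norm (B (u n))^2\<close> is at most
    \<open>- 2 c + c^2 K = - c\<close>, and \<open>sq\<close> bounds that square from below by
    \<open>\<gamma>\<close> times the energy.\<close>
  have step: "\<phi> (Suc n) \<le> q * \<phi> n" for n
  proof -
    let ?v = "B (u n)"
    have "\<phi> (Suc n) = \<phi> n - 2 * c * (?v \<bullet> ?v) + c\<^sup>2 * (B ?v \<bullet> ?v)"
      by (simp add: \<phi>_def uS B.diff B.scaleR inner_diff_left inner_diff_right adj power2_eq_square algebra_simps)
    also have "B ?v \<bullet> ?v \<le> norm (B ?v) * norm ?v" by (rule norm_cauchy_schwarz)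
    also have "\<dots> \<le> K * norm ?v * norm ?v" by (intro mult_right_mono KB) auto
    also have "c\<^sup>2 * (K * norm ?v * norm ?v) = c * (?v \<bullet> ?v)"
      using K by (simp add: c_def power2_eq_square field_simps flip: norm_eq_square power2_norm_eq_inner)
    also have "\<phi> n - 2 * c * (?v \<bullet> ?v) + c * (?v \<bullet> ?v) = \<phi> n - c * (?v \<bullet> ?v)" by simp
    also have "\<dots> \<le> \<phi> n - c * (\<gamma> * \<phi> n)"
      using mult_left_mono[OF sq[of "u n"], of c] c by (simp add: \<phi>_def)
    finally show ?thesis using c by (simp add: q_def algebra_simps)
  qed
  have geo: "\<phi> n \<le> q ^ n * \<phi> 0" for n
  proof (induction n)
    case (Suc n)
    have "\<phi> (Suc n) \<le> q * \<phi> n" by (rule step)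
    also have "\<dots> \<le> q * (q ^ n * \<phi> 0)" using Suc q by (intro mult_left_mono) auto
    finally show ?case by simp
  qed simp
  \<comment> \<open>The increments are controlled by the square root of the energy and so decay like
    \<open>sqrt q ^ n\<close>; completeness then provides the limit.\<close>
  have "summable (\<lambda>n. u (Suc n) - u n)"
  proof (rule summable_comparison_test')
    show "summable (\<lambda>n. c * sqrt (K * \<phi> 0) * (sqrt q) ^ n)"
      using q by (intro summable_mult summable_geometric) auto
    fix n
    have "(norm (B (u n)))\<^sup>2 \<le> K * \<phi> n" unfolding \<phi>_def by (rule nB)
    also have "\<dots> \<le> K * (q ^ n * \<phi> 0)" using geo K by simp
    finally have "norm (B (u n)) \<le> sqrt (K * (q ^ n * \<phi> 0))" by (rule real_le_rsqrt)
    also have "\<dots> = sqrt (K * \<phi> 0) * sqrt q ^ n" by (simp add: real_sqrt_mult real_sqrt_power)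
    finally have "c * norm (B (u n)) \<le> c * (sqrt (K * \<phi> 0) * sqrt q ^ n)" using c by simp
    then show "norm (u (Suc n) - u n) \<le> c * sqrt (K * \<phi> 0) * (sqrt q) ^ n"
      using c by (simp add: uS)
  qed
  then have "convergent (\<lambda>n. \<Sum>k<n. u (Suc k) - u k)" by (simp add: summable_iff_convergent)
  then obtain w0 where "(\<lambda>n. \<Sum>k<n. u (Suc k) - u k) \<longlonglongrightarrow> w0" by (auto simp: convergent_def)
  then have "(\<lambda>n. (u n - x) + x) \<longlonglongrightarrow> w0 + x"
    by (intro tendsto_add tendsto_const) (simp add: sum_lessThan_telescope u0)
  then obtain w where w: "u \<longlonglongrightarrow> w" by auto
  have "(\<lambda>n. q ^ n * \<phi> 0) \<longlonglongrightarrow> 0 * \<phi> 0" using q by (intro tendsto_mult tendsto_const LIMSEQ_realpow_zero) auto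
  moreover have "(\<lambda>n. B (u n) \<bullet> u n) \<longlonglongrightarrow> B w \<bullet> w" by (intro tendsto_inner B.tendsto w)
  ultimately have "B w \<bullet> w \<le> 0"
    using geo by (intro LIMSEQ_le[of "\<lambda>n. B (u n) \<bullet> u n" _ "\<lambda>n. q ^ n * \<phi> 0"]) (auto simp: \<phi>_def)
  then have "B w \<bullet> w = 0" using pos[of w] by linarith
  then have Bw: "B w = 0" using nB[of w] by simp
  \<comment> \<open>The increments lie in the range of \<open>B\<close>, which is orthogonal to the
    kernel vector \<open>w\<close>. Every iterate keeps the inner product \<open>0\<close> with
    \<open>w\<close> that \<open>x\<close> has by hypothesis, so the limit \<open>w\<close> is
    orthogonal to itself.\<close>
  have uw: "u n \<bullet> w = 0" for n
  proof (induction n)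
    case 0 show ?case unfolding u0 by (rule orth[OF Bw])
  next
    case (Suc n)
    have "B (u n) \<bullet> w = 0" by (simp only: adj[of "u n" w] Bw inner_zero_right)
    then show ?case by (simp add: uS inner_diff_left Suc.IH)
  qed
  have "(\<lambda>n. u n \<bullet> w) \<longlonglongrightarrow> w \<bullet> w" by (intro tendsto_inner w tendsto_const)
  then have "w = 0" by (simp add: uw LIMSEQ_const_iff)
  then have lim: "(\<lambda>n. (norm x)\<^sup>2 - (norm (u n))\<^sup>2) \<longlonglongrightarrow> (norm x)\<^sup>2 - (norm (0::'a))\<^sup>2"
    using w by (intro tendsto_intros) auto
  \<comment> \<open>Since \<open>1 - q = c * \<gamma>\<close>, these bounds sum to at most
    \<open>2 * \<phi> 0 / \<gamma>\<close>. The factor \<open>2\<close> stems from the rate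
    \<open>q\<close> in \<open>step\<close>, where half of the first-order decrease is spent on the
    second-order term.\<close>
  have dec: "(norm (u n))\<^sup>2 - (norm (u (Suc n)))\<^sup>2 \<le> 2 * c * \<phi> 0 * q ^ n" for n
  proof -
    have "(norm (u n))\<^sup>2 - (norm (u (Suc n)))\<^sup>2 = 2 * c * \<phi> n - c\<^sup>2 * (B (u n) \<bullet> B (u n))"
      unfolding power2_norm_eq_inner uS \<phi>_def
      by (simp add: inner_diff_left inner_diff_right inner_commute[of "u n" "B (u n)"] power2_eq_square algebra_simps)
    also have "\<dots> \<le> 2 * c * \<phi> n" by simp
    also have "\<dots> \<le> 2 * c * (q ^ n * \<phi> 0)" using geo c by simp
    finally show ?thesis by (simp add: mult_ac)
  qed
  have "(norm x)\<^sup>2 - (norm (u n))\<^sup>2 \<le> 2 * c * \<phi> 0 / (1 - q)" for n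
  proof -
    have "(norm x)\<^sup>2 - (norm (u n))\<^sup>2 = (\<Sum>k<n. (norm (u k))\<^sup>2 - (norm (u (Suc k)))\<^sup>2)"
      using sum_lessThan_telescope'[of "\<lambda>k. (norm (u k))\<^sup>2" n] by (simp add: u0)
    also have "\<dots> \<le> (\<Sum>k<n. 2 * c * \<phi> 0 * q ^ k)" by (intro sum_mono dec)
    also have "\<dots> = 2 * c * \<phi> 0 * (\<Sum>k<n. q ^ k)" by (simp add: sum_distrib_left)
    also have "(\<Sum>k<n. q ^ k) \<le> 1 / (1 - q)"
      using q by (simp add: sum_gp_strict divide_right_mono)
    finally show ?thesis using c pos by (simp add: \<phi>_def mult_left_mono)
  qed
  then have "(norm x)\<^sup>2 - (norm (0::'a))\<^sup>2 \<le> 2 * c * \<phi> 0 / (1 - q)"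
    by (intro LIMSEQ_le_const2[OF lim]) auto
  also have "2 * c * \<phi> 0 / (1 - q) = 2 * \<phi> 0 / \<gamma>" using c g by (simp add: q_def field_simps)
  finally show ?thesis using g by (simp add: field_simps \<phi>_def u0)
qed

section \<open>Heat semigroups\<close>

text \<open>Time is a separate real argument, so that the flow can be differentiated in it; heat
  flows are values at \<open>- t\<close>.\<close>

definition op_exp :: "('a::real_normed_vector \<Rightarrow> 'a) \<Rightarrow> real \<Rightarrow> 'a \<Rightarrow> 'a" where
  "op_exp T t x = (\<Sum>n. (t ^ n / fact n) *\<^sub>R (T ^^ n) x)"

lemma norm_funpow_le:
  fixes T :: "'a::real_normed_vector \<Rightarrow> 'a"
  assumes "K \<ge> 0" "\<And>x. norm (T x) \<le> norm x * K"
  shows "norm ((T ^^ n) x) \<le> K ^ n * norm x"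
proof (induction n)
  case (Suc n)
  have "norm (T ((T ^^ n) x)) \<le> norm ((T ^^ n) x) * K" by (rule assms)
  also have "\<dots> \<le> (K ^ n * norm x) * K" using Suc assms(1) by (rule mult_right_mono)
  finally show ?case by (simp add: mult_ac)
qed simp

text \<open>The majorant depends on \<open>t\<close> only through \<open>r\<close>. It thus serves
  pointwise convergence as well as the uniform convergence behind termwise differentiation.\<close>

lemma op_exp_term_bound:
  fixes T :: "'a::real_normed_vector \<Rightarrow> 'a"
  assumes "K \<ge> 0" "\<And>x. norm (T x) \<le> norm x * K" "\<bar>t\<bar> \<le> r"
  shows "norm ((t ^ n / fact n) *\<^sub>R (T ^^ n) x) \<le> norm x * ((r * K) ^ n /\<^sub>R fact n)"
proof -
  have "norm ((t ^ n / fact n) *\<^sub>R (T ^^ n) x) = \<bar>t\<bar> ^ n * norm ((T ^^ n) x) / fact n"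
    by (simp add: power_abs)
  also have "\<dots> \<le> r ^ n * (K ^ n * norm x) / fact n"
    using assms by (intro divide_right_mono mult_mono power_mono norm_funpow_le) auto
  finally show ?thesis by (simp add: power_mult_distrib field_simps)
qed

lemma op_exp_sums:
  fixes T :: "'a::banach \<Rightarrow> 'a"
  assumes "bounded_linear T"
  shows "(\<lambda>n. (t ^ n / fact n) *\<^sub>R (T ^^ n) x) sums op_exp T t x"
proof -
  obtain K where K: "K > 0" "\<And>x. norm (T x) \<le> norm x * K"
    using bounded_linear.pos_bounded[OF assms] by blast
  have "summable (\<lambda>n. (t ^ n / fact n) *\<^sub>R (T ^^ n) x)"
  proof (rule summable_comparison_test')
    show "summable (\<lambda>n. norm x * ((\<bar>t\<bar> * K) ^ n /\<^sub>R fact n))"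
      by (intro summable_mult summable_exp_generic)
  qed (rule op_exp_term_bound, use K in auto)
  then show ?thesis unfolding op_exp_def by (rule summable_sums)
qed

lemma op_exp_0 [simp]: "op_exp T 0 x = x"
proof -
  have "(\<lambda>n. ((0::real) ^ n / fact n) *\<^sub>R (T ^^ n) x) = (\<lambda>n. if n = 0 then x else 0)" by auto
  then show ?thesis unfolding op_exp_def using suminf_finite[of "{0}" "\<lambda>n. if n = 0 then x else 0"] by simp
qed

text \<open>\<open>S\<close> will be \<open>T\<close> itself, which gives the derivative of the flow
  its usual form, or a projection commuting with \<open>T\<close>, which shows that the flow
  preserves the range of the projection.\<close>

lemma op_exp_commute:
  fixes T :: "'a::banach \<Rightarrow> 'a"
  assumes T: "bounded_linear T" and S: "bounded_linear S" and comm: "\<And>y. S (T y) = T (S y)"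
  shows "op_exp T t (S x) = S (op_exp T t x)"
proof -
  interpret S: bounded_linear S by fact
  have "S ((T ^^ n) x) = (T ^^ n) (S x)" for n by (induction n) (auto simp: comm)
  then have "(\<lambda>n. (t ^ n / fact n) *\<^sub>R (T ^^ n) (S x)) sums S (op_exp T t x)"
    using S.sums[OF op_exp_sums[OF T, of t x]] by (simp add: S.scaleR)
  then show ?thesis using op_exp_sums[OF T] sums_unique2 by blast
qed

lemma op_exp_adjoint:
  fixes T :: "'a::{real_inner,banach} \<Rightarrow> 'a"
  assumes T: "bounded_linear T" and adj: "\<And>x y. T x \<bullet> y = x \<bullet> T y"
  shows "op_exp T t x \<bullet> y = x \<bullet> op_exp T t y"
proof -
  have "(T ^^ n) x \<bullet> y = x \<bullet> (T ^^ n) y" for n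
  proof (induction n arbitrary: y)
    case (Suc n)
    then show ?case using adj[of "(T ^^ n) x" y] by (simp add: funpow_swap1)
  qed simp
  then have "(\<lambda>n. (t ^ n / fact n) *\<^sub>R (T ^^ n) x \<bullet> y) = (\<lambda>n. x \<bullet> (t ^ n / fact n) *\<^sub>R (T ^^ n) y)"
    by simp
  moreover have "(\<lambda>n. (t ^ n / fact n) *\<^sub>R (T ^^ n) x \<bullet> y) sums (op_exp T t x \<bullet> y)"
    by (rule bounded_linear.sums[OF bounded_linear_inner_left op_exp_sums[OF T]])
  moreover have "(\<lambda>n. x \<bullet> (t ^ n / fact n) *\<^sub>R (T ^^ n) y) sums (x \<bullet> op_exp T t y)"
    by (rule bounded_linear.sums[OF bounded_linear_inner_right op_exp_sums[OF T]])
  ultimately show ?thesis using sums_unique2 by metis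
qed

text \<open>The series is differentiated term by term on a ball containing \<open>t\<close>. The
  derivative series is the exponential series started at \<open>T x\<close>, and commutation moves
  \<open>T\<close> outside.\<close>

lemma op_exp_has_vector_derivative:
  fixes T :: "'a::banach \<Rightarrow> 'a"
  assumes T: "bounded_linear T"
  shows "((\<lambda>t. op_exp T t x) has_vector_derivative T (op_exp T t x)) (at t)"
proof -
  interpret T: bounded_linear T by fact
  obtain K where K: "K > 0" "\<And>x. norm (T x) \<le> norm x * K" using T.pos_bounded by blast
  define r where "r = \<bar>t\<bar> + 1"
  let ?S = "ball (0::real) r"
  let ?f = "\<lambda>n s. (s ^ n / fact n) *\<^sub>R (T ^^ n) x"
  let ?f' = "\<lambda>n s h. h *\<^sub>R ((real n * s ^ (n - 1) / fact n) *\<^sub>R (T ^^ n) x)"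
  \<comment> \<open>The constant term has derivative zero, so \<open>Suc n\<close> differentiated
    terms match \<open>n\<close> terms of the series at \<open>T x\<close>.\<close>
  have shift: "(\<Sum>i<Suc n. ?f' i s h) = h *\<^sub>R (\<Sum>i<n. (s ^ i / fact i) *\<^sub>R (T ^^ i) (T x))" for n s h
  proof -
    have "(\<Sum>i<Suc n. ?f' i s h) = (\<Sum>i<n. ?f' (Suc i) s h)"
      by (subst sum.lessThan_Suc_shift) simp
    also have "\<dots> = (\<Sum>i<n. h *\<^sub>R ((s ^ i / fact i) *\<^sub>R (T ^^ i) (T x)))"
    proof (rule sum.cong[OF refl])
      fix i
      have "real (Suc i) * s ^ i / fact (Suc i) = s ^ i / fact i"
        by (simp only: fact_Suc of_nat_mult) (simp del: of_nat_Suc)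
      then show "?f' (Suc i) s h = h *\<^sub>R ((s ^ i / fact i) *\<^sub>R (T ^^ i) (T x))"
        by (simp only: diff_Suc_1) (simp add: funpow_swap1)
    qed
    finally show ?thesis by (simp add: scaleR_sum_right)
  qed
  have unif: "uniform_limit ?S (\<lambda>n s. \<Sum>i<n. (s ^ i / fact i) *\<^sub>R (T ^^ i) (T x))
      (\<lambda>s. op_exp T s (T x)) sequentially"
    unfolding op_exp_def
  proof (rule Weierstrass_m_test)
    show "summable (\<lambda>n. norm (T x) * ((r * K) ^ n /\<^sub>R fact n))"
      by (intro summable_mult summable_exp_generic)
  qed (rule op_exp_term_bound, use K in auto)
  have "\<exists>g. \<forall>s\<in>?S. (\<lambda>n. ?f n s) sums g s \<and>
      (g has_derivative (\<lambda>h. h *\<^sub>R op_exp T s (T x))) (at s within ?S)"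
  proof (rule has_derivative_series)
    show "convex ?S" by simp
    show "0 \<in> ?S" by (simp add: r_def)
    show "(\<lambda>n. ?f n 0) sums op_exp T 0 x" by (rule op_exp_sums[OF T])
    fix n s assume "s \<in> ?S"
    have "((\<lambda>s. s ^ n / fact n) has_real_derivative real n * s ^ (n - 1) / fact n) (at s within ?S)"
      by (auto intro!: derivative_eq_intros)
    then have "((\<lambda>s. s ^ n / fact n) has_derivative (\<lambda>h. h * (real n * s ^ (n - 1) / fact n))) (at s within ?S)"
      unfolding has_field_derivative_def mult_commute_abs .
    from has_derivative_scaleR_left[OF this, of "(T ^^ n) x"]
    show "(?f n has_derivative ?f' n s) (at s within ?S)" by simp
  next
    fix e :: real assume "e > 0"
    then have "\<forall>\<^sub>F n in sequentially. \<forall>s\<in>?S.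
        dist (\<Sum>i<n. (s ^ i / fact i) *\<^sub>R (T ^^ i) (T x)) (op_exp T s (T x)) < e"
      using unif by (simp add: uniform_limit_iff)
    then have "\<forall>\<^sub>F n in sequentially. \<forall>s\<in>?S. \<forall>h.
        norm ((\<Sum>i<Suc n. ?f' i s h) - h *\<^sub>R op_exp T s (T x)) \<le> e * norm h"
    proof eventually_elim
      case (elim n)
      show ?case
      proof (intro ballI allI)
        fix s h assume "s \<in> ?S"
        then have "norm ((\<Sum>i<n. (s ^ i / fact i) *\<^sub>R (T ^^ i) (T x)) - op_exp T s (T x)) \<le> e"
          using elim by (auto simp: dist_norm intro: less_imp_le)
        then show "norm ((\<Sum>i<Suc n. ?f' i s h) - h *\<^sub>R op_exp T s (T x)) \<le> e * norm h"
          unfolding shift using mult_left_mono[of _ e "\<bar>h\<bar>"]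
          by (simp flip: scaleR_diff_right add: mult.commute[of e])
      qed
    qed
    then show "\<forall>\<^sub>F n in sequentially. \<forall>s\<in>?S. \<forall>h.
        norm ((\<Sum>i<n. ?f' i s h) - h *\<^sub>R op_exp T s (T x)) \<le> e * norm h"
      by (subst (asm) eventually_sequentially_Suc)
  qed
  then obtain g where g: "\<And>s. s \<in> ?S \<Longrightarrow> (\<lambda>n. ?f n s) sums g s"
      "\<And>s. s \<in> ?S \<Longrightarrow> (g has_derivative (\<lambda>h. h *\<^sub>R op_exp T s (T x))) (at s within ?S)" by blast
  have t: "t \<in> ?S" by (simp add: r_def)
  have "(g has_derivative (\<lambda>h. h *\<^sub>R op_exp T t (T x))) (at t)"
    using g(2)[OF t] unfolding at_within_open[OF t open_ball] .
  then have "((\<lambda>s. op_exp T s x) has_derivative (\<lambda>h. h *\<^sub>R op_exp T t (T x))) (at t)"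
  proof (rule has_derivative_transform_within_open[OF _ open_ball t])
    show "g s = op_exp T s x" if "s \<in> ?S" for s
      by (rule sums_unique2[OF g(1)[OF that] op_exp_sums[OF T]])
  qed
  moreover have "op_exp T t (T x) = T (op_exp T t x)" by (rule op_exp_commute[OF T T]) simp
  ultimately show ?thesis by (simp only: has_vector_derivative_def)
qed

lemma op_exp_minus_has_vector_derivative:
  fixes T :: "'a::banach \<Rightarrow> 'a"
  assumes "bounded_linear T"
  shows "((\<lambda>s. op_exp T (- s) x) has_vector_derivative - T (op_exp T (- s) x)) (at s)"
proof -
  have "((\<lambda>s. op_exp T s x) \<circ> uminus has_vector_derivative (- 1) *\<^sub>R T (op_exp T (- s) x)) (at s)"
    by (rule vector_diff_chain_at[of uminus "- 1" s])
      (auto intro!: derivative_eq_intros op_exp_has_vector_derivative[OF assms])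
  then show ?thesis by (simp add: o_def)
qed

text \<open>The left-hand side decreases along the flow: differentiating the factor \<open>s\<close>
  cancels the derivative of the squared norm, and \<open>- 4 s norm (H u)^2\<close> remains.\<close>

lemma heat_energy_bound:
  fixes H :: "'a::{real_inner,banach} \<Rightarrow> 'a"
  assumes H: "positive_operator H" and s: "s \<ge> 0"
  shows "(norm (op_exp H (- s) x))\<^sup>2 + 2 * s * (H (op_exp H (- s) x) \<bullet> op_exp H (- s) x) \<le> (norm x)\<^sup>2"
proof -
  interpret H: bounded_linear H by (rule positive_operatorD[OF H])
  note adj = positive_operatorD(2)[OF H]
  define u where "u s = op_exp H (- s) x" for s
  have du: "(u has_vector_derivative - H (u s)) (at s)" for s
    unfolding u_def by (rule op_exp_minus_has_vector_derivative[OF H.bounded_linear_axioms])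
  note dHu = H.has_vector_derivative[OF du]
  have d1: "((\<lambda>s. u s \<bullet> u s) has_real_derivative - 2 * (H (u s) \<bullet> u s)) (at s)" for s
    using bounded_bilinear.has_vector_derivative[OF bounded_bilinear_inner du du, of s]
    by (simp add: has_real_derivative_iff_has_vector_derivative inner_commute)
  have d2: "((\<lambda>s. H (u s) \<bullet> u s) has_real_derivative - 2 * (H (u s) \<bullet> H (u s))) (at s)" for s
    using bounded_bilinear.has_vector_derivative[OF bounded_bilinear_inner dHu du, of s]
    by (simp add: has_real_derivative_iff_has_vector_derivative H.neg adj)
  define \<psi> where "\<psi> s = u s \<bullet> u s + 2 * s * (H (u s) \<bullet> u s)" for s
  have "\<psi> s \<le> \<psi> 0"
  proof (rule DERIV_nonpos_imp_nonincreasing[OF s])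
    fix r assume r: "0 \<le> r" "r \<le> s"
    have "(\<psi> has_real_derivative - 4 * r * (H (u r) \<bullet> H (u r))) (at r)"
      unfolding \<psi>_def by (auto intro!: derivative_eq_intros d1 d2 simp: algebra_simps)
    moreover have "- 4 * r * (H (u r) \<bullet> H (u r)) \<le> 0" using r by simp
    ultimately show "\<exists>y. (\<psi> has_real_derivative y) (at r) \<and> y \<le> 0" by blast
  qed
  then show ?thesis by (simp add: \<psi>_def u_def power2_norm_eq_inner)
qed

lemma heat_contraction:
  fixes H :: "'a::{real_inner,banach} \<Rightarrow> 'a"
  assumes H: "positive_operator H" and s: "s \<ge> 0"
  shows "norm (op_exp H (- s) x) \<le> norm x"
proof -
  have "0 \<le> 2 * s * (H (op_exp H (- s) x) \<bullet> op_exp H (- s) x)"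
    using s positive_operatorD(3)[OF H] by simp
  then have "(norm (op_exp H (- s) x))\<^sup>2 \<le> (norm x)\<^sup>2" using heat_energy_bound[OF H s, of x] by linarith
  then show ?thesis by (rule power2_le_imp_le) simp
qed

section \<open>Orthogonal projections and the compressed heat flow\<close>

locale orthogonal_projection = bounded_linear P for P :: "'a::{real_inner,banach} \<Rightarrow> 'a" +
  assumes idem [simp]: "P (P x) = P x" and adj: "P x \<bullet> y = x \<bullet> P y"
begin

lemma norm_le: "norm (P x) \<le> norm x"
proof (cases "P x = 0")
  case False
  have "(norm (P x))\<^sup>2 = P x \<bullet> x" by (simp add: power2_norm_eq_inner adj inner_commute)
  also have "\<dots> \<le> norm (P x) * norm x" by (rule norm_cauchy_schwarz)
  finally show ?thesis using False by (simp add: power2_eq_square)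
qed simp

lemma norm_compl_le: "norm (x - P x) \<le> norm x"
proof -
  have "(norm (x - P x))\<^sup>2 = (norm x)\<^sup>2 - (norm (P x))\<^sup>2"
    unfolding power2_norm_eq_inner
    by (simp add: inner_diff_left inner_diff_right adj)
  then have "(norm (x - P x))\<^sup>2 \<le> (norm x)\<^sup>2" by simp
  then show ?thesis by (rule power2_le_imp_le) simp
qed

lemma positive_compression:
  assumes "positive_operator H"
  shows "positive_operator (\<lambda>x. P (H (P x)))"
  unfolding positive_operator_def
proof (intro conjI allI)
  show "bounded_linear (\<lambda>x. P (H (P x)))"
    by (rule bounded_linear_compose[OF bounded_linear_axioms
          bounded_linear_compose[OF positive_operatorD(1)[OF assms] bounded_linear_axioms]])
next
  fix x y
  show "P (H (P x)) \<bullet> y = x \<bullet> P (H (P y))"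
    by (simp only: adj positive_operatorD(2)[OF assms, of "P x"])
  show "0 \<le> P (H (P x)) \<bullet> x"
    using positive_operatorD(3)[OF assms, of "P x"] by (simp only: adj)
qed

text \<open>Duhamel's formula tested against \<open>y\<close>: along \<open>s \<mapsto> v s \<bullet> u (t - s)\<close>, with
  \<open>v\<close> the compressed and \<open>u\<close> the full heat flow, only \<open>u - P u\<close> enters the derivative, and
  that component is controlled by the energy, which decays like \<open>1 / s\<close>.\<close>

lemma heat_compression_bound:
  assumes H: "positive_operator H" and K: "K \<ge> 0" "\<And>x. norm (H (P x)) \<le> K * norm x"
    and g: "\<gamma> > 0" and gap: "\<And>x. \<gamma> * (norm (x - P x))\<^sup>2 \<le> 2 * (H x \<bullet> x)" and t: "t > 0"
  shows "norm (op_exp H (- t) x - op_exp (\<lambda>x. P (H (P x))) (- t) (P x))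
           \<le> (1 / sqrt t + 2 * K * sqrt t) / sqrt \<gamma> * norm x" (is "norm ?d \<le> _")
proof -
  define M where "M x = P (H (P x))" for x
  \<comment> \<open>The test vector is the error itself, so \<open>y \<bullet> y\<close> is the
    quantity to be bounded and one factor \<open>norm y\<close> cancels at the end.\<close>
  define y where "y = op_exp H (- t) x - op_exp M (- t) (P x)"
  have M: "positive_operator M" unfolding M_def by (rule positive_compression[OF H])
  note blH = positive_operatorD(1)[OF H] and adjH = positive_operatorD(2)[OF H]
  note blM = positive_operatorD(1)[OF M]
  define u where "u s = op_exp H (- s) y" for s
  define v where "v s = op_exp M (- s) (P x)" for s
  define c where "c = K * norm x * (norm y / sqrt \<gamma>)"
  have compl: "norm (u s - P (u s)) \<le> norm y / sqrt \<gamma> / sqrt s" if s: "s > 0" for s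
  proof -
    have "0 \<le> (norm (u s))\<^sup>2" by simp
    then have "2 * s * (H (u s) \<bullet> u s) \<le> (norm y)\<^sup>2"
      using heat_energy_bound[OF H, of s y] s unfolding u_def by linarith
    moreover have "s * (\<gamma> * (norm (u s - P (u s)))\<^sup>2) \<le> s * (2 * (H (u s) \<bullet> u s))"
      using s by (intro mult_left_mono gap) auto
    ultimately have "s * \<gamma> * (norm (u s - P (u s)))\<^sup>2 \<le> (norm y)\<^sup>2" by (simp add: mult_ac)
    then have "(norm (u s - P (u s)))\<^sup>2 \<le> (norm y)\<^sup>2 / (s * \<gamma>)"
      using s g by (simp add: pos_le_divide_eq mult.commute)
    also have "\<dots> = (norm y / sqrt \<gamma> / sqrt s)\<^sup>2"
      using s g by (simp add: power_divide power_mult_distrib mult.commute)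
    finally have "(norm (u s - P (u s)))\<^sup>2 \<le> (norm y / sqrt \<gamma> / sqrt s)\<^sup>2" .
    then show ?thesis by (rule power2_le_imp_le) (use s g in simp)
  qed
  have Pv: "P (v s) = v s" for s
    using op_exp_commute[OF blM bounded_linear_axioms, of "- s" "P x"] by (simp add: v_def M_def)
  have nv: "norm (v s) \<le> norm x" if "s \<ge> 0" for s
    unfolding v_def using heat_contraction[OF M that, of "P x"] norm_le[of x] by linarith
  define h where "h s = v s \<bullet> u (t - s)" for s
  have dv: "(v has_vector_derivative - M (v s)) (at s)" for s
    unfolding v_def by (rule op_exp_minus_has_vector_derivative[OF blM])
  have du: "((\<lambda>s. u (t - s)) has_vector_derivative H (u (t - s))) (at s)" for s
  proof -
    have "(u has_vector_derivative - H (u (t - s))) (at (t - s))"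
      unfolding u_def by (rule op_exp_minus_has_vector_derivative[OF blH])
    then have "(u \<circ> (\<lambda>s. t - s) has_vector_derivative (- 1) *\<^sub>R - H (u (t - s))) (at s)"
      by (intro vector_diff_chain_at[of "\<lambda>s. t - s" "- 1" s]) (auto intro!: derivative_eq_intros)
    then show ?thesis by (simp add: o_def)
  qed
  \<comment> \<open>Symmetry moves \<open>H\<close> onto \<open>v s = P (v s)\<close>, where
    \<open>K\<close> controls it however large the norm of \<open>H\<close> is.\<close>
  have dh: "(h has_real_derivative H (P (v s)) \<bullet> (u (t - s) - P (u (t - s)))) (at s)" for s
  proof -
    have "(h has_real_derivative v s \<bullet> H (u (t - s)) + (- M (v s)) \<bullet> u (t - s)) (at s)"
      unfolding h_def has_real_derivative_iff_has_vector_derivative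
      by (rule bounded_bilinear.has_vector_derivative[OF bounded_bilinear_inner dv du])
    also have "v s \<bullet> H (u (t - s)) + (- M (v s)) \<bullet> u (t - s) = H (P (v s)) \<bullet> (u (t - s) - P (u (t - s)))"
      by (simp add: M_def inner_diff_right adj adjH Pv)
    finally show ?thesis .
  qed
  have bound: "\<bar>H (P (v s)) \<bullet> (u (t - s) - P (u (t - s)))\<bar> \<le> c / sqrt (t - s)" if "0 < s" "s < t" for s
  proof -
    have "\<bar>H (P (v s)) \<bullet> (u (t - s) - P (u (t - s)))\<bar> \<le> norm (H (P (v s))) * norm (u (t - s) - P (u (t - s)))"
      by (rule Cauchy_Schwarz_ineq2)
    also have "\<dots> \<le> K * norm x * (norm y / sqrt \<gamma> / sqrt (t - s))"
    proof (rule mult_mono)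
      show "norm (H (P (v s))) \<le> K * norm x"
        using K(2)[of "v s"] mult_left_mono[OF nv[of s] K(1)] that by linarith
    qed (use that K(1) compl[of "t - s"] in auto)
    finally show ?thesis by (simp add: c_def)
  qed
  have cont: "continuous_on {0..t} h"
    using dh by (meson DERIV_isCont continuous_at_imp_continuous_on)
  \<comment> \<open>An antiderivative of the singular bound \<open>c / sqrt (t - s)\<close>. It is
    continuous up to \<open>s = t\<close>, where its derivative blows up, so \<open>h\<close> is
    compared with \<open>k\<close> by monotonicity on the open interval instead of by
    integration.\<close>
  define k where "k s = - (2 * c * sqrt (t - s))" for s
  have dk: "(k has_real_derivative c / sqrt (t - s)) (at s)" if "s < t" for s
    unfolding k_def using that by (auto intro!: derivative_eq_intros simp: field_simps)
  have contk: "continuous_on {0..t} k" unfolding k_def by (intro continuous_intros)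
  have "k 0 - h 0 \<le> k t - h t"
  proof (rule DERIV_nonneg_imp_increasing_open[where f = "\<lambda>s. k s - h s"])
    show "continuous_on {0..t} (\<lambda>s. k s - h s)" by (intro continuous_intros cont contk)
    fix s assume s: "0 < s" "s < t"
    show "\<exists>r. ((\<lambda>s. k s - h s) has_real_derivative r) (at s) \<and> 0 \<le> r"
      using DERIV_diff[OF dk[OF s(2)] dh] bound[OF s] by (intro exI conjI) auto
  qed (use t in simp)
  then have "h t - h 0 \<le> 2 * c * sqrt t" by (simp add: k_def)
  moreover have "\<bar>(x - P x) \<bullet> u t\<bar> \<le> norm x * (norm y / sqrt \<gamma> / sqrt t)"
  proof -
    have "(x - P x) \<bullet> u t = (x - P x) \<bullet> (u t - P (u t))"
      by (simp add: inner_diff_left inner_diff_right adj)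
    also have "\<bar>\<dots>\<bar> \<le> norm (x - P x) * norm (u t - P (u t))" by (rule Cauchy_Schwarz_ineq2)
    also have "\<dots> \<le> norm x * (norm y / sqrt \<gamma> / sqrt t)"
      by (intro mult_mono norm_compl_le compl t) auto
    finally show ?thesis .
  qed
  moreover have "\<bar>h t - h 0\<bar> \<le> 2 * c * sqrt t"
  proof -
    have "k 0 + h 0 \<le> k t + h t"
    proof (rule DERIV_nonneg_imp_increasing_open[where f = "\<lambda>s. k s + h s"])
      show "continuous_on {0..t} (\<lambda>s. k s + h s)" by (intro continuous_intros cont contk)
      fix s assume s: "0 < s" "s < t"
      show "\<exists>r. ((\<lambda>s. k s + h s) has_real_derivative r) (at s) \<and> 0 \<le> r"
        using DERIV_add[OF dk[OF s(2)] dh] bound[OF s] by (intro exI conjI) auto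
    qed (use t in simp)
    then show ?thesis using \<open>h t - h 0 \<le> 2 * c * sqrt t\<close> by (simp add: k_def)
  qed
  \<comment> \<open>As \<open>u 0 = y\<close>, the endpoint values are
    \<open>h t = v t \<bullet> y\<close> and \<open>h 0 = P x \<bullet> u t\<close>. The term with
    \<open>x - P x\<close> appears because the compressed flow starts from
    \<open>P x\<close>.\<close>
  moreover have "y \<bullet> y = (x - P x) \<bullet> u t - (h t - h 0)"
  proof -
    have "y \<bullet> y = op_exp H (- t) x \<bullet> y - v t \<bullet> y" by (simp add: y_def v_def inner_diff_left)
    also have "op_exp H (- t) x \<bullet> y = x \<bullet> u t" unfolding u_def by (rule op_exp_adjoint[OF blH adjH])
    finally show ?thesis by (simp add: h_def u_def v_def inner_diff_left)
  qed
  ultimately have "y \<bullet> y \<le> norm x * (norm y / sqrt \<gamma> / sqrt t) + 2 * c * sqrt t" by linarith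
  \<comment> \<open>The part \<open>1 / sqrt t\<close> is due to the initial mismatch
    \<open>x - P x\<close>; the part \<open>2 * K * sqrt t\<close> is the integral of
    \<open>K / sqrt s\<close> over the time interval.\<close>
  also have "\<dots> = (1 / sqrt t + 2 * K * sqrt t) / sqrt \<gamma> * norm x * norm y"
    using t g by (simp add: c_def field_simps)
  finally have "norm y * norm y \<le> (1 / sqrt t + 2 * K * sqrt t) / sqrt \<gamma> * norm x * norm y"
    by (simp flip: power2_norm_eq_inner add: power2_eq_square)
  moreover have "0 \<le> (1 / sqrt t + 2 * K * sqrt t) / sqrt \<gamma> * norm x"
    using t g K(1) by (intro mult_nonneg_nonneg divide_nonneg_nonneg add_nonneg_nonneg) auto
  ultimately have "norm y \<le> (1 / sqrt t + 2 * K * sqrt t) / sqrt \<gamma> * norm x"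
    by (cases "y = 0") (simp_all only: norm_zero norm_eq_zero mult_le_cancel_right_pos zero_less_norm_iff simp_thms)
  then show ?thesis by (simp add: y_def M_def[abs_def])
qed

end

section \<open>The Hilbert space of square-summable families\<close>

text \<open>For \<open>s > K\<close> the equation is a fixed point problem for the contraction
  \<open>x \<mapsto> (y - B x) / s\<close>. Its solution provides the resolvent at
  \<open>- s\<close>.\<close>

lemma resolvent_exists:
  fixes B :: "'a::banach \<Rightarrow> 'a"
  assumes B: "bounded_linear B" and K: "K \<ge> 0" "\<And>x. norm (B x) \<le> K * norm x" and s: "s > K"
  shows "\<exists>!x. s *\<^sub>R x + B x = y"
proof -
  interpret B: bounded_linear B by fact
  let ?f = "\<lambda>x. (1 / s) *\<^sub>R (y - B x)"
  have s0: "s > 0" using K(1) s by linarith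
  have "\<exists>!x. ?f x = x"
  proof (rule banach_fix_type[of "K / s"], use K s s0 in simp, use K s s0 in simp, intro allI)
    fix x z
    have "dist (?f x) (?f z) = norm (B (z - x)) / s"
      using s0 by (simp add: dist_norm B.diff flip: scaleR_diff_right)
    also have "\<dots> \<le> K * norm (z - x) / s" using s0 K by (intro divide_right_mono) auto
    finally show "dist (?f x) (?f z) \<le> K / s * dist x z" by (simp add: dist_norm norm_minus_commute)
  qed
  moreover have "?f x = x \<longleftrightarrow> s *\<^sub>R x + B x = y" for x
  proof
    assume "?f x = x"
    then have "s *\<^sub>R ?f x = s *\<^sub>R x" by simp
    then show "s *\<^sub>R x + B x = y" using s0 by (simp add: algebra_simps)
  next
    assume "s *\<^sub>R x + B x = y"
    then have "y - B x = s *\<^sub>R x" by auto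
    then show "?f x = x" using s0 by simp
  qed
  ultimately show ?thesis by (simp only:)
qed

lemma summable_on_dominated:
  fixes f :: "'a \<Rightarrow> 'b::banach" and g :: "'a \<Rightarrow> real"
  assumes "g summable_on A" "\<And>x. x \<in> A \<Longrightarrow> norm (f x) \<le> g x"
  shows "f summable_on A"
  using assms
  by - (rule abs_summable_summable, rule Infinite_Sum.abs_summable_on_comparison_test')

lemma norm_add_squared_le:
  fixes x y :: "'a::real_inner"
  shows "(norm (x + y))\<^sup>2 \<le> 2 * (norm x)\<^sup>2 + 2 * (norm y)\<^sup>2"
proof -
  have "0 \<le> (norm (x - y))\<^sup>2" by simp
  then show ?thesis
    unfolding power2_norm_eq_inner
    by (simp add: inner_diff_left inner_diff_right inner_add_left inner_add_right inner_commute[of y x])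
qed

lemma norm_diff_squared_le:
  fixes x y :: "'a::real_inner"
  shows "(norm (x - y))\<^sup>2 \<le> 2 * (norm x)\<^sup>2 + 2 * (norm y)\<^sup>2"
  using norm_add_squared_le[of x "- y"] by simp

lemma abs_inner_le_squares:
  fixes x y :: "'a::real_inner"
  shows "\<bar>x \<bullet> y\<bar> \<le> (norm x)\<^sup>2 + (norm y)\<^sup>2"
proof -
  have "\<bar>x \<bullet> y\<bar> \<le> norm x * norm y" by (rule Cauchy_Schwarz_ineq2)
  also have "\<dots> \<le> (norm x)\<^sup>2 + (norm y)\<^sup>2"
    using sum_squares_bound[of "norm x" "norm y"] mult_nonneg_nonneg[OF norm_ge_zero[of x] norm_ge_zero[of y]] by linarith
  finally show ?thesis .
qed

text \<open>A type cannot depend on a graph, so the Hilbert space is unweighted and indexed by the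
  whole vertex type; masses and the vertex set enter through the embedding \<open>to_lsq\<close>.
  The inner product is the real part of the usual one.\<close>

typedef 'a lsq = "{f :: 'a \<Rightarrow> complex. (\<lambda>x. (norm (f x))\<^sup>2) summable_on UNIV}"
  morphisms coord Abs_lsq
  by (rule exI[of _ "\<lambda>_. 0"]) simp

setup_lifting type_definition_lsq

lemma coord_summable: "(\<lambda>x. (norm (coord f x))\<^sup>2) summable_on UNIV"
  using coord[of f] by simp

lemma inner_summable:
  fixes f g :: "'a \<Rightarrow> 'b::real_inner"
  assumes "(\<lambda>x. (norm (f x))\<^sup>2) summable_on A" "(\<lambda>x. (norm (g x))\<^sup>2) summable_on A"
  shows "(\<lambda>x. f x \<bullet> g x) summable_on A"
  by (rule summable_on_dominated[OF summable_on_add[OF assms]]) (simp add: abs_inner_le_squares)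

instantiation lsq :: (type) real_inner
begin

lift_definition zero_lsq :: "'a lsq" is "\<lambda>_. 0" by simp

lift_definition plus_lsq :: "'a lsq \<Rightarrow> 'a lsq \<Rightarrow> 'a lsq" is "\<lambda>f g x. f x + g x"
proof -
  fix f g :: "'a \<Rightarrow> complex"
  assume "(\<lambda>x. (norm (f x))\<^sup>2) summable_on UNIV" "(\<lambda>x. (norm (g x))\<^sup>2) summable_on UNIV"
  then have "(\<lambda>x. 2 * (norm (f x))\<^sup>2 + 2 * (norm (g x))\<^sup>2) summable_on UNIV"
    by (intro summable_on_add summable_on_cmult_right)
  then show "(\<lambda>x. (norm (f x + g x))\<^sup>2) summable_on UNIV"
    by (rule summable_on_dominated) (simp add: norm_add_squared_le)
qed

lift_definition scaleR_lsq :: "real \<Rightarrow> 'a lsq \<Rightarrow> 'a lsq" is "\<lambda>r f x. r *\<^sub>R f x"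
  by (simp add: power_mult_distrib summable_on_cmult_right)

lift_definition uminus_lsq :: "'a lsq \<Rightarrow> 'a lsq" is "\<lambda>f x. - f x" by simp

definition minus_lsq :: "'a lsq \<Rightarrow> 'a lsq \<Rightarrow> 'a lsq" where "f - g = f + - g" for f g :: "'a lsq"

definition inner_lsq :: "'a lsq \<Rightarrow> 'a lsq \<Rightarrow> real" where
  "inner_lsq f g = (\<Sum>\<^sub>\<infinity>x. coord f x \<bullet> coord g x)"

definition norm_lsq :: "'a lsq \<Rightarrow> real" where "norm_lsq f = sqrt (f \<bullet> f)"

definition dist_lsq :: "'a lsq \<Rightarrow> 'a lsq \<Rightarrow> real" where "dist_lsq f g = norm (f - g)"

definition sgn_lsq :: "'a lsq \<Rightarrow> 'a lsq" where "sgn_lsq f = inverse (norm f) *\<^sub>R f"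

definition uniformity_lsq :: "('a lsq \<times> 'a lsq) filter" where
  "uniformity_lsq = (INF e\<in>{0 <..}. principal {(x, y). dist x y < e})"

definition open_lsq :: "'a lsq set \<Rightarrow> bool" where
  "open_lsq U \<longleftrightarrow> (\<forall>x\<in>U. \<forall>\<^sub>F (x', y) in uniformity. x' = x \<longrightarrow> y \<in> U)"

instance
proof
  fix f g h :: "'a lsq" and r s :: real
  show "f + g + h = f + (g + h)" "f + g = g + f" "0 + f = f" "- f + f = 0"
    "r *\<^sub>R (f + g) = r *\<^sub>R f + r *\<^sub>R g" "(r + s) *\<^sub>R f = r *\<^sub>R f + s *\<^sub>R f"
    "r *\<^sub>R s *\<^sub>R f = (r * s) *\<^sub>R f" "1 *\<^sub>R f = f"
    by (simp_all add: fun_eq_iff algebra_simps plus_lsq.rep_eq scaleR_lsq.rep_eq uminus_lsq.rep_eq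
        zero_lsq.rep_eq flip: coord_inject)
  show "f \<bullet> g = g \<bullet> f" by (simp add: inner_lsq_def inner_commute)
  have summ: "(\<lambda>x. coord f x \<bullet> coord g x) summable_on UNIV" for f g :: "'a lsq"
    by (intro inner_summable coord_summable)
  show "(f + g) \<bullet> h = f \<bullet> h + g \<bullet> h"
    by (simp add: inner_lsq_def plus_lsq.rep_eq inner_add_left infsum_add summ)
  show "(r *\<^sub>R f) \<bullet> g = r * (f \<bullet> g)"
    by (simp add: inner_lsq_def scaleR_lsq.rep_eq infsum_cmult_right summ)
  show "0 \<le> f \<bullet> f" by (auto simp: inner_lsq_def intro!: infsum_nonneg)
  show "f \<bullet> f = 0 \<longleftrightarrow> f = 0"
  proof
    assume "f \<bullet> f = 0"
    then have "coord f x \<bullet> coord f x = 0" for x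
      using nonneg_infsum_le_0D[of "\<lambda>x. coord f x \<bullet> coord f x" UNIV x] summ
      by (simp add: inner_lsq_def)
    then have "coord f = coord 0" by (auto simp: zero_lsq.rep_eq)
    then show "f = 0" by (simp add: coord_inject)
  qed (simp add: inner_lsq_def zero_lsq.rep_eq)
qed (rule minus_lsq_def norm_lsq_def dist_lsq_def sgn_lsq_def uniformity_lsq_def open_lsq_def)+

end

lemma coord_simps [simp]:
  "coord (f + g) x = coord f x + coord g x" "coord (f - g) x = coord f x - coord g x"
  "coord (- f) x = - coord f x" "coord (r *\<^sub>R f) x = r *\<^sub>R coord f x" "coord 0 x = 0"
  by (simp_all only: diff_conv_add_uminus plus_lsq.rep_eq uminus_lsq.rep_eq scaleR_lsq.rep_eq zero_lsq.rep_eq)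

lemma coord_Abs: "(\<lambda>x. (norm (f x))\<^sup>2) summable_on UNIV \<Longrightarrow> coord (Abs_lsq f) = f"
  by (simp add: Abs_lsq_inverse)

lemma lsq_eqI: "(\<And>x. coord f x = coord g x) \<Longrightarrow> f = g"
  using coord_inject by blast

lemma norm_lsq_squared: "(norm f)\<^sup>2 = (\<Sum>\<^sub>\<infinity>x. (norm (coord f x))\<^sup>2)"
  by (simp only: power2_norm_eq_inner inner_lsq_def)

lemma sum_coord_le_norm: "finite F \<Longrightarrow> (\<Sum>x\<in>F. (norm (coord f x))\<^sup>2) \<le> (norm f)\<^sup>2"
  unfolding norm_lsq_squared by (rule finite_sum_le_infsum) (auto simp: coord_summable)

lemma norm_coord_le: "norm (coord f x) \<le> norm f"
  using sum_coord_le_norm[of "{x}" f] by (auto intro: power2_le_imp_le)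

lemma bounded_linear_coord: "bounded_linear (\<lambda>f. coord f x)"
  by (rule bounded_linear_intro[of _ 1]) (auto simp: norm_coord_le)

text \<open>The limit is formed coordinatewise. The Cauchy estimates for sums of squares over finite
  sets are uniform in the set, so they survive the limit and yield both square summability and
  convergence in norm.\<close>

instance lsq :: (type) banach
proof
  fix X :: "nat \<Rightarrow> 'a lsq"
  assume X: "Cauchy X"
  interpret coord: bounded_linear "\<lambda>f. coord f x" for x :: 'a by (rule bounded_linear_coord)
  have "convergent (\<lambda>n. coord (X n) x)" for x
    using coord.Cauchy[OF X] by (simp add: Cauchy_convergent_iff)
  then obtain f where f: "\<And>x. (\<lambda>n. coord (X n) x) \<longlonglongrightarrow> f x"
    unfolding convergent_def by metis
  have close: "\<exists>M. \<forall>n\<ge>M. \<forall>F. finite F \<longrightarrow> (\<Sum>x\<in>F. (norm (f x - coord (X n) x))\<^sup>2) \<le> e\<^sup>2"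
    if e: "e > 0" for e
  proof -
    obtain M where M: "\<And>m n. m \<ge> M \<Longrightarrow> n \<ge> M \<Longrightarrow> norm (X m - X n) < e"
      using X e unfolding Cauchy_iff by blast
    have "(\<Sum>x\<in>F. (norm (f x - coord (X n) x))\<^sup>2) \<le> e\<^sup>2" if "n \<ge> M" "finite F" for n F
    proof (rule tendsto_upperbound)
      show "(\<lambda>m. \<Sum>x\<in>F. (norm (coord (X m) x - coord (X n) x))\<^sup>2)
          \<longlonglongrightarrow> (\<Sum>x\<in>F. (norm (f x - coord (X n) x))\<^sup>2)"
        by (intro tendsto_intros f)
      show "\<forall>\<^sub>F m in sequentially. (\<Sum>x\<in>F. (norm (coord (X m) x - coord (X n) x))\<^sup>2) \<le> e\<^sup>2"
        using eventually_ge_at_top[of M]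
      proof eventually_elim
        case (elim m)
        have "(\<Sum>x\<in>F. (norm (coord (X m) x - coord (X n) x))\<^sup>2) \<le> (norm (X m - X n))\<^sup>2"
          using sum_coord_le_norm[OF that(2), of "X m - X n"] by simp
        also have "\<dots> \<le> e\<^sup>2" using M[OF elim that(1)] by (intro power_mono) auto
        finally show ?case .
      qed
    qed simp
    then show ?thesis by blast
  qed
  have summ: "(\<lambda>x. (norm (f x))\<^sup>2) summable_on UNIV"
  proof -
    obtain n where n: "\<And>F. finite F \<Longrightarrow> (\<Sum>x\<in>F. (norm (f x - coord (X n) x))\<^sup>2) \<le> 1\<^sup>2"
      using close[of 1] by auto
    then have "(\<lambda>x. (norm (f x - coord (X n) x))\<^sup>2) summable_on UNIV"
      by (intro nonneg_bdd_above_summable_on bdd_aboveI[of _ "1\<^sup>2"]) auto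
    then have "(\<lambda>x. 2 * (norm (f x - coord (X n) x))\<^sup>2 + 2 * (norm (coord (X n) x))\<^sup>2) summable_on UNIV"
      by (intro summable_on_add summable_on_cmult_right coord_summable)
    then show ?thesis
    proof (rule summable_on_dominated)
      show "norm ((norm (f x))\<^sup>2) \<le> 2 * (norm (f x - coord (X n) x))\<^sup>2 + 2 * (norm (coord (X n) x))\<^sup>2" for x
        using norm_add_squared_le[of "f x - coord (X n) x" "coord (X n) x"] by simp
    qed
  qed
  have "X \<longlonglongrightarrow> Abs_lsq f"
  proof (rule LIMSEQ_I)
    fix e :: real assume e: "e > 0"
    obtain M where M: "\<And>n F. n \<ge> M \<Longrightarrow> finite F \<Longrightarrow> (\<Sum>x\<in>F. (norm (f x - coord (X n) x))\<^sup>2) \<le> (e / 2)\<^sup>2"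
      using close[of "e / 2"] e by auto
    have "norm (X n - Abs_lsq f) < e" if "n \<ge> M" for n
    proof -
      have "(norm (Abs_lsq f - X n))\<^sup>2 \<le> (e / 2)\<^sup>2"
        unfolding norm_lsq_squared
        by (intro infsum_le_finite_sums[OF coord_summable]) (use M[OF that] in \<open>simp add: coord_Abs[OF summ]\<close>)
      then have "norm (Abs_lsq f - X n) \<le> e / 2" by (rule power2_le_imp_le) (use e in simp)
      then show ?thesis using e by (simp add: norm_minus_commute)
    qed
    then show "\<exists>M. \<forall>n\<ge>M. norm (X n - Abs_lsq f) < e" by blast
  qed
  then show "convergent X" by (auto simp: convergent_def)
qed

section \<open>Transfer from weighted sequence spaces\<close>

text \<open>The square root of the mass makes this embedding of \<open>ell2 G\<close> isometric. It
  is not onto when points lie outside the vertex set; \<open>of_lsq\<close> forgets their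
  coordinates and is a left inverse on \<open>ell2 G\<close>.\<close>

definition to_lsq :: "'v wgraph \<Rightarrow> ('v \<Rightarrow> complex) \<Rightarrow> 'v lsq" where
  "to_lsq G f = Abs_lsq (\<lambda>x. if x \<in> verts G then sqrt (mass G x) *\<^sub>R f x else 0)"

definition of_lsq :: "'v wgraph \<Rightarrow> 'v lsq \<Rightarrow> 'v \<Rightarrow> complex" where
  "of_lsq G \<phi> = (\<lambda>x. if x \<in> verts G then (1 / sqrt (mass G x)) *\<^sub>R coord \<phi> x else 0)"

text \<open>For linear \<open>T\<close> the lift vanishes on coordinates outside the vertex set, so
  these always belong to its kernel.\<close>

definition lift_operator :: "'v wgraph \<Rightarrow> (('v \<Rightarrow> complex) \<Rightarrow> ('v \<Rightarrow> complex)) \<Rightarrow> 'v lsq \<Rightarrow> 'v lsq" where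
  "lift_operator G T \<phi> = to_lsq G (T (of_lsq G \<phi>))"

locale mass_space =
  fixes G :: "'v wgraph"
  assumes mass_pos: "x \<in> verts G \<Longrightarrow> mass G x > 0"
begin

lemma ell2_outside: "f \<in> ell2 G \<Longrightarrow> x \<notin> verts G \<Longrightarrow> f x = 0"
  by (simp add: ell2_def)

lemma ell2_summable: "f \<in> ell2 G \<Longrightarrow> (\<lambda>x. (norm (f x))\<^sup>2 * mass G x) summable_on verts G"
  by (simp add: ell2_def)

lemma coord_to_lsq:
  assumes "f \<in> ell2 G"
  shows "coord (to_lsq G f) x = (if x \<in> verts G then sqrt (mass G x) *\<^sub>R f x else 0)"
proof -
  have "(\<lambda>x. (norm (if x \<in> verts G then sqrt (mass G x) *\<^sub>R f x else 0))\<^sup>2) summable_on UNIV \<longleftrightarrow>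
      (\<lambda>x. (norm (f x))\<^sup>2 * mass G x) summable_on verts G"
    by (rule summable_on_cong_neutral)
      (auto simp: power_mult_distrib mass_pos less_imp_le mult.commute)
  then show ?thesis unfolding to_lsq_def using ell2_summable[OF assms] by (subst coord_Abs) auto
qed

lemma of_lsq_ell2 [simp]: "of_lsq G \<phi> \<in> ell2 G"
proof -
  have "(\<lambda>x. (norm (coord \<phi> x))\<^sup>2) summable_on verts G"
    by (rule summable_on_subset[OF coord_summable subset_UNIV])
  moreover have "(norm (of_lsq G \<phi> x))\<^sup>2 * mass G x = (norm (coord \<phi> x))\<^sup>2" if "x \<in> verts G" for x
    using mass_pos[OF that] by (simp add: of_lsq_def that power_mult_distrib power_divide)
  ultimately have "(\<lambda>x. (norm (of_lsq G \<phi> x))\<^sup>2 * mass G x) summable_on verts G"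
    by (simp cong: summable_on_cong)
  then show ?thesis by (simp add: ell2_def of_lsq_def)
qed

lemma of_to_lsq: "f \<in> ell2 G \<Longrightarrow> of_lsq G (to_lsq G f) = f"
  using mass_pos by (auto simp: of_lsq_def coord_to_lsq fun_eq_iff ell2_outside dest: mass_pos)

lemma coord_to_of: "coord (to_lsq G (of_lsq G \<phi>)) x = (if x \<in> verts G then coord \<phi> x else 0)"
  unfolding coord_to_lsq[OF of_lsq_ell2] using mass_pos[of x] by (cases "x \<in> verts G") (simp_all add: of_lsq_def)

lemma inner_to_lsq:
  assumes "f \<in> ell2 G" "g \<in> ell2 G"
  shows "to_lsq G f \<bullet> to_lsq G g = (\<Sum>\<^sub>\<infinity>x\<in>verts G. mass G x * (f x \<bullet> g x))"
  unfolding inner_lsq_def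
  by (rule infsum_cong_neutral) (auto simp: coord_to_lsq assms mass_pos less_imp_le)

lemma norm_to_lsq:
  assumes "f \<in> ell2 G"
  shows "norm (to_lsq G f) = ell2_norm G f"
proof -
  have "to_lsq G f \<bullet> to_lsq G f = (\<Sum>\<^sub>\<infinity>x\<in>verts G. (cmod (f x))\<^sup>2 * mass G x)"
    unfolding inner_to_lsq[OF assms assms] by (simp only: dot_square_norm mult.commute)
  then show ?thesis unfolding norm_eq_sqrt_inner[of "to_lsq G f"] ell2_norm_def by (simp only:)
qed

lemma ell2_add: "f \<in> ell2 G \<Longrightarrow> g \<in> ell2 G \<Longrightarrow> (\<lambda>x. f x + g x) \<in> ell2 G"
proof -
  assume f: "f \<in> ell2 G" and g: "g \<in> ell2 G"
  have "(\<lambda>x. 2 * ((norm (f x))\<^sup>2 * mass G x) + 2 * ((norm (g x))\<^sup>2 * mass G x)) summable_on verts G"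
    by (intro summable_on_add summable_on_cmult_right ell2_summable f g)
  then have "(\<lambda>x. (norm (f x + g x))\<^sup>2 * mass G x) summable_on verts G"
  proof (rule summable_on_dominated)
    fix x assume "x \<in> verts G"
    then show "norm ((norm (f x + g x))\<^sup>2 * mass G x) \<le>
        2 * ((norm (f x))\<^sup>2 * mass G x) + 2 * ((norm (g x))\<^sup>2 * mass G x)"
      using mult_right_mono[OF norm_add_squared_le[of "f x" "g x"], of "mass G x"] mass_pos[of x]
      by (simp add: algebra_simps)
  qed
  then show ?thesis using f g by (simp add: ell2_def)
qed

lemma ell2_scale: "f \<in> ell2 G \<Longrightarrow> (\<lambda>x. c * f x) \<in> ell2 G"
proof -
  assume f: "f \<in> ell2 G"
  have "(\<lambda>x. (norm c)\<^sup>2 * ((norm (f x))\<^sup>2 * mass G x)) summable_on verts G"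
    by (intro summable_on_cmult_right ell2_summable f)
  then show ?thesis using f by (simp add: ell2_def norm_mult power_mult_distrib mult.assoc)
qed

lemma to_lsq_add: "f \<in> ell2 G \<Longrightarrow> g \<in> ell2 G \<Longrightarrow> to_lsq G (\<lambda>x. f x + g x) = to_lsq G f + to_lsq G g"
  by (rule lsq_eqI) (simp add: coord_to_lsq ell2_add scaleR_add_right)

lemma to_lsq_scale: "f \<in> ell2 G \<Longrightarrow> to_lsq G (\<lambda>x. of_real r * f x) = r *\<^sub>R to_lsq G f"
  by (rule lsq_eqI) (simp add: coord_to_lsq ell2_scale scaleR_conv_of_real mult_ac)

lemma of_lsq_simps:
  "of_lsq G (\<phi> + \<psi>) = (\<lambda>x. of_lsq G \<phi> x + of_lsq G \<psi> x)"
  "of_lsq G (\<phi> - \<psi>) = (\<lambda>x. of_lsq G \<phi> x - of_lsq G \<psi> x)"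
  "of_lsq G (r *\<^sub>R \<phi>) = (\<lambda>x. of_real r * of_lsq G \<phi> x)"
  by (auto simp: of_lsq_def fun_eq_iff add_divide_distrib diff_divide_distrib scaleR_conv_of_real)

lemma norm_to_of_le: "norm (to_lsq G (of_lsq G \<phi>)) \<le> norm \<phi>"
proof (rule power2_le_imp_le)
  show "(norm (to_lsq G (of_lsq G \<phi>)))\<^sup>2 \<le> (norm \<phi>)\<^sup>2"
    unfolding norm_lsq_squared by (intro infsum_mono coord_summable) (simp add: coord_to_of)
qed simp

lemma bounded_linear_to_of: "bounded_linear (\<lambda>\<phi>. to_lsq G (of_lsq G \<phi>))"
  by (rule bounded_linear_intro[of _ 1])
    (auto simp: of_lsq_simps to_lsq_add to_lsq_scale norm_to_of_le)

lemma to_of_adjoint: "to_lsq G (of_lsq G \<phi>) \<bullet> \<psi> = \<phi> \<bullet> to_lsq G (of_lsq G \<psi>)"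
  unfolding inner_lsq_def by (rule infsum_cong) (simp add: coord_to_of)

lemma bounded_operator_ell2: "bounded_operator G T \<Longrightarrow> f \<in> ell2 G \<Longrightarrow> T f \<in> ell2 G"
  by (simp add: bounded_operator_def)

lemma to_of_lift: "bounded_operator G T \<Longrightarrow> to_lsq G (of_lsq G (lift_operator G T \<phi>)) = lift_operator G T \<phi>"
  by (simp add: lift_operator_def of_to_lsq bounded_operator_ell2)

lemma lift_to_lsq: "f \<in> ell2 G \<Longrightarrow> lift_operator G T (to_lsq G f) = to_lsq G (T f)"
  by (simp add: lift_operator_def of_to_lsq)

lemma norm_lift_le:
  assumes K: "K \<ge> 0" "\<And>f. f \<in> ell2 G \<Longrightarrow> ell2_norm G (T f) \<le> K * ell2_norm G f"
    and T: "\<And>f. f \<in> ell2 G \<Longrightarrow> T f \<in> ell2 G"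
  shows "norm (lift_operator G T \<phi>) \<le> K * norm \<phi>"
proof -
  have "norm (lift_operator G T \<phi>) \<le> K * norm (to_lsq G (of_lsq G \<phi>))"
    using K(2)[of "of_lsq G \<phi>"] by (simp add: lift_operator_def norm_to_lsq T)
  also have "\<dots> \<le> K * norm \<phi>" using K(1) norm_to_of_le by (rule mult_left_mono[rotated])
  finally show ?thesis .
qed

lemma bounded_linear_lift:
  assumes T: "bounded_operator G T"
  shows "bounded_linear (lift_operator G T)"
proof -
  obtain K where K: "\<And>f. f \<in> ell2 G \<Longrightarrow> ell2_norm G (T f) \<le> K * ell2_norm G f"
    using T unfolding bounded_operator_def by blast
  have ell2: "\<And>f. f \<in> ell2 G \<Longrightarrow> T f \<in> ell2 G"
    and add: "\<And>f g. f \<in> ell2 G \<Longrightarrow> g \<in> ell2 G \<Longrightarrow> T (\<lambda>x. f x + g x) = (\<lambda>x. T f x + T g x)"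
    and scale: "\<And>c f. f \<in> ell2 G \<Longrightarrow> T (\<lambda>x. c * f x) = (\<lambda>x. c * T f x)"
    using T unfolding bounded_operator_def by auto
  have K': "ell2_norm G (T f) \<le> \<bar>K\<bar> * ell2_norm G f" if "f \<in> ell2 G" for f
  proof -
    have "0 \<le> ell2_norm G f" using norm_to_lsq[OF that] norm_ge_zero by metis
    then have "K * ell2_norm G f \<le> \<bar>K\<bar> * ell2_norm G f" by (intro mult_right_mono) auto
    then show ?thesis using K[OF that] by linarith
  qed
  show ?thesis
  proof (rule bounded_linear_intro[of _ "\<bar>K\<bar>"])
    show "norm (lift_operator G T \<phi>) \<le> norm \<phi> * \<bar>K\<bar>" for \<phi>
      using norm_lift_le[OF _ K' ell2, of \<phi>] by (simp add: mult.commute)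
  qed (simp_all add: lift_operator_def of_lsq_simps add scale to_lsq_add to_lsq_scale ell2)
qed

lemma positive_lift:
  assumes T: "bounded_operator G T"
    and adj: "\<And>f g. f \<in> ell2 G \<Longrightarrow> g \<in> ell2 G \<Longrightarrow> to_lsq G (T f) \<bullet> to_lsq G g = to_lsq G f \<bullet> to_lsq G (T g)"
    and pos: "\<And>f. f \<in> ell2 G \<Longrightarrow> 0 \<le> to_lsq G (T f) \<bullet> to_lsq G f"
  shows "positive_operator (lift_operator G T)"
  unfolding positive_operator_def
proof (intro conjI allI)
  show "bounded_linear (lift_operator G T)" by (rule bounded_linear_lift[OF T])
  \<comment> \<open>The lift takes values in the image of \<open>to_lsq\<close>, so coordinates of
    \<open>\<psi>\<close> off the vertex set do not contribute.\<close>
  have shift: "lift_operator G T \<phi> \<bullet> \<psi> = lift_operator G T \<phi> \<bullet> to_lsq G (of_lsq G \<psi>)" for \<phi> \<psi>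
    by (simp add: to_of_lift[OF T] flip: to_of_adjoint)
  fix \<phi> \<psi>
  have "lift_operator G T \<phi> \<bullet> \<psi> = to_lsq G (of_lsq G \<phi>) \<bullet> lift_operator G T \<psi>"
    using adj[of "of_lsq G \<phi>" "of_lsq G \<psi>"] shift[of \<phi> \<psi>] by (simp add: lift_operator_def)
  also have "\<dots> = \<phi> \<bullet> lift_operator G T \<psi>" using shift[of \<psi> \<phi>] by (simp add: inner_commute)
  finally show "lift_operator G T \<phi> \<bullet> \<psi> = \<phi> \<bullet> lift_operator G T \<psi>" .
  show "0 \<le> lift_operator G T \<phi> \<bullet> \<phi>"
    using pos[of "of_lsq G \<phi>"] shift[of \<phi> \<phi>] by (simp add: lift_operator_def)
qed

end

section \<open>Spectrum and resolvent\<close>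

context mass_space
begin

text \<open>On coordinates outside the vertex set, the lift of \<open>T\<close> minus
  \<open>r\<close> is \<open>- r\<close> times the identity. The lifted resolvent is therefore
  complemented there by \<open>- 1 / r\<close>, which is why \<open>r = 0\<close> is
  excluded.\<close>

lemma bounded_below_off_spectrum:
  assumes T: "bounded_operator G T" and r: "r \<noteq> 0" "complex_of_real r \<notin> spectrum G T"
  obtains c where "c > 0" "\<And>\<phi>. c * norm \<phi> \<le> norm (lift_operator G T \<phi> - r *\<^sub>R \<phi>)"
proof -
  obtain R where R: "bounded_operator G R"
    and inv: "\<And>f. f \<in> ell2 G \<Longrightarrow> R (\<lambda>x. T f x - of_real r * f x) = f"
    using r(2) unfolding spectrum_def by blast
  define \<pi> where "\<pi> \<phi> = to_lsq G (of_lsq G \<phi>)" for \<phi>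
  define S where "S \<phi> = lift_operator G R \<phi> - (1 / r) *\<^sub>R (\<phi> - \<pi> \<phi>)" for \<phi>
  have blS: "bounded_linear S" unfolding S_def \<pi>_def
    by (intro bounded_linear_sub bounded_linear_const_scaleR bounded_linear_lift[OF R]
        bounded_linear_ident bounded_linear_to_of)
  have S: "S (lift_operator G T \<phi> - r *\<^sub>R \<phi>) = \<phi>" for \<phi>
  proof -
    define f where "f = of_lsq G \<phi>"
    have f: "f \<in> ell2 G" by (simp add: f_def)
    interpret \<pi>: bounded_linear \<pi> unfolding \<pi>_def by (rule bounded_linear_to_of)
    have "of_lsq G (lift_operator G T \<phi> - r *\<^sub>R \<phi>) = (\<lambda>x. T f x - of_real r * f x)"
      by (simp only: of_lsq_simps lift_operator_def of_to_lsq bounded_operator_ell2[OF T] f_def of_lsq_ell2)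
    then have "lift_operator G R (lift_operator G T \<phi> - r *\<^sub>R \<phi>) = \<pi> \<phi>"
      by (simp only: lift_operator_def[of G R] inv[OF f]) (simp only: f_def \<pi>_def)
    moreover have "\<pi> (lift_operator G T \<phi> - r *\<^sub>R \<phi>) = lift_operator G T \<phi> - r *\<^sub>R \<pi> \<phi>"
      unfolding \<pi>.diff \<pi>.scaleR by (simp only: \<pi>_def to_of_lift[OF T])
    moreover have "lift_operator G T \<phi> - r *\<^sub>R \<phi> - (lift_operator G T \<phi> - r *\<^sub>R \<pi> \<phi>) = r *\<^sub>R (\<pi> \<phi> - \<phi>)"
      by (simp add: scaleR_diff_right)
    ultimately show ?thesis unfolding S_def using r(1) by simp
  qed
  obtain K where K: "K > 0" "\<And>\<phi>. norm (S \<phi>) \<le> norm \<phi> * K"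
    using bounded_linear.pos_bounded[OF blS] by blast
  show ?thesis
  proof (rule that[of "1 / K"])
    show "1 / K * norm \<phi> \<le> norm (lift_operator G T \<phi> - r *\<^sub>R \<phi>)" for \<phi>
      using K(2)[of "lift_operator G T \<phi> - r *\<^sub>R \<phi>"] K(1) by (simp add: S field_simps)
  qed (use K in simp)
qed

text \<open>A crude bound whose purpose is to make the set under the infimum in
  \<open>spectral_gap\<close> bounded below, so that the infimum really is a lower bound of
  it.\<close>

lemma not_in_spectrum_below:
  assumes T: "bounded_operator G T" and pos: "positive_operator (lift_operator G T)"
    and K: "K \<ge> 0" "\<And>\<phi>. norm (lift_operator G T \<phi>) \<le> K * norm \<phi>" and r: "r < - K"
  shows "complex_of_real r \<notin> spectrum G T"
proof -
  define s where "s = - r"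
  have s: "s > K" "s > 0" using r K by (auto simp: s_def)
  note bl = bounded_linear_lift[OF T]
  have uniq: "\<exists>!\<phi>. s *\<^sub>R \<phi> + lift_operator G T \<phi> = \<psi>" for \<psi>
    by (rule resolvent_exists[OF bl K s(1)])
  define \<rho> where "\<rho> \<psi> = (THE \<phi>. s *\<^sub>R \<phi> + lift_operator G T \<phi> = \<psi>)" for \<psi>
  have \<rho>: "s *\<^sub>R \<rho> \<psi> + lift_operator G T (\<rho> \<psi>) = \<psi>" for \<psi>
    unfolding \<rho>_def by (rule theI'[OF uniq])
  define R where "R f = of_lsq G (\<rho> (to_lsq G f))" for f
  \<comment> \<open>Uniqueness in the resolvent equation identifies \<open>R f\<close>. It also
    yields complex linearity of \<open>R\<close>, although the solution was found in a real Hilbert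
    space.\<close>
  have RI: "R f = g" if g: "g \<in> ell2 G" and eq: "\<And>x. T g x + of_real s * g x = f x" for f g
  proof -
    have "to_lsq G (\<lambda>x. T g x + of_real s * g x) = lift_operator G T (to_lsq G g) + s *\<^sub>R to_lsq G g"
      by (simp add: to_lsq_add to_lsq_scale ell2_scale bounded_operator_ell2[OF T] g lift_to_lsq)
    then have "s *\<^sub>R to_lsq G g + lift_operator G T (to_lsq G g) = to_lsq G f" by (simp add: eq add.commute)
    then have "\<rho> (to_lsq G f) = to_lsq G g" using uniq \<rho> by blast
    then show ?thesis by (simp add: R_def of_to_lsq g)
  qed
  have R_ell2: "R f \<in> ell2 G" for f by (simp add: R_def)
  have TR: "T (R f) x + of_real s * R f x = f x" if f: "f \<in> ell2 G" for f x
  proof -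
    have "of_lsq G (s *\<^sub>R \<rho> (to_lsq G f) + lift_operator G T (\<rho> (to_lsq G f))) = f"
      by (simp add: \<rho> of_to_lsq f)
    then have "(\<lambda>x. of_real s * R f x + T (R f) x) = f"
      by (simp add: of_lsq_simps R_def lift_operator_def of_to_lsq bounded_operator_ell2[OF T])
    then show ?thesis by (metis add.commute)
  qed
  have add: "\<And>f g. f \<in> ell2 G \<Longrightarrow> g \<in> ell2 G \<Longrightarrow> T (\<lambda>x. f x + g x) = (\<lambda>x. T f x + T g x)"
    and scale: "\<And>c f. f \<in> ell2 G \<Longrightarrow> T (\<lambda>x. c * f x) = (\<lambda>x. c * T f x)"
    using T unfolding bounded_operator_def by auto
  have "bounded_operator G R" unfolding bounded_operator_def
  proof (intro conjI ballI allI exI)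
    fix f g c assume f: "f \<in> ell2 G"
    show "R f \<in> ell2 G" by (rule R_ell2)
    show "R (\<lambda>x. f x + g x) = (\<lambda>x. R f x + R g x)" if g: "g \<in> ell2 G"
      by (rule RI) (simp_all add: ell2_add R_ell2 add TR[OF f, symmetric] TR[OF g, symmetric] algebra_simps)
    show "R (\<lambda>x. c * f x) = (\<lambda>x. c * R f x)"
      by (rule RI) (simp_all add: ell2_scale R_ell2 scale TR[OF f, symmetric] algebra_simps)
    show "ell2_norm G (R f) \<le> 1 / s * ell2_norm G f"
    proof -
      let ?\<phi> = "\<rho> (to_lsq G f)"
      have "s * (norm ?\<phi>)\<^sup>2 \<le> s * (norm ?\<phi>)\<^sup>2 + lift_operator G T ?\<phi> \<bullet> ?\<phi>"
        using positive_operatorD(3)[OF pos, of ?\<phi>] by simp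
      also have "\<dots> = (s *\<^sub>R ?\<phi> + lift_operator G T ?\<phi>) \<bullet> ?\<phi>"
        by (simp add: inner_add_left dot_square_norm)
      also have "\<dots> = to_lsq G f \<bullet> ?\<phi>" by (simp only: \<rho>)
      also have "\<dots> \<le> norm (to_lsq G f) * norm ?\<phi>" by (rule norm_cauchy_schwarz)
      finally have "s * norm ?\<phi> * norm ?\<phi> \<le> norm (to_lsq G f) * norm ?\<phi>"
        by (simp add: power2_eq_square)
      then have "s * norm ?\<phi> \<le> norm (to_lsq G f)" by (cases "?\<phi> = 0") simp_all
      moreover have "ell2_norm G (R f) \<le> norm ?\<phi>"
        using norm_to_of_le[of ?\<phi>] norm_to_lsq[OF R_ell2[of f]] by (simp add: R_def)
      ultimately have "s * ell2_norm G (R f) \<le> ell2_norm G f"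
        unfolding norm_to_lsq[OF f] using s(2) by (meson mult_left_mono less_imp_le order_trans)
      then show ?thesis using s(2) by (simp add: field_simps)
    qed
  qed
  moreover have "R (\<lambda>x. T f x - of_real r * f x) = f" if "f \<in> ell2 G" for f
    by (rule RI[OF that]) (simp add: s_def)
  moreover have "(\<lambda>x. T (R f) x - of_real r * R f x) = f" if "f \<in> ell2 G" for f
    using TR[OF that] by (simp add: s_def fun_eq_iff)
  ultimately show ?thesis unfolding spectrum_def by blast
qed

text \<open>Every \<open>z\<close> strictly between \<open>0\<close> and the gap is a resolvent
  point, so the lift minus \<open>z\<close> is bounded below in norm. This is the hypothesis of the
  inequality between \<open>T^2\<close> and \<open>T\<close>, which in turn gives the estimate
  orthogonal to the kernel.\<close>

lemma spectral_gap_bound: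
  assumes T: "bounded_operator G T" and pos: "positive_operator (lift_operator G T)"
    and gap: "spectral_gap G T > 0"
    and orth: "\<And>\<psi>. lift_operator G T \<psi> = 0 \<Longrightarrow> \<phi> \<bullet> \<psi> = 0"
  shows "spectral_gap G T * (norm \<phi>)\<^sup>2 \<le> 2 * (lift_operator G T \<phi> \<bullet> \<phi>)"
proof (rule positive_operator_gap_orthogonal[OF pos gap _ orth])
  let ?S = "{r::real. complex_of_real r \<in> spectrum G T - {0}}"
  obtain K where K: "K > 0" "\<And>\<phi>. norm (lift_operator G T \<phi>) \<le> norm \<phi> * K"
    using bounded_linear.pos_bounded[OF bounded_linear_lift[OF T]] by blast
  have "bdd_below ?S"
  proof (rule bdd_belowI)
    fix r assume "r \<in> ?S"
    then show "- K \<le> r"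
      using not_in_spectrum_below[OF T pos, of K r] K by (force simp: mult.commute)
  qed
  then have below: "r \<notin> ?S" if "r < spectral_gap G T" for r
    using cInf_lower[of r ?S] that unfolding spectral_gap_def by (meson not_le)
  show "spectral_gap G T * (lift_operator G T \<psi> \<bullet> \<psi>) \<le> lift_operator G T \<psi> \<bullet> lift_operator G T \<psi>" for \<psi>
  proof (rule positive_operator_gap_square[OF pos gap])
    fix z assume z: "0 < z" "z < spectral_gap G T"
    have "complex_of_real z \<notin> spectrum G T" using below[OF z(2)] z(1) by simp
    then obtain c where "c > 0" "\<And>\<phi>. c * norm \<phi> \<le> norm (lift_operator G T \<phi> - z *\<^sub>R \<phi>)"
      using bounded_below_off_spectrum[OF T] z(1) by (metis less_irrefl)
    then show "\<exists>c>0. \<forall>\<phi>. c * norm \<phi> \<le> norm (lift_operator G T \<phi> - z *\<^sub>R \<phi>)" by blast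
  qed
qed

end

section \<open>The graph Laplacian\<close>

text \<open>The degree bound \<open>C\<close> is a parameter and not hidden behind an existential
  quantifier, because that of the original graph enters the final constant.\<close>

locale laplacian_graph =
  fixes G :: "'v wgraph" and C :: real
  assumes graph: "weighted_graph G" and undirected: "undirected G"
    and C_nonneg: "C \<ge> 0" and degree_le: "x \<in> verts G \<Longrightarrow> degree G x \<le> C * mass G x"
begin

sublocale mass_space G
  by standard (use graph in \<open>simp add: weighted_graph_def\<close>)

abbreviation V where "V \<equiv> verts G"
abbreviation a where "a \<equiv> weight G"

definition nbrs :: "'v \<Rightarrow> 'v set" where "nbrs x = {y \<in> V. a x y \<noteq> 0}"

lemma weight_nonneg: "x \<in> V \<Longrightarrow> y \<in> V \<Longrightarrow> 0 \<le> a x y"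
  using graph by (simp add: weighted_graph_def)

lemma weight_sym: "x \<in> V \<Longrightarrow> y \<in> V \<Longrightarrow> a x y = a y x"
  using undirected by (simp add: undirected_def)

lemma finite_nbrs:
  assumes x: "x \<in> V"
  shows "finite (nbrs x)"
proof (rule finite_subset)
  show "nbrs x \<subseteq> snd ` {e \<in> edges G. fst e = x \<or> snd e = x}"
  proof
    fix y assume "y \<in> nbrs x"
    then have "y \<in> V" "a x y > 0" using weight_nonneg[OF x, of y] by (auto simp: nbrs_def)
    then have "(x, y) \<in> edges G" using graph x by (auto simp: weighted_graph_def)
    then show "y \<in> snd ` {e \<in> edges G. fst e = x \<or> snd e = x}" by force
  qed
  show "finite (snd ` {e \<in> edges G. fst e = x \<or> snd e = x})"
    using graph x by (auto simp: weighted_graph_def)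
qed

lemma has_sum_nbrs:
  fixes h :: "'v \<Rightarrow> 'b::{comm_monoid_add,t2_space}"
  assumes "x \<in> V" "\<And>y. y \<in> V \<Longrightarrow> a x y = 0 \<Longrightarrow> h y = 0"
  shows "(h has_sum (\<Sum>y\<in>nbrs x. h y)) V"
  by (rule has_sum_finite_neutralI[OF finite_nbrs[OF assms(1)]]) (auto simp: nbrs_def assms(2))

lemma infsum_nbrs:
  fixes h :: "'v \<Rightarrow> 'b::{comm_monoid_add,t2_space}"
  assumes "x \<in> V" "\<And>y. y \<in> V \<Longrightarrow> a x y = 0 \<Longrightarrow> h y = 0"
  shows "infsum h V = (\<Sum>y\<in>nbrs x. h y)"
  using has_sum_nbrs[OF assms] by (rule infsumI)

lemma degree_eq: "x \<in> V \<Longrightarrow> degree G x = (\<Sum>y\<in>nbrs x. a x y)"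
  unfolding degree_def by (rule infsum_nbrs) auto

lemma laplacian_eq:
  assumes x: "x \<in> V"
  shows "laplacian G f x = (1 / mass G x) *\<^sub>R (\<Sum>y\<in>nbrs x. a x y *\<^sub>R (f x - f y))"
proof -
  have "(\<Sum>\<^sub>\<infinity>y\<in>V. of_real (a x y) * f y) = (\<Sum>y\<in>nbrs x. of_real (a x y) * f y)"
    by (rule infsum_nbrs[OF x]) simp
  then show ?thesis using x
    by (simp add: laplacian_def degree_eq scaleR_conv_of_real sum_subtractf sum_distrib_right right_diff_distrib)
qed

text \<open>Summing over \<open>y\<close> first turns the weights into the degree, which is at most
  \<open>C\<close> times the mass.\<close>

lemma weighted_summable_fst:
  assumes f: "f \<in> ell2 G"
  shows "(\<lambda>(x, y). a x y * (norm (f x))\<^sup>2) summable_on V \<times> V"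
    and "(\<Sum>\<^sub>\<infinity>(x, y)\<in>V \<times> V. a x y * (norm (f x))\<^sup>2) \<le> C * (ell2_norm G f)\<^sup>2"
proof -
  have inner: "((\<lambda>y. a x y * (norm (f x))\<^sup>2) has_sum degree G x * (norm (f x))\<^sup>2) V" if x: "x \<in> V" for x
    unfolding degree_eq[OF x] sum_distrib_right by (rule has_sum_nbrs[OF x]) simp
  have deg0: "0 \<le> degree G x" if "x \<in> V" for x
    unfolding degree_eq[OF that] by (intro sum_nonneg weight_nonneg that) (simp add: nbrs_def)
  have le: "degree G x * (norm (f x))\<^sup>2 \<le> C * ((norm (f x))\<^sup>2 * mass G x)" if "x \<in> V" for x
    using mult_right_mono[OF degree_le[OF that], of "(norm (f x))\<^sup>2"] by (simp add: mult_ac)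
  have sC: "(\<lambda>x. C * ((norm (f x))\<^sup>2 * mass G x)) summable_on V"
    by (intro summable_on_cmult_right ell2_summable f)
  have outer: "(\<lambda>x. degree G x * (norm (f x))\<^sup>2) summable_on V"
    by (rule summable_on_dominated[OF sC]) (use le deg0 in auto)
  show summ: "(\<lambda>(x, y). a x y * (norm (f x))\<^sup>2) summable_on V \<times> V"
    by (rule summable_on_SigmaI[OF _ outer]) (use inner weight_nonneg in auto)
  have "(\<Sum>\<^sub>\<infinity>(x, y)\<in>V \<times> V. a x y * (norm (f x))\<^sup>2) = (\<Sum>\<^sub>\<infinity>x\<in>V. degree G x * (norm (f x))\<^sup>2)"
    unfolding infsum_Sigma_banach[OF summ, symmetric] using infsumI[OF inner] by (auto intro: infsum_cong)
  also have "\<dots> \<le> (\<Sum>\<^sub>\<infinity>x\<in>V. C * ((norm (f x))\<^sup>2 * mass G x))"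
    by (rule infsum_mono[OF outer sC le])
  also have "\<dots> = C * (\<Sum>\<^sub>\<infinity>x\<in>V. (norm (f x))\<^sup>2 * mass G x)"
    by (intro infsum_cmult_right ell2_summable f)
  also have "(\<Sum>\<^sub>\<infinity>x\<in>V. (norm (f x))\<^sup>2 * mass G x) = (ell2_norm G f)\<^sup>2"
    unfolding ell2_norm_def by (subst real_sqrt_pow2) (auto intro!: infsum_nonneg mult_nonneg_nonneg simp: mass_pos less_imp_le)
  finally show "(\<Sum>\<^sub>\<infinity>(x, y)\<in>V \<times> V. a x y * (norm (f x))\<^sup>2) \<le> C * (ell2_norm G f)\<^sup>2" .
qed

lemma infsum_product_swap:
  fixes h :: "'v \<Rightarrow> 'v \<Rightarrow> 'b::{comm_monoid_add,t2_space}"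
  shows "(\<Sum>\<^sub>\<infinity>(x, y)\<in>V \<times> V. h y x) = (\<Sum>\<^sub>\<infinity>(x, y)\<in>V \<times> V. h x y)"
  using infsum_reindex[of prod.swap "V \<times> V" "\<lambda>(x, y). h x y"]
  by (simp add: o_def case_prod_unfold inj_on_def product_swap)

lemma weighted_summable_snd:
  assumes f: "f \<in> ell2 G"
  shows "(\<lambda>(x, y). a x y * (norm (f y))\<^sup>2) summable_on V \<times> V"
    and "(\<Sum>\<^sub>\<infinity>(x, y)\<in>V \<times> V. a x y * (norm (f y))\<^sup>2) \<le> C * (ell2_norm G f)\<^sup>2"
proof -
  have eq: "(\<lambda>(x, y). a y x * (norm (f y))\<^sup>2) z = (\<lambda>(x, y). a x y * (norm (f y))\<^sup>2) z" if "z \<in> V \<times> V" for z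
    using that weight_sym by auto
  have "(\<lambda>(x, y). a y x * (norm (f y))\<^sup>2) summable_on V \<times> V"
    using weighted_summable_fst(1)[OF f] by (subst (asm) summable_on_swap) simp
  then show "(\<lambda>(x, y). a x y * (norm (f y))\<^sup>2) summable_on V \<times> V"
    by (simp only: summable_on_cong[OF eq])
  show "(\<Sum>\<^sub>\<infinity>(x, y)\<in>V \<times> V. a x y * (norm (f y))\<^sup>2) \<le> C * (ell2_norm G f)\<^sup>2"
    using weighted_summable_fst(2)[OF f] infsum_product_swap[of "\<lambda>x y. a x y * (norm (f x))\<^sup>2"]
    by (simp only: infsum_cong[OF eq])
qed

lemma gradient_summable:
  assumes f: "f \<in> ell2 G"
  shows "(\<lambda>(x, y). a x y * (norm (f x - f y))\<^sup>2) summable_on V \<times> V"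
    and "(\<Sum>\<^sub>\<infinity>(x, y)\<in>V \<times> V. a x y * (norm (f x - f y))\<^sup>2) \<le> 4 * C * (ell2_norm G f)\<^sup>2"
proof -
  note s1 = weighted_summable_fst[OF f] and s2 = weighted_summable_snd[OF f]
  let ?h = "\<lambda>z. 2 * (case z of (x, y) \<Rightarrow> a x y * (norm (f x))\<^sup>2) + 2 * (case z of (x, y) \<Rightarrow> a x y * (norm (f y))\<^sup>2)"
  have h: "?h summable_on V \<times> V" by (intro summable_on_add summable_on_cmult_right s1 s2)
  have le: "(case z of (x, y) \<Rightarrow> a x y * (norm (f x - f y))\<^sup>2) \<le> ?h z" if "z \<in> V \<times> V" for z
  proof (cases z)
    case (Pair x y)
    then show ?thesis
      using mult_left_mono[OF norm_diff_squared_le[of "f x" "f y"], of "a x y"] weight_nonneg[of x y] that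
      by (simp add: algebra_simps)
  qed
  show summ: "(\<lambda>(x, y). a x y * (norm (f x - f y))\<^sup>2) summable_on V \<times> V"
    by (rule summable_on_dominated[OF h]) (use le weight_nonneg in fastforce)
  have "(\<Sum>\<^sub>\<infinity>(x, y)\<in>V \<times> V. a x y * (norm (f x - f y))\<^sup>2) \<le> infsum ?h (V \<times> V)"
    by (rule infsum_mono[OF summ h le])
  also have "\<dots> = 2 * (\<Sum>\<^sub>\<infinity>(x, y)\<in>V \<times> V. a x y * (norm (f x))\<^sup>2) + 2 * (\<Sum>\<^sub>\<infinity>(x, y)\<in>V \<times> V. a x y * (norm (f y))\<^sup>2)"
    by (subst infsum_add) (auto intro!: summable_on_cmult_right s1 s2 simp: infsum_cmult_right s1 s2)
  finally show "(\<Sum>\<^sub>\<infinity>(x, y)\<in>V \<times> V. a x y * (norm (f x - f y))\<^sup>2) \<le> 4 * C * (ell2_norm G f)\<^sup>2"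
    using s1(2) s2(2) by linarith
qed

text \<open>Cauchy-Schwarz with each weight split into two square roots: one factor sums to the
  degree, the other to the local energy at \<open>x\<close>. Summation over \<open>x\<close> then
  bounds the squared norm by \<open>C\<close> times an energy with constant \<open>4 * C\<close>,
  whence the operator bound \<open>2 * C\<close>.\<close>

lemma laplacian_pointwise:
  assumes x: "x \<in> V"
  shows "(norm (laplacian G f x))\<^sup>2 * mass G x \<le> C * (\<Sum>\<^sub>\<infinity>y\<in>V. a x y * (norm (f x - f y))\<^sup>2)"
proof -
  let ?s = "\<Sum>y\<in>nbrs x. a x y * (norm (f x - f y))\<^sup>2"
  have a0: "0 \<le> a x y" if "y \<in> nbrs x" for y using weight_nonneg[OF x] that by (simp add: nbrs_def)
  have "norm (\<Sum>y\<in>nbrs x. a x y *\<^sub>R (f x - f y)) \<le> (\<Sum>y\<in>nbrs x. norm (a x y *\<^sub>R (f x - f y)))"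
    by (rule norm_sum)
  also have "\<dots> = (\<Sum>y\<in>nbrs x. sqrt (a x y) * (sqrt (a x y) * norm (f x - f y)))"
    by (rule sum.cong) (auto simp: a0 simp flip: mult.assoc)
  finally have "(norm (\<Sum>y\<in>nbrs x. a x y *\<^sub>R (f x - f y)))\<^sup>2 \<le>
      (\<Sum>y\<in>nbrs x. sqrt (a x y) * (sqrt (a x y) * norm (f x - f y)))\<^sup>2" by (rule power_mono) simp
  also have "\<dots> \<le> (\<Sum>y\<in>nbrs x. (sqrt (a x y))\<^sup>2) * (\<Sum>y\<in>nbrs x. (sqrt (a x y) * norm (f x - f y))\<^sup>2)"
    by (rule Cauchy_Schwarz_ineq_sum)
  also have "\<dots> = degree G x * ?s"
    by (simp add: degree_eq x power_mult_distrib a0)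
  also have "\<dots> \<le> C * mass G x * ?s"
    by (intro mult_right_mono degree_le x sum_nonneg mult_nonneg_nonneg a0) auto
  finally have "(norm (\<Sum>y\<in>nbrs x. a x y *\<^sub>R (f x - f y)))\<^sup>2 / mass G x \<le> C * ?s"
    using mass_pos[OF x] by (simp add: field_simps)
  moreover have "(norm (laplacian G f x))\<^sup>2 * mass G x = (norm (\<Sum>y\<in>nbrs x. a x y *\<^sub>R (f x - f y)))\<^sup>2 / mass G x"
    unfolding laplacian_eq[OF x] norm_scaleR power_mult_distrib using mass_pos[OF x]
    by (simp add: power2_eq_square)
  moreover have "(\<Sum>\<^sub>\<infinity>y\<in>V. a x y * (norm (f x - f y))\<^sup>2) = ?s" by (rule infsum_nbrs[OF x]) simp
  ultimately show ?thesis by (simp only:)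
qed

lemma laplacian_ell2:
  assumes f: "f \<in> ell2 G"
  shows "laplacian G f \<in> ell2 G" and "ell2_norm G (laplacian G f) \<le> 2 * C * ell2_norm G f"
proof -
  let ?h = "\<lambda>x. C * (\<Sum>\<^sub>\<infinity>y\<in>V. a x y * (norm (f x - f y))\<^sup>2)"
  note grad = gradient_summable[OF f]
  have sg: "(\<lambda>x. \<Sum>\<^sub>\<infinity>y\<in>V. a x y * (norm (f x - f y))\<^sup>2) summable_on V"
    using summable_on_Sigma_banach[OF grad(1)] by simp
  then have sh: "?h summable_on V" by (rule summable_on_cmult_right)
  have summ: "(\<lambda>x. (norm (laplacian G f x))\<^sup>2 * mass G x) summable_on V"
    by (rule summable_on_dominated[OF sh]) (use laplacian_pointwise mass_pos in \<open>simp add: less_imp_le\<close>)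
  then show *: "laplacian G f \<in> ell2 G" by (simp add: ell2_def laplacian_def)
  have "(ell2_norm G (laplacian G f))\<^sup>2 = (\<Sum>\<^sub>\<infinity>x\<in>V. (norm (laplacian G f x))\<^sup>2 * mass G x)"
    unfolding ell2_norm_def by (subst real_sqrt_pow2) (auto intro!: infsum_nonneg mult_nonneg_nonneg simp: mass_pos less_imp_le)
  also have "\<dots> \<le> infsum ?h V" by (rule infsum_mono[OF summ sh laplacian_pointwise])
  also have "\<dots> = C * (\<Sum>\<^sub>\<infinity>x\<in>V. \<Sum>\<^sub>\<infinity>y\<in>V. a x y * (norm (f x - f y))\<^sup>2)"
    by (rule infsum_cmult_right[OF sg])
  also have "\<dots> = C * (\<Sum>\<^sub>\<infinity>(x, y)\<in>V \<times> V. a x y * (norm (f x - f y))\<^sup>2)"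
    using infsum_Sigma_banach[OF grad(1)] by simp
  also have "\<dots> \<le> C * (4 * C * (ell2_norm G f)\<^sup>2)" by (rule mult_left_mono[OF grad(2) C_nonneg])
  also have "\<dots> = (2 * C * ell2_norm G f)\<^sup>2" by (simp add: power2_eq_square)
  finally show "ell2_norm G (laplacian G f) \<le> 2 * C * ell2_norm G f"
  proof (rule power2_le_imp_le)
    show "0 \<le> 2 * C * ell2_norm G f"
      using C_nonneg norm_ge_zero[of "to_lsq G f"] by (simp add: norm_to_lsq[OF f])
  qed
qed

lemma bounded_operator_laplacian: "bounded_operator G (laplacian G)"
  unfolding bounded_operator_def
proof (intro conjI ballI allI exI)
  fix f g c assume "f \<in> ell2 G"
  then show "laplacian G f \<in> ell2 G" "ell2_norm G (laplacian G f) \<le> 2 * C * ell2_norm G f"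
    by (rule laplacian_ell2)+
  show "laplacian G (\<lambda>x. f x + g x) = (\<lambda>x. laplacian G f x + laplacian G g x)"
  proof
    show "laplacian G (\<lambda>x. f x + g x) x = laplacian G f x + laplacian G g x" for x
    proof (cases "x \<in> V")
      case True
      then show ?thesis
        by (simp only: laplacian_eq scaleR_add_right add_diff_add sum.distrib)
    qed (simp add: laplacian_def)
  qed
  show "laplacian G (\<lambda>x. c * f x) = (\<lambda>x. c * laplacian G f x)"
  proof
    show "laplacian G (\<lambda>x. c * f x) x = c * laplacian G f x" for x
    proof (cases "x \<in> V")
      case True
      have "(\<Sum>y\<in>nbrs x. a x y *\<^sub>R (c * f x - c * f y)) = c * (\<Sum>y\<in>nbrs x. a x y *\<^sub>R (f x - f y))"
        by (simp add: sum_distrib_left right_diff_distrib)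
      then show ?thesis by (simp only: laplacian_eq[OF True] mult_scaleR_right)
    qed (simp add: laplacian_def)
  qed
qed

text \<open>Symmetrizing over the two orientations of an edge turns \<open>\<langle>Lf, g\<rangle>\<close> into the Dirichlet form.\<close>

lemma laplacian_inner:
  assumes f: "f \<in> ell2 G" and g: "g \<in> ell2 G"
  shows "2 * (to_lsq G (laplacian G f) \<bullet> to_lsq G g) = (\<Sum>\<^sub>\<infinity>(x, y)\<in>V \<times> V. a x y * ((f x - f y) \<bullet> (g x - g y)))"
proof -
  have summ: "(\<lambda>(x, y). a x y * ((f x - f y) \<bullet> g x)) summable_on V \<times> V"
  proof (rule summable_on_dominated)
    show "(\<lambda>z. (case z of (x, y) \<Rightarrow> a x y * (norm (f x - f y))\<^sup>2) + (case z of (x, y) \<Rightarrow> a x y * (norm (g x))\<^sup>2))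
        summable_on V \<times> V"
      by (intro summable_on_add gradient_summable weighted_summable_fst f g)
    fix z assume "z \<in> V \<times> V"
    then show "norm (case z of (x, y) \<Rightarrow> a x y * ((f x - f y) \<bullet> g x)) \<le>
        (case z of (x, y) \<Rightarrow> a x y * (norm (f x - f y))\<^sup>2) + (case z of (x, y) \<Rightarrow> a x y * (norm (g x))\<^sup>2)"
      using mult_left_mono[OF abs_inner_le_squares, of "a (fst z) (snd z)"] weight_nonneg[of "fst z" "snd z"]
      by (cases z) (auto simp: abs_mult distrib_left)
  qed
  have eq1: "to_lsq G (laplacian G f) \<bullet> to_lsq G g = (\<Sum>\<^sub>\<infinity>(x, y)\<in>V \<times> V. a x y * ((f x - f y) \<bullet> g x))"
  proof -
    have "to_lsq G (laplacian G f) \<bullet> to_lsq G g = (\<Sum>\<^sub>\<infinity>x\<in>V. \<Sum>\<^sub>\<infinity>y\<in>V. a x y * ((f x - f y) \<bullet> g x))"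
      unfolding inner_to_lsq[OF laplacian_ell2(1)[OF f] g]
    proof (rule infsum_cong)
      fix x assume x: "x \<in> V"
      have "(\<Sum>\<^sub>\<infinity>y\<in>V. a x y * ((f x - f y) \<bullet> g x)) = (\<Sum>y\<in>nbrs x. a x y * ((f x - f y) \<bullet> g x))"
        by (rule infsum_nbrs[OF x]) simp
      also have "\<dots> = (\<Sum>y\<in>nbrs x. a x y *\<^sub>R (f x - f y)) \<bullet> g x" by (simp add: inner_sum_left)
      also have "\<dots> = mass G x * (laplacian G f x \<bullet> g x)"
        using mass_pos[OF x] by (simp add: laplacian_eq[OF x])
      finally show "mass G x * (laplacian G f x \<bullet> g x) = (\<Sum>\<^sub>\<infinity>y\<in>V. a x y * ((f x - f y) \<bullet> g x))" by simp
    qed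
    also have "\<dots> = (\<Sum>\<^sub>\<infinity>(x, y)\<in>V \<times> V. a x y * ((f x - f y) \<bullet> g x))"
      using infsum_Sigma_banach[OF summ] by simp
    finally show ?thesis .
  qed
  have sw: "(\<lambda>(x, y). a y x * ((f y - f x) \<bullet> g y)) summable_on V \<times> V"
    using summ by (subst (asm) summable_on_swap) simp
  have "2 * (to_lsq G (laplacian G f) \<bullet> to_lsq G g) =
      (\<Sum>\<^sub>\<infinity>(x, y)\<in>V \<times> V. a x y * ((f x - f y) \<bullet> g x)) + (\<Sum>\<^sub>\<infinity>(x, y)\<in>V \<times> V. a y x * ((f y - f x) \<bullet> g y))"
    unfolding eq1 infsum_product_swap[of "\<lambda>x y. a x y * ((f x - f y) \<bullet> g x)"] by simp
  also have "\<dots> = (\<Sum>\<^sub>\<infinity>z\<in>V \<times> V. (case z of (x, y) \<Rightarrow> a x y * ((f x - f y) \<bullet> g x)) +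
      (case z of (x, y) \<Rightarrow> a y x * ((f y - f x) \<bullet> g y)))"
    by (rule infsum_add[OF summ sw, symmetric])
  also have "\<dots> = (\<Sum>\<^sub>\<infinity>(x, y)\<in>V \<times> V. a x y * ((f x - f y) \<bullet> (g x - g y)))"
    by (rule infsum_cong) (auto simp: weight_sym inner_diff_left inner_diff_right algebra_simps)
  finally show ?thesis .
qed

lemma positive_lift_laplacian: "positive_operator (lift_operator G (laplacian G))"
proof (rule positive_lift[OF bounded_operator_laplacian])
  fix f g assume f: "f \<in> ell2 G" and g: "g \<in> ell2 G"
  have "2 * (to_lsq G (laplacian G f) \<bullet> to_lsq G g) = 2 * (to_lsq G (laplacian G g) \<bullet> to_lsq G f)"
    unfolding laplacian_inner[OF f g] laplacian_inner[OF g f] by (simp only: inner_commute)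
  then show "to_lsq G (laplacian G f) \<bullet> to_lsq G g = to_lsq G f \<bullet> to_lsq G (laplacian G g)"
    by (simp add: inner_commute)
next
  fix f assume f: "f \<in> ell2 G"
  have "0 \<le> (\<Sum>\<^sub>\<infinity>(x, y)\<in>V \<times> V. a x y * ((f x - f y) \<bullet> (f x - f y)))"
    by (rule infsum_nonneg) (use weight_nonneg in \<open>auto intro!: mult_nonneg_nonneg\<close>)
  then show "0 \<le> to_lsq G (laplacian G f) \<bullet> to_lsq G f"
    using laplacian_inner[OF f f] by linarith
qed

lemma norm_lift_laplacian_le: "norm (lift_operator G (laplacian G) \<phi>) \<le> 2 * C * norm \<phi>"
  by (rule norm_lift_le) (use C_nonneg laplacian_ell2 in auto)

text \<open>The Dirichlet form of \<open>f\<close> vanishes and its terms are nonnegative, so the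
  term of each edge is zero.\<close>

lemma laplacian_kernel_edge:
  assumes f: "f \<in> ell2 G" and z: "laplacian G f = (\<lambda>_. 0)" and e: "(x, y) \<in> edges G"
  shows "f x = f y"
proof -
  have xy: "x \<in> V" "y \<in> V" "a x y > 0" using graph e by (auto simp: weighted_graph_def)
  have "to_lsq G (laplacian G f) = 0"
    unfolding z by (rule lsq_eqI) (simp add: coord_to_lsq ell2_def)
  then have "(\<Sum>\<^sub>\<infinity>(x, y)\<in>V \<times> V. a x y * ((f x - f y) \<bullet> (f x - f y))) = 0"
    using laplacian_inner[OF f f] by simp
  moreover have "(\<lambda>(x, y). a x y * ((f x - f y) \<bullet> (f x - f y))) summable_on V \<times> V"
    using gradient_summable(1)[OF f] by (simp only: power2_norm_eq_inner)
  ultimately have "(\<lambda>(x, y). a x y * ((f x - f y) \<bullet> (f x - f y))) (x, y) = 0"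
    by (intro nonneg_infsum_le_0D[where A = "V \<times> V"])
      (use weight_nonneg xy in \<open>auto intro!: mult_nonneg_nonneg\<close>)
  then show ?thesis using xy by simp
qed

end

section \<open>Averaging over clusters\<close>

lemma infsum_bounded_linear_image:
  assumes "bounded_linear h" "f summable_on A"
  shows "(\<Sum>\<^sub>\<infinity>x\<in>A. h (f x)) = h (infsum f A)"
  by (rule infsumI[OF has_sum_bounded_linear[OF assms(1) has_sum_infsum[OF assms(2)]]])

lemma norm_le_square_add_one: "norm x \<le> (norm x)\<^sup>2 + 1"
proof -
  have "0 \<le> (norm x - 1)\<^sup>2" by simp
  then have "2 * norm x \<le> (norm x)\<^sup>2 + 1" by (simp add: power2_diff)
  then show ?thesis using norm_ge_zero[of x] by linarith
qed

text \<open>For disjoint sets \<open>snd\<close> is a bijection from \<open>Sigma A B\<close> onto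
  the union, which makes results on iterated sums available for partitions.\<close>

lemma summable_on_partition:
  fixes h :: "'b \<Rightarrow> 'c::banach"
  assumes "disjoint_family_on B A"
  shows "h summable_on (\<Union>i\<in>A. B i) \<longleftrightarrow> (\<lambda>z. h (snd z)) summable_on Sigma A B"
    and "infsum h (\<Union>i\<in>A. B i) = infsum (\<lambda>z. h (snd z)) (Sigma A B)"
proof -
  have "bij_betw snd (Sigma A B) (\<Union>i\<in>A. B i)"
    unfolding bij_betw_def
  proof
    show "inj_on snd (Sigma A B)"
    proof (rule inj_onI)
      fix z w assume "z \<in> Sigma A B" "w \<in> Sigma A B" "snd z = snd w"
      then show "z = w" using disjoint_family_onD[OF assms, of "fst z" "fst w"] by (cases z, cases w) auto
    qed
  qed force
  then show "h summable_on (\<Union>i\<in>A. B i) \<longleftrightarrow> (\<lambda>z. h (snd z)) summable_on Sigma A B"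
    "infsum h (\<Union>i\<in>A. B i) = infsum (\<lambda>z. h (snd z)) (Sigma A B)"
    by (simp_all only: summable_on_reindex_bij_betw infsum_reindex_bij_betw)
qed

lemma infsum_partition:
  fixes h :: "'b \<Rightarrow> 'c::banach"
  assumes "disjoint_family_on B A" "h summable_on (\<Union>i\<in>A. B i)"
  shows "(\<Sum>\<^sub>\<infinity>i\<in>A. infsum h (B i)) = infsum h (\<Union>i\<in>A. B i)"
    and "(\<lambda>i. infsum h (B i)) summable_on A"
proof -
  note s = summable_on_partition(1)[OF assms(1), THEN iffD1, OF assms(2)]
  show "(\<Sum>\<^sub>\<infinity>i\<in>A. infsum h (B i)) = infsum h (\<Union>i\<in>A. B i)"
    unfolding summable_on_partition(2)[OF assms(1)] infsum_Sigma_banach[OF s, symmetric] by simp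
  show "(\<lambda>i. infsum h (B i)) summable_on A" using summable_on_Sigma_banach[of "\<lambda>_. h" A B] s
    by (simp add: case_prod_unfold)
qed

text \<open>Of the clusters only the union \<open>F\<close> of their edges and the finite mass of
  each component are kept; the indexing is no longer visible.\<close>

locale cluster_graph = laplacian_graph G C for G :: "'v wgraph" and C +
  fixes F :: "('v \<times> 'v) set"
  assumes F_edges: "F \<subseteq> edges G" and F_sym: "sym F"
    and comp_mass: "x \<in> verts G \<Longrightarrow> mass G summable_on {w \<in> verts G. (x, w) \<in> F\<^sup>*}"
begin

definition comp :: "'v \<Rightarrow> 'v set" where "comp x = {w \<in> V. (x, w) \<in> F\<^sup>*}"

abbreviation comps where "comps \<equiv> components V F"

definition P :: "('v \<Rightarrow> complex) \<Rightarrow> ('v \<Rightarrow> complex)" where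
  "P f = J_up G F (J_down G F f)"

text \<open>Stated on single edges, the form in which the kernel of the cluster Laplacian presents
  itself; induction along paths extends it to components.\<close>

definition cluster_constant :: "('v \<Rightarrow> complex) \<Rightarrow> bool" where
  "cluster_constant f \<longleftrightarrow> (\<forall>(x, y)\<in>F. f x = f y)"

lemma comps_eq: "comps = comp ` V"
  by (simp add: components_def comp_def)

lemma verts_reduced [simp]: "verts (reduced_graph G F) = comps"
  by (simp add: reduced_graph_def)

lemma comp_self: "x \<in> V \<Longrightarrow> x \<in> comp x"
  by (simp add: comp_def)

lemma comp_cong: "y \<in> comp x \<Longrightarrow> comp y = comp x"
  using symD[OF sym_rtrancl[OF F_sym]] by (auto simp: comp_def intro: rtrancl_trans)

lemma comps_unique: "D \<in> comps \<Longrightarrow> x \<in> D \<Longrightarrow> x \<in> V \<and> D = comp x"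
  using comp_cong by (auto simp: comps_eq) (auto simp: comp_def)

lemma comps_subset: "D \<in> comps \<Longrightarrow> D \<subseteq> V"
  using comps_unique by blast

lemma disjoint_comps: "disjoint_family_on (\<lambda>D. D) comps"
  unfolding disjoint_family_on_def using comps_unique by blast

lemma Union_comps: "(\<Union>D\<in>comps. D) = V"
proof
  show "(\<Union>D\<in>comps. D) \<subseteq> V" using comps_subset by blast
  show "V \<subseteq> (\<Union>D\<in>comps. D)" unfolding comps_eq using comp_self by blast
qed

lemma cluster_constant_comp:
  assumes f: "cluster_constant f" and y: "y \<in> comp x"
  shows "f y = f x"
proof -
  have "(x, y) \<in> F\<^sup>*" using y by (simp add: comp_def)
  then show ?thesis
    by (induction rule: rtrancl_induct) (use f in \<open>auto simp: cluster_constant_def\<close>)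
qed

lemma mass_summable_comps: "D \<in> comps \<Longrightarrow> mass G summable_on D"
  using comp_mass by (auto simp: comps_eq comp_def)

abbreviation M where "M D \<equiv> infsum (mass G) D"

lemma mass_reduced: "mass (reduced_graph G F) D = M D"
  by (simp add: reduced_graph_def)

lemma M_pos:
  assumes "D \<in> comps"
  shows "M D > 0"
proof -
  obtain x where x: "x \<in> V" "D = comp x" using assms by (auto simp: comps_eq)
  have "sum (mass G) {x} \<le> M D"
    by (rule finite_sum_le_infsum[OF mass_summable_comps[OF assms]])
      (use x comp_self mass_pos in \<open>auto simp: comp_def less_imp_le\<close>)
  then show ?thesis using mass_pos[OF x(1)] by simp
qed

lemma J_down_eq:
  assumes "D \<in> comps"
  shows "J_down G F f D = (1 / M D) *\<^sub>R (\<Sum>\<^sub>\<infinity>x\<in>D. mass G x *\<^sub>R f x)"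
proof -
  have "ell2_inner G (indicator D) f = (\<Sum>\<^sub>\<infinity>x\<in>D. mass G x *\<^sub>R f x)"
    unfolding ell2_inner_def
    by (rule infsum_cong_neutral)
      (use comps_subset[OF assms] in \<open>auto simp: indicator_def scaleR_conv_of_real mult.commute\<close>)
  then show ?thesis using assms by (simp add: J_down_def mass_reduced scaleR_conv_of_real)
qed

lemma J_up_eq: "J_up G F g x = (if x \<in> V then g (comp x) else 0)"
proof (cases "x \<in> V")
  case True
  have "comp x \<in> comps" using True by (simp add: comps_eq)
  have "J_up G F g x = (\<Sum>\<^sub>\<infinity>D\<in>{comp x}. g D * indicator D x)"
    unfolding J_up_def verts_reduced
  proof (rule infsum_cong_neutral)
    fix D assume "D \<in> comps - {comp x}"
    then have "x \<notin> D" using comps_unique by blast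
    then show "g D * indicator D x = 0" by simp
  qed (use \<open>comp x \<in> comps\<close> in simp_all)
  then show ?thesis using True by (simp add: comp_self)
next
  case False
  have "J_up G F g x = (\<Sum>\<^sub>\<infinity>D\<in>comps. 0)"
    unfolding J_up_def verts_reduced
  proof (rule infsum_cong)
    fix D assume "D \<in> comps"
    then have "x \<notin> D" using False comps_unique by blast
    then show "g D * indicator D x = 0" by simp
  qed
  then show ?thesis using False by simp
qed

lemma P_eq: "P f x = (if x \<in> V then J_down G F f (comp x) else 0)"
  by (simp add: P_def J_up_eq)

lemma P_on_comps: "D \<in> comps \<Longrightarrow> x \<in> D \<Longrightarrow> P f x = J_down G F f D"
  using comps_unique by (simp add: P_eq)

lemma cluster_constant_P: "cluster_constant (P f)"
  unfolding cluster_constant_def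
proof safe
  fix x y assume xy: "(x, y) \<in> F"
  then have "x \<in> V" "y \<in> V" using F_edges graph by (auto simp: weighted_graph_def)
  moreover have "comp y = comp x" by (rule comp_cong) (use xy \<open>y \<in> V\<close> in \<open>auto simp: comp_def\<close>)
  ultimately show "P f x = P f y" by (simp add: P_eq)
qed

text \<open>Clusters may be infinite. Their finite mass and
  \<open>norm z \<le> (norm z)^2 + 1\<close> make square-summable functions summable on them, so
  that the mean over a cluster is meaningful.\<close>

lemma mass_scaled_summable:
  assumes f: "f \<in> ell2 G" and D: "D \<in> comps"
  shows "(\<lambda>x. mass G x *\<^sub>R f x) summable_on D"
proof (rule summable_on_dominated)
  show "(\<lambda>x. (norm (f x))\<^sup>2 * mass G x + mass G x) summable_on D"
    by (intro summable_on_add mass_summable_comps D summable_on_subset[OF ell2_summable[OF f] comps_subset])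
  fix x assume "x \<in> D"
  then have m: "mass G x > 0" using comps_subset[OF D] mass_pos by blast
  from mult_right_mono[OF norm_le_square_add_one[of "f x"], of "mass G x"]
  show "norm (mass G x *\<^sub>R f x) \<le> (norm (f x))\<^sup>2 * mass G x + mass G x"
    using m by (simp add: algebra_simps)
qed

lemma J_down_sum:
  assumes "D \<in> comps"
  shows "(\<Sum>\<^sub>\<infinity>x\<in>D. mass G x *\<^sub>R f x) = M D *\<^sub>R J_down G F f D"
  using M_pos[OF assms] by (simp add: J_down_eq[OF assms])

lemma J_down_cluster_constant:
  assumes "cluster_constant f" "D \<in> comps" "x \<in> D"
  shows "J_down G F f D = f x"
proof -
  have "(\<Sum>\<^sub>\<infinity>y\<in>D. mass G y *\<^sub>R f y) = (\<Sum>\<^sub>\<infinity>y\<in>D. mass G y *\<^sub>R f x)"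
  proof (rule infsum_cong)
    fix y assume "y \<in> D"
    then have "y \<in> comp x" using comps_unique assms by blast
    then show "mass G y *\<^sub>R f y = mass G y *\<^sub>R f x" using cluster_constant_comp[OF assms(1)] by simp
  qed
  also have "\<dots> = M D *\<^sub>R f x"
    by (rule infsum_scaleR_left) (simp add: mass_summable_comps assms)
  finally show ?thesis using M_pos[OF assms(2)] by (simp add: J_down_eq[OF assms(2)])
qed

lemma P_cluster_constant:
  assumes f: "f \<in> ell2 G" "cluster_constant f"
  shows "P f = f"
proof
  show "P f x = f x" for x
  proof (cases "x \<in> V")
    case True
    then show ?thesis using J_down_cluster_constant[OF f(2), of "comp x" x] comp_self by (simp add: P_eq comps_eq)
  qed (simp add: P_eq ell2_outside f)
qed

text \<open>This is the nonnegativity of the variance on a cluster.\<close>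

lemma J_down_squared_le:
  assumes f: "f \<in> ell2 G" and D: "D \<in> comps"
  shows "(norm (J_down G F f D))\<^sup>2 * M D \<le> (\<Sum>\<^sub>\<infinity>x\<in>D. (norm (f x))\<^sup>2 * mass G x)"
proof -
  define c where "c = J_down G F f D"
  let ?s = "\<lambda>x. (norm (f x))\<^sup>2 * mass G x" and ?m = "\<lambda>x. (mass G x *\<^sub>R f x) \<bullet> c"
  have s1: "?s summable_on D" by (rule summable_on_subset[OF ell2_summable[OF f] comps_subset[OF D]])
  have s2: "?m summable_on D"
    by (rule summable_on_bounded_linear[OF bounded_linear_inner_left mass_scaled_summable[OF f D]])
  have s3: "(\<lambda>x. (norm c)\<^sup>2 * mass G x) summable_on D"
    by (intro summable_on_cmult_right mass_summable_comps D)
  have s2': "infsum ?m D = (norm c)\<^sup>2 * M D"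
  proof -
    have "infsum ?m D = (M D *\<^sub>R c) \<bullet> c"
      unfolding infsum_bounded_linear_image[OF bounded_linear_inner_left mass_scaled_summable[OF f D]]
        J_down_sum[OF D] c_def ..
    then show ?thesis by (simp add: dot_square_norm mult.commute)
  qed
  have "0 \<le> (\<Sum>\<^sub>\<infinity>x\<in>D. (?s x + (norm c)\<^sup>2 * mass G x) + (- 2) * ?m x)"
  proof (rule infsum_nonneg)
    fix x assume "x \<in> D"
    then have m: "mass G x > 0" using comps_subset[OF D] mass_pos by blast
    have "0 \<le> mass G x * (norm (f x - c))\<^sup>2" using m by simp
    also have "\<dots> = (?s x + (norm c)\<^sup>2 * mass G x) + (- 2) * ?m x"
      unfolding power2_norm_eq_inner
      by (simp add: inner_diff_left inner_diff_right inner_commute[of c "f x"] algebra_simps)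
    finally show "0 \<le> (?s x + (norm c)\<^sup>2 * mass G x) + (- 2) * ?m x" .
  qed
  also have "\<dots> = (infsum ?s D + infsum (\<lambda>x. (norm c)\<^sup>2 * mass G x) D) + (- 2) * infsum ?m D"
    by (subst infsum_add infsum_cmult_right, (intro summable_on_add summable_on_cmult_right s1 s2 s3 impI)+)+ simp
  also have "infsum (\<lambda>x. (norm c)\<^sup>2 * mass G x) D = (norm c)\<^sup>2 * M D"
    by (rule infsum_cmult_right) (simp add: mass_summable_comps D)
  finally show ?thesis unfolding c_def[symmetric] using s2' by linarith
qed

lemma P_ell2:
  assumes f: "f \<in> ell2 G"
  shows "P f \<in> ell2 G"
proof -
  let ?s = "\<lambda>x. (norm (f x))\<^sup>2 * mass G x"
  have "?s summable_on (\<Union>D\<in>comps. D)" unfolding Union_comps by (rule ell2_summable[OF f])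
  then have "(\<lambda>D. infsum ?s D) summable_on comps" by (rule infsum_partition(2)[OF disjoint_comps])
  then have outer: "(\<lambda>D. (norm (J_down G F f D))\<^sup>2 * M D) summable_on comps"
    by (rule summable_on_dominated) (use J_down_squared_le[OF f] M_pos in \<open>simp add: less_imp_le\<close>)
  have "(\<lambda>z. (norm (P f (snd z)))\<^sup>2 * mass G (snd z)) summable_on (SIGMA D:comps. D)"
  proof (rule summable_on_SigmaI[OF _ outer])
    fix D assume D: "D \<in> comps"
    have "((\<lambda>x. (norm (J_down G F f D))\<^sup>2 * mass G x) has_sum (norm (J_down G F f D))\<^sup>2 * M D) D"
      by (intro has_sum_cmult_right has_sum_infsum mass_summable_comps D)
    then show "((\<lambda>x. (norm (P f (snd (D, x))))\<^sup>2 * mass G (snd (D, x))) has_sum (norm (J_down G F f D))\<^sup>2 * M D) D"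
      by (rule has_sum_cong[THEN iffD1, rotated]) (simp add: P_on_comps[OF D])
    show "0 \<le> (norm (P f (snd (D, x))))\<^sup>2 * mass G (snd (D, x))" if "x \<in> D" for x
      using comps_subset[OF D] that mass_pos by (auto simp: less_imp_le)
  qed
  then have "(\<lambda>x. (norm (P f x))\<^sup>2 * mass G x) summable_on V"
    using summable_on_partition(1)[OF disjoint_comps, of "\<lambda>x. (norm (P f x))\<^sup>2 * mass G x"]
    unfolding Union_comps by blast
  then show ?thesis by (simp add: ell2_def P_eq)
qed

text \<open>On each component \<open>P f\<close> is a constant that leaves the sum, and the rest is
  the mean of \<open>g\<close>. The result is symmetric in \<open>f\<close> and \<open>g\<close>,
  which makes \<open>P\<close> self-adjoint.\<close>

lemma P_inner:
  assumes f: "f \<in> ell2 G" and g: "g \<in> ell2 G"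
  shows "to_lsq G (P f) \<bullet> to_lsq G g = (\<Sum>\<^sub>\<infinity>D\<in>comps. M D * (J_down G F f D \<bullet> J_down G F g D))"
proof -
  let ?h = "\<lambda>x. mass G x * (P f x \<bullet> g x)"
  have "?h summable_on V"
  proof (rule summable_on_dominated)
    show "(\<lambda>x. (norm (P f x))\<^sup>2 * mass G x + (norm (g x))\<^sup>2 * mass G x) summable_on V"
      by (intro summable_on_add ell2_summable P_ell2 f g)
    show "norm (?h x) \<le> (norm (P f x))\<^sup>2 * mass G x + (norm (g x))\<^sup>2 * mass G x" if "x \<in> V" for x
      using mult_left_mono[OF abs_inner_le_squares[of "P f x" "g x"], of "mass G x"] mass_pos[OF that]
      by (simp add: abs_mult algebra_simps)
  qed
  then have "to_lsq G (P f) \<bullet> to_lsq G g = (\<Sum>\<^sub>\<infinity>D\<in>comps. infsum ?h D)"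
    using infsum_partition(1)[OF disjoint_comps, of ?h] unfolding Union_comps inner_to_lsq[OF P_ell2[OF f] g] by simp
  also have "\<dots> = (\<Sum>\<^sub>\<infinity>D\<in>comps. M D * (J_down G F f D \<bullet> J_down G F g D))"
  proof (rule infsum_cong)
    fix D assume D: "D \<in> comps"
    have "infsum ?h D = (\<Sum>\<^sub>\<infinity>x\<in>D. J_down G F f D \<bullet> (mass G x *\<^sub>R g x))"
      by (rule infsum_cong) (simp add: P_on_comps[OF D])
    also have "\<dots> = J_down G F f D \<bullet> (\<Sum>\<^sub>\<infinity>x\<in>D. mass G x *\<^sub>R g x)"
      by (rule infsum_bounded_linear_image[OF bounded_linear_inner_right mass_scaled_summable[OF g D]])
    finally show "infsum ?h D = M D * (J_down G F f D \<bullet> J_down G F g D)" by (simp add: J_down_sum[OF D])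
  qed
  finally show ?thesis .
qed

lemma P_adjoint:
  assumes f: "f \<in> ell2 G" and g: "g \<in> ell2 G"
  shows "to_lsq G (P f) \<bullet> to_lsq G g = to_lsq G f \<bullet> to_lsq G (P g)"
  using P_inner[OF f g] P_inner[OF g f] by (simp add: inner_commute)

lemma P_idem: "f \<in> ell2 G \<Longrightarrow> P (P f) = P f"
  by (rule P_cluster_constant[OF P_ell2 cluster_constant_P])

lemma J_down_P: "f \<in> ell2 G \<Longrightarrow> J_down G F (P f) = J_down G F f"
proof
  fix D assume f: "f \<in> ell2 G"
  show "J_down G F (P f) D = J_down G F f D"
  proof (cases "D \<in> comps")
    case True
    then obtain x where "x \<in> D" using comp_self by (auto simp: comps_eq)
    then show ?thesis using J_down_cluster_constant[OF cluster_constant_P True] P_on_comps[OF True] by simp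
  qed (simp add: J_down_def)
qed

lemma J_down_add:
  assumes "f \<in> ell2 G" "g \<in> ell2 G"
  shows "J_down G F (\<lambda>x. f x + g x) D = J_down G F f D + J_down G F g D"
proof (cases "D \<in> comps")
  case True
  then show ?thesis
    by (simp add: J_down_eq scaleR_add_right infsum_add mass_scaled_summable assms)
qed (simp add: J_down_def)

lemma J_down_scale: "J_down G F (\<lambda>x. c * f x) D = c * J_down G F f D"
proof (cases "D \<in> comps")
  case True
  have "(\<Sum>\<^sub>\<infinity>x\<in>D. mass G x *\<^sub>R (c * f x)) = (\<Sum>\<^sub>\<infinity>x\<in>D. c * (mass G x *\<^sub>R f x))" by simp
  also have "\<dots> = c * (\<Sum>\<^sub>\<infinity>x\<in>D. mass G x *\<^sub>R f x)" by (rule infsum_cmult_right')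
  finally show ?thesis using True by (simp only: J_down_eq mult_scaleR_right)
qed (simp add: J_down_def)

lemma bounded_operator_P: "bounded_operator G P"
  unfolding bounded_operator_def
proof (intro conjI ballI allI exI)
  fix f g c assume f: "f \<in> ell2 G"
  show "P f \<in> ell2 G" by (rule P_ell2[OF f])
  show "P (\<lambda>x. f x + g x) = (\<lambda>x. P f x + P g x)" if "g \<in> ell2 G"
    by (auto simp: P_eq fun_eq_iff J_down_add f that)
  show "P (\<lambda>x. c * f x) = (\<lambda>x. c * P f x)"
    by (auto simp: P_eq fun_eq_iff J_down_scale)
  show "ell2_norm G (P f) \<le> 1 * ell2_norm G f"
  proof (cases "to_lsq G (P f) = 0")
    case True
    then show ?thesis using norm_to_lsq[OF P_ell2[OF f]] norm_to_lsq[OF f] norm_ge_zero[of "to_lsq G f"] by simp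
  next
    case False
    have "(norm (to_lsq G (P f)))\<^sup>2 = to_lsq G (P f) \<bullet> to_lsq G f"
      by (simp add: power2_norm_eq_inner P_adjoint f P_ell2 P_idem inner_commute)
    also have "\<dots> \<le> norm (to_lsq G (P f)) * norm (to_lsq G f)" by (rule norm_cauchy_schwarz)
    finally have "norm (to_lsq G (P f)) \<le> norm (to_lsq G f)" using False by (simp add: power2_eq_square)
    then show ?thesis by (simp add: norm_to_lsq P_ell2 f)
  qed
qed

text \<open>Vectors outside the image of \<open>to_lsq\<close> are fixed, so that the complement of the
  projection sees only functions on the graph.\<close>

definition Proj :: "'v lsq \<Rightarrow> 'v lsq" where
  "Proj \<phi> = \<phi> - to_lsq G (of_lsq G \<phi>) + lift_operator G P \<phi>"

lemma Proj_to_lsq: "f \<in> ell2 G \<Longrightarrow> Proj (to_lsq G f) = to_lsq G (P f)"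
  by (simp add: Proj_def of_to_lsq lift_to_lsq)

lemma of_Proj: "of_lsq G (Proj \<phi>) = P (of_lsq G \<phi>)"
  by (simp add: Proj_def of_lsq_simps of_to_lsq lift_operator_def P_ell2)

lemma positive_lift_P: "positive_operator (lift_operator G P)"
proof (rule positive_lift[OF bounded_operator_P P_adjoint])
  fix f assume f: "f \<in> ell2 G"
  have "to_lsq G (P f) \<bullet> to_lsq G f = to_lsq G (P (P f)) \<bullet> to_lsq G f" by (simp add: P_idem f)
  also have "\<dots> = to_lsq G (P f) \<bullet> to_lsq G (P f)" by (rule P_adjoint[OF P_ell2[OF f] f])
  finally show "0 \<le> to_lsq G (P f) \<bullet> to_lsq G f" by simp
qed

lemma orthogonal_projection_Proj: "orthogonal_projection Proj"
proof -
  have "bounded_linear Proj" unfolding Proj_def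
    by (intro bounded_linear_add bounded_linear_sub bounded_linear_ident bounded_linear_to_of
        positive_operatorD(1)[OF positive_lift_P])
  moreover have "Proj (Proj \<phi>) = Proj \<phi>" for \<phi>
  proof -
    have "Proj (Proj \<phi>) = Proj \<phi> - to_lsq G (P (of_lsq G \<phi>)) + to_lsq G (P (P (of_lsq G \<phi>)))"
      by (simp only: Proj_def[of "Proj \<phi>"] of_Proj lift_operator_def)
    then show ?thesis by (simp add: P_idem)
  qed
  moreover have "Proj \<phi> \<bullet> \<psi> = \<phi> \<bullet> Proj \<psi>" for \<phi> \<psi>
    by (simp add: Proj_def inner_add_left inner_add_right inner_diff_left inner_diff_right
        to_of_adjoint positive_operatorD(2)[OF positive_lift_P])
  ultimately show ?thesis
    by (simp add: orthogonal_projection_def orthogonal_projection_axioms_def)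
qed

text \<open>The loop weight \<open>reduced_weight D D\<close> cancels against its contribution to the degree.\<close>

lemma laplacian_reduced:
  assumes h: "h \<in> ell2 G" "cluster_constant h"
  shows "laplacian (reduced_graph G F) (J_down G F h) = J_down G F (laplacian G h)"
proof
  fix D
  show "laplacian (reduced_graph G F) (J_down G F h) D = J_down G F (laplacian G h) D"
  proof (cases "D \<in> comps")
    case False
    then show ?thesis by (simp add: laplacian_def J_down_def)
  next
    case D: True
    have DV: "D \<subseteq> V" by (rule comps_subset[OF D])
    let ?p = "\<lambda>z. a (fst z) (snd z)" and ?q = "\<lambda>z. of_real (a (fst z) (snd z)) * h (snd z)"
    \<comment> \<open>\<open>D\<close> and \<open>V\<close> may both be infinite, so rearrangement
      requires summability over the product: rows sum to degrees, which are dominated by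
      \<open>C\<close> times the mass, summable on \<open>D\<close>.\<close>
    have sp: "?p summable_on D \<times> V"
    proof (rule summable_on_SigmaI)
      show "((\<lambda>y. ?p (x, y)) has_sum degree G x) V" if "x \<in> D" for x
        using has_sum_nbrs[of x "a x"] degree_eq[of x] that DV by auto
      show "degree G summable_on D"
      proof (rule summable_on_dominated)
        show "(\<lambda>x. C * mass G x) summable_on D" by (intro summable_on_cmult_right mass_summable_comps D)
        fix x assume "x \<in> D"
        then have x: "x \<in> V" using DV by blast
        have "0 \<le> degree G x" unfolding degree_eq[OF x] by (intro sum_nonneg weight_nonneg x) (simp add: nbrs_def)
        then show "norm (degree G x) \<le> C * mass G x" using degree_le[OF x] by simp
      qed
      show "0 \<le> ?p (x, y)" if "x \<in> D" "y \<in> V" for x y using that DV weight_nonneg by auto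
    qed
    have sq: "?q summable_on D \<times> V"
    proof (rule summable_on_dominated)
      have "(\<lambda>(x, y). a x y * (norm (h y))\<^sup>2) summable_on D \<times> V"
        by (rule summable_on_subset[OF weighted_summable_snd(1)[OF h(1)]]) (use DV in auto)
      then show "(\<lambda>z. (case z of (x, y) \<Rightarrow> a x y * (norm (h y))\<^sup>2) + ?p z) summable_on D \<times> V"
        by (rule summable_on_add[OF _ sp])
      fix z assume "z \<in> D \<times> V"
      then have a0: "0 \<le> a (fst z) (snd z)" using DV weight_nonneg by auto
      from mult_left_mono[OF norm_le_square_add_one[of "h (snd z)"] a0]
      show "norm (?q z) \<le> (case z of (x, y) \<Rightarrow> a x y * (norm (h y))\<^sup>2) + ?p z"
        using a0 by (cases z) (simp add: norm_mult algebra_simps)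
    qed
    \<comment> \<open>Grouping the second coordinate by components turns sums over vertices of the
      reduced graph into sums over \<open>D \<times> V\<close>.\<close>
    have part: "(\<Sum>\<^sub>\<infinity>B\<in>comps. infsum k (D \<times> B)) = infsum k (D \<times> V)"
      if "k summable_on D \<times> V" for k :: "'v \<times> 'v \<Rightarrow> 'b::banach"
    proof -
      have U: "(\<Union>B\<in>comps. D \<times> B) = D \<times> V" using Union_comps by auto
      have "disjoint_family_on (\<lambda>B. D \<times> B) comps"
        using disjoint_comps by (fastforce simp: disjoint_family_on_def)
      from infsum_partition(1)[OF this, of k] that show ?thesis unfolding U by simp
    qed
    have rw: "reduced_weight G D B = infsum ?p (D \<times> B)" for B
      by (simp add: reduced_weight_def case_prod_unfold)
    have deg: "degree (reduced_graph G F) D = infsum ?p (D \<times> V)"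
      using part[OF sp] by (simp add: degree_def reduced_graph_def rw)
    have h_D: "h x = J_down G F h D" if "x \<in> D" for x
      using J_down_cluster_constant[OF h(2) D that] by simp
    have "(\<Sum>\<^sub>\<infinity>B\<in>comps. of_real (reduced_weight G D B) * J_down G F h B) = (\<Sum>\<^sub>\<infinity>B\<in>comps. infsum ?q (D \<times> B))"
    proof (rule infsum_cong)
      fix B assume B: "B \<in> comps"
      have "infsum ?q (D \<times> B) = (\<Sum>\<^sub>\<infinity>z\<in>D \<times> B. of_real (?p z) * J_down G F h B)"
        by (rule infsum_cong) (use J_down_cluster_constant[OF h(2) B] in auto)
      also have "\<dots> = (\<Sum>\<^sub>\<infinity>z\<in>D \<times> B. of_real (?p z)) * J_down G F h B" by (rule infsum_cmult_left')
      also have "(\<Sum>\<^sub>\<infinity>z\<in>D \<times> B. complex_of_real (?p z)) = of_real (infsum ?p (D \<times> B))"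
        by (rule infsum_bounded_linear_image[OF bounded_linear_of_real summable_on_subset[OF sp]])
          (use comps_subset[OF B] in auto)
      finally show "of_real (reduced_weight G D B) * J_down G F h B = infsum ?q (D \<times> B)" by (simp add: rw)
    qed
    also have "\<dots> = infsum ?q (D \<times> V)" by (rule part[OF sq])
    finally have off: "(\<Sum>\<^sub>\<infinity>B\<in>comps. of_real (reduced_weight G D B) * J_down G F h B) = infsum ?q (D \<times> V)" .
    let ?r = "\<lambda>z. of_real (?p z) * J_down G F h D"
    have spc: "(\<lambda>z. complex_of_real (?p z)) summable_on D \<times> V"
      by (rule summable_on_bounded_linear[OF bounded_linear_of_real sp])
    have sr: "?r summable_on D \<times> V" by (rule summable_on_cmult_left[OF spc])
    have diag: "of_real (infsum ?p (D \<times> V)) * J_down G F h D = infsum ?r (D \<times> V)"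
      unfolding infsum_bounded_linear_image[OF bounded_linear_of_real sp, symmetric]
      by (rule infsum_cmult_left'[symmetric])
    have sq': "(\<lambda>z. - ?q z) summable_on D \<times> V" using sq by (simp only: summable_on_uminus)
    have srq: "(\<lambda>z. ?r z + - ?q z) summable_on D \<times> V" by (rule summable_on_add[OF sr sq'])
    \<comment> \<open>Degree and off-diagonal parts are subtracted only once both are sums over
      \<open>D \<times> V\<close>. The sum over \<open>y\<close> is then finite and equals the mass
      times the Laplacian at \<open>x\<close>.\<close>
    have "infsum ?r (D \<times> V) - infsum ?q (D \<times> V) = infsum (\<lambda>z. ?r z + - ?q z) (D \<times> V)"
      unfolding infsum_add[OF sr sq'] infsum_uminus by (rule diff_conv_add_uminus)
    also have "\<dots> = (\<Sum>\<^sub>\<infinity>x\<in>D. \<Sum>\<^sub>\<infinity>y\<in>V. ?r (x, y) + - ?q (x, y))"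
      using infsum_Sigma_banach[OF srq] by simp
    also have "\<dots> = (\<Sum>\<^sub>\<infinity>x\<in>D. mass G x *\<^sub>R laplacian G h x)"
    proof (rule infsum_cong)
      fix x assume "x \<in> D"
      then have x: "x \<in> V" and hx: "J_down G F h D = h x" using DV h_D by auto
      have "(\<Sum>\<^sub>\<infinity>y\<in>V. ?r (x, y) + - ?q (x, y)) = (\<Sum>y\<in>nbrs x. ?r (x, y) + - ?q (x, y))"
        by (rule infsum_nbrs[OF x]) simp
      also have "\<dots> = (\<Sum>y\<in>nbrs x. a x y *\<^sub>R (h x - h y))"
        by (rule sum.cong) (simp_all add: hx scaleR_conv_of_real right_diff_distrib)
      also have "\<dots> = mass G x *\<^sub>R laplacian G h x" using mass_pos[OF x] by (simp add: laplacian_eq[OF x])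
      finally show "(\<Sum>\<^sub>\<infinity>y\<in>V. ?r (x, y) + - ?q (x, y)) = mass G x *\<^sub>R laplacian G h x" .
    qed
    also have "\<dots> = M D *\<^sub>R J_down G F (laplacian G h) D" by (rule J_down_sum[OF D])
    finally have key: "infsum ?r (D \<times> V) - infsum ?q (D \<times> V) = M D *\<^sub>R J_down G F (laplacian G h) D" .
    have "laplacian (reduced_graph G F) (J_down G F h) D =
        1 / of_real (M D) * (of_real (degree (reduced_graph G F) D) * J_down G F h D -
          (\<Sum>\<^sub>\<infinity>B\<in>comps. of_real (reduced_weight G D B) * J_down G F h B))"
      using D by (simp add: laplacian_def mass_reduced) (simp add: reduced_graph_def)
    also have "\<dots> = 1 / of_real (M D) * (M D *\<^sub>R J_down G F (laplacian G h) D)"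
      unfolding deg off diag key ..
    also have "\<dots> = J_down G F (laplacian G h) D" using M_pos[OF D] by (simp add: scaleR_conv_of_real)
    finally show ?thesis .
  qed
qed

end

section \<open>The strong coupling estimate\<close>

lemma laplacian_scale: "laplacian G (\<lambda>x. c * f x) = (\<lambda>x. c * laplacian G f x)"
proof
  fix x
  have "(\<Sum>\<^sub>\<infinity>y\<in>verts G. of_real (weight G x y) * (c * f y)) = (\<Sum>\<^sub>\<infinity>y\<in>verts G. c * (of_real (weight G x y) * f y))"
    by (simp add: mult.left_commute)
  also have "\<dots> = c * (\<Sum>\<^sub>\<infinity>y\<in>verts G. of_real (weight G x y) * f y)" by (rule infsum_cmult_right')
  finally show "laplacian G (\<lambda>x. c * f x) x = c * laplacian G f x"
    by (simp add: laplacian_def right_diff_distrib mult_ac)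
qed

text \<open>An identity of the terms of the series, valid for every graph and function without any
  convergence; it therefore also covers the reduced graph, which need not be locally finite.\<close>

lemma heat_eq: "heat G t f x = (\<Sum>n. ((- t) ^ n / fact n) *\<^sub>R (laplacian G ^^ n) f x)"
proof -
  have "((\<lambda>f x. - of_real t * laplacian G f x) ^^ n) f = (\<lambda>x. of_real ((- t) ^ n) * (laplacian G ^^ n) f x)" for n
    by (induction n) (simp_all add: laplacian_scale mult_ac)
  then show ?thesis by (simp add: heat_def operator_exp_def scaleR_conv_of_real)
qed

text \<open>The sequence space sees a graph only through vertices and masses, so the operators of
  all coupled graphs act on one space.\<close>

lemma same_space:
  assumes "verts H = verts G" "mass H = mass G"
  shows "ell2 H = ell2 G" "ell2_norm H = ell2_norm G" "bounded_operator H = bounded_operator G"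
    "to_lsq H = to_lsq G" "of_lsq H = of_lsq G" "lift_operator H = lift_operator G"
proof -
  show *: "ell2 H = ell2 G" "ell2_norm H = ell2_norm G" "to_lsq H = to_lsq G" "of_lsq H = of_lsq G"
    unfolding ell2_def ell2_norm_def[abs_def] to_lsq_def[abs_def] of_lsq_def[abs_def] assms by (rule refl)+
  show "bounded_operator H = bounded_operator G" "lift_operator H = lift_operator G"
    by (simp_all add: bounded_operator_def lift_operator_def * fun_eq_iff)
qed

section \<open>Operator exponentials on weighted sequence spaces\<close>

context mass_space
begin

lemma lift_funpow:
  assumes T: "bounded_operator G T" and f: "f \<in> ell2 G"
  shows "(T ^^ n) f \<in> ell2 G \<and> (lift_operator G T ^^ n) (to_lsq G f) = to_lsq G ((T ^^ n) f)"
  by (induction n) (simp_all add: f lift_to_lsq bounded_operator_ell2[OF T])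

lemma bounded_linear_of_lsq: "bounded_linear (\<lambda>\<phi>. of_lsq G \<phi> x)"
proof (cases "x \<in> verts G")
  case True
  then show ?thesis unfolding of_lsq_def
    by (simp only: if_True) (intro bounded_linear_const_scaleR bounded_linear_coord)
qed (simp add: of_lsq_def bounded_linear_zero)

lemma of_lsq_zero: "of_lsq G 0 = (\<lambda>_. 0)"
  by (simp add: of_lsq_def fun_eq_iff)

text \<open>The exponential is formed in the Hilbert space, where the flow estimates apply, and read
  back as a function on the graph.\<close>

definition exp_on :: "(('v \<Rightarrow> complex) \<Rightarrow> ('v \<Rightarrow> complex)) \<Rightarrow> real \<Rightarrow> ('v \<Rightarrow> complex) \<Rightarrow> ('v \<Rightarrow> complex)" where
  "exp_on T t f = of_lsq G (op_exp (lift_operator G T) t (to_lsq G f))"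

lemma exp_on_sums:
  assumes T: "bounded_operator G T" and f: "f \<in> ell2 G"
  shows "(\<lambda>n. (t ^ n / fact n) *\<^sub>R (T ^^ n) f x) sums exp_on T t f x"
proof -
  have "(\<lambda>n. of_lsq G ((t ^ n / fact n) *\<^sub>R (lift_operator G T ^^ n) (to_lsq G f)) x) sums exp_on T t f x"
    unfolding exp_on_def
    by (rule bounded_linear.sums[OF bounded_linear_of_lsq op_exp_sums[OF bounded_linear_lift[OF T]]])
  then show ?thesis
    using lift_funpow[OF T f] by (simp add: of_lsq_simps of_to_lsq scaleR_conv_of_real)
qed

lemma exp_on_add:
  assumes T: "bounded_operator G T" and f: "f \<in> ell2 G" and g: "g \<in> ell2 G"
  shows "exp_on T t (\<lambda>x. f x + g x) = (\<lambda>x. exp_on T t f x + exp_on T t g x)"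
proof
  fix x
  have "(T ^^ n) (\<lambda>x. f x + g x) = (\<lambda>x. (T ^^ n) f x + (T ^^ n) g x)" for n
  proof (induction n)
    case (Suc n)
    have "T (\<lambda>x. (T ^^ n) f x + (T ^^ n) g x) = (\<lambda>x. T ((T ^^ n) f) x + T ((T ^^ n) g) x)"
      using T lift_funpow[OF T f, of n] lift_funpow[OF T g, of n] unfolding bounded_operator_def by blast
    then show ?case by (simp add: Suc)
  qed simp
  then have "(\<lambda>n. (t ^ n / fact n) *\<^sub>R (T ^^ n) (\<lambda>x. f x + g x) x) sums (exp_on T t f x + exp_on T t g x)"
    using sums_add[OF exp_on_sums[OF T f] exp_on_sums[OF T g], of t x t x] by (simp add: scaleR_add_right)
  then show "exp_on T t (\<lambda>x. f x + g x) x = exp_on T t f x + exp_on T t g x"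
    using exp_on_sums[OF T ell2_add[OF f g]] sums_unique2 by blast
qed

text \<open>Complex homogeneity is read off the pointwise series, since \<open>op_exp\<close> only
  knows the real structure.\<close>

lemma exp_on_scale:
  assumes T: "bounded_operator G T" and f: "f \<in> ell2 G"
  shows "exp_on T t (\<lambda>x. c * f x) = (\<lambda>x. c * exp_on T t f x)"
proof
  fix x
  have "(T ^^ n) (\<lambda>x. c * f x) = (\<lambda>x. c * (T ^^ n) f x)" for n
  proof (induction n)
    case (Suc n)
    have "T (\<lambda>x. c * (T ^^ n) f x) = (\<lambda>x. c * T ((T ^^ n) f) x)"
      using T lift_funpow[OF T f, of n] unfolding bounded_operator_def by blast
    then show ?case by (simp add: Suc)
  qed simp
  then have "(\<lambda>n. (t ^ n / fact n) *\<^sub>R (T ^^ n) (\<lambda>x. c * f x) x) sums (c * exp_on T t f x)"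
    using sums_mult[OF exp_on_sums[OF T f], of c t x] by simp
  then show "exp_on T t (\<lambda>x. c * f x) x = c * exp_on T t f x"
    using exp_on_sums[OF T ell2_scale[OF f]] sums_unique2 by blast
qed

lemma bounded_operator_compose:
  assumes S: "bounded_operator G S" and T: "bounded_operator G T"
  shows "bounded_operator G (\<lambda>f. S (T f))"
proof -
  obtain K where K: "\<And>f. f \<in> ell2 G \<Longrightarrow> ell2_norm G (T f) \<le> K * ell2_norm G f"
    using T unfolding bounded_operator_def by blast
  obtain L where L: "L > 0" "\<And>\<phi>. norm (lift_operator G S \<phi>) \<le> norm \<phi> * L"
    using bounded_linear.pos_bounded[OF bounded_linear_lift[OF S]] by blast
  have "ell2_norm G (S (T f)) \<le> L * K * ell2_norm G f" if f: "f \<in> ell2 G" for f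
  proof -
    note Tf = bounded_operator_ell2[OF T f]
    have "ell2_norm G (S (T f)) \<le> L * ell2_norm G (T f)"
      using L(2)[of "to_lsq G (T f)"]
      by (simp add: lift_to_lsq Tf norm_to_lsq bounded_operator_ell2[OF S] mult.commute)
    also have "\<dots> \<le> L * (K * ell2_norm G f)" using L(1) K[OF f] by (intro mult_left_mono) auto
    finally show ?thesis by (simp add: mult.assoc)
  qed
  then show ?thesis using S T unfolding bounded_operator_def by (intro conjI ballI allI) auto
qed

end

context laplacian_graph
begin

lemma heat_eq_exp_on: "f \<in> ell2 G \<Longrightarrow> heat G t f = exp_on (laplacian G) (- t) f"
  by (rule ext) (simp only: heat_eq sums_unique[OF exp_on_sums[OF bounded_operator_laplacian]])

lemma laplacian_infsum:
  assumes "x \<in> V"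
  shows "laplacian G f x = (1 / mass G x) *\<^sub>R (\<Sum>\<^sub>\<infinity>y\<in>V. a x y *\<^sub>R (f x - f y))"
  unfolding laplacian_eq[OF assms] by (subst infsum_nbrs[OF assms]) auto

text \<open>Deleting edges can only lower the degree, so the same bound \<open>C\<close>
  serves.\<close>

lemma restrict_edges_laplacian_graph:
  assumes F: "F \<subseteq> edges G" "sym F"
  shows "laplacian_graph (restrict_edges G F) C"
proof
  show "weighted_graph (restrict_edges G F)"
  proof -
    have "finite {e \<in> F. fst e = v \<or> snd e = v}" if "v \<in> V" for v
      by (rule finite_subset[of _ "{e \<in> edges G. fst e = v \<or> snd e = v}"])
        (use F graph that in \<open>auto simp: weighted_graph_def\<close>)
    moreover have "F \<subseteq> V \<times> V" using F graph unfolding weighted_graph_def by blast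
    moreover have "0 \<le> a v w * indicator F (v, w) \<and> (0 < a v w * indicator F (v, w) \<longleftrightarrow> (v, w) \<in> F)"
      if "v \<in> V" "w \<in> V" for v w
      using F graph that by (auto simp: weighted_graph_def indicator_def)
    ultimately show ?thesis using graph by (simp add: weighted_graph_def restrict_edges_def)
  qed
  show "Defs.undirected (restrict_edges G F)"
    using F undirected symD[OF F(2)]
    by (auto simp: undirected_def restrict_edges_def indicator_def)
  show "0 \<le> C" by (rule C_nonneg)
  fix x assume "x \<in> verts (restrict_edges G F)"
  then have x: "x \<in> V" by (simp add: restrict_edges_def)
  have "degree (restrict_edges G F) x = (\<Sum>\<^sub>\<infinity>y\<in>V. a x y * indicator F (x, y))"
    by (simp add: degree_def restrict_edges_def)
  also have "\<dots> \<le> (\<Sum>\<^sub>\<infinity>y\<in>V. a x y)"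
  proof (rule infsum_mono)
    show "(\<lambda>y. a x y * indicator F (x, y)) summable_on V"
      by (rule has_sum_imp_summable[OF has_sum_nbrs[OF x]]) simp
    show "a x summable_on V" by (rule has_sum_imp_summable[OF has_sum_nbrs[OF x]])
    show "a x y * indicator F (x, y) \<le> a x y" if "y \<in> V" for y
      using weight_nonneg[OF x that] by (simp add: indicator_def)
  qed
  also have "\<dots> \<le> C * mass G x" using degree_le[OF x] by (simp add: degree_def)
  finally show "degree (restrict_edges G F) x \<le> C * mass (restrict_edges G F) x"
    by (simp add: restrict_edges_def)
qed

lemma laplacian_split:
  assumes F: "F \<subseteq> edges G" "sym F"
  shows "laplacian G f x = laplacian (restrict_edges G F) f x + laplacian (restrict_edges G (edges G - F)) f x"
proof (cases "x \<in> V")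
  case x: True
  have F': "edges G - F \<subseteq> edges G" "sym (edges G - F)"
    using F undirected by (auto simp: sym_def undirected_def)
  interpret B: laplacian_graph "restrict_edges G F" C by (rule restrict_edges_laplacian_graph[OF F])
  interpret A: laplacian_graph "restrict_edges G (edges G - F)" C by (rule restrict_edges_laplacian_graph[OF F'])
  have split: "a x y *\<^sub>R (f x - f y) = (a x y * indicator F (x, y)) *\<^sub>R (f x - f y) +
      (a x y * indicator (edges G - F) (x, y)) *\<^sub>R (f x - f y)" if "y \<in> V" for y
  proof (cases "(x, y) \<in> edges G")
    case False
    then have "\<not> 0 < a x y" using graph x that unfolding weighted_graph_def by blast
    then have "a x y = 0" using weight_nonneg[OF x that] by linarith
    then show ?thesis by simp
  qed (auto simp: indicator_def)
  have "(\<Sum>\<^sub>\<infinity>y\<in>V. a x y *\<^sub>R (f x - f y)) = (\<Sum>\<^sub>\<infinity>y\<in>V. (a x y * indicator F (x, y)) *\<^sub>R (f x - f y) +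
      (a x y * indicator (edges G - F) (x, y)) *\<^sub>R (f x - f y))"
    by (rule infsum_cong[OF split])
  also have "\<dots> = (\<Sum>\<^sub>\<infinity>y\<in>V. (a x y * indicator F (x, y)) *\<^sub>R (f x - f y)) +
      (\<Sum>\<^sub>\<infinity>y\<in>V. (a x y * indicator (edges G - F) (x, y)) *\<^sub>R (f x - f y))"
    by (rule infsum_add; rule has_sum_imp_summable[OF has_sum_nbrs[OF x]]) simp_all
  finally show ?thesis
    using B.laplacian_infsum[of x f] A.laplacian_infsum[of x f] x
    by (simp add: laplacian_infsum restrict_edges_def scaleR_add_right)
qed (simp add: laplacian_def restrict_edges_def)

end

text \<open>\<open>H\<close> is the graph at one fixed coupling. Its degree bound \<open>C'\<close>
  secures boundedness of its Laplacian, while the constants of the final estimates come from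
  \<open>C\<close>, which does not change with the coupling.\<close>

locale coupled_graph = cluster_graph G C F for G :: "'v wgraph" and C F +
  fixes H :: "'v wgraph" and C'
  assumes H: "laplacian_graph H C'"
    and H_same [simp]: "verts H = verts G" "mass H = mass G" "edges H = edges G"
    and H_weight: "x \<in> verts G \<Longrightarrow> y \<in> verts G \<Longrightarrow> (x, y) \<notin> F \<Longrightarrow> weight H x y = weight G x y"
begin

abbreviation "L \<equiv> lift_operator G (laplacian H)"
abbreviation "B \<equiv> lift_operator G (laplacian (restrict_edges H F))"

lemma restrict_same [simp]: "verts (restrict_edges H F') = verts G" "mass (restrict_edges H F') = mass G"
    "edges (restrict_edges H F') = F'"
  by (simp_all add: restrict_edges_def)

lemma H_restrict: "laplacian_graph (restrict_edges H F) C'"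
  by (rule laplacian_graph.restrict_edges_laplacian_graph[OF H]) (use F_edges F_sym in auto)

lemma H_restrict_compl: "laplacian_graph (restrict_edges H (edges G - F)) C'"
  by (rule laplacian_graph.restrict_edges_laplacian_graph[OF H])
    (use F_sym undirected in \<open>auto simp: sym_def undirected_def\<close>)

lemma positive_L: "positive_operator L" and bounded_L: "bounded_operator G (laplacian H)"
  using laplacian_graph.positive_lift_laplacian[OF H] laplacian_graph.bounded_operator_laplacian[OF H]
  by (simp_all add: same_space[of H G])

lemma positive_B: "positive_operator B" and bounded_B: "bounded_operator G (laplacian (restrict_edges H F))"
  using laplacian_graph.positive_lift_laplacian[OF H_restrict] laplacian_graph.bounded_operator_laplacian[OF H_restrict]
  by (simp_all add: same_space[of "restrict_edges H F" G])

lemma B_le_L: "B \<phi> \<bullet> \<phi> \<le> L \<phi> \<bullet> \<phi>"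
proof -
  let ?A = "restrict_edges H (edges G - F)"
  have A: "positive_operator (lift_operator G (laplacian ?A))" "bounded_operator G (laplacian ?A)"
    using laplacian_graph.positive_lift_laplacian[OF H_restrict_compl]
      laplacian_graph.bounded_operator_laplacian[OF H_restrict_compl]
    by (simp_all add: same_space[of ?A G])
  have "laplacian H (of_lsq G \<phi>) =
      (\<lambda>x. laplacian (restrict_edges H F) (of_lsq G \<phi>) x + laplacian ?A (of_lsq G \<phi>) x)"
    using laplacian_graph.laplacian_split[OF H, of F] F_edges F_sym by (simp add: fun_eq_iff)
  then have "L \<phi> = B \<phi> + lift_operator G (laplacian ?A) \<phi>"
    by (simp add: lift_operator_def to_lsq_add bounded_operator_ell2[OF A(2)] bounded_operator_ell2[OF bounded_B])
  then show ?thesis using positive_operatorD(3)[OF A(1), of \<phi>] by (simp add: inner_add_left)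
qed

text \<open>The weights of \<open>H\<close> and \<open>G\<close> differ only on cluster edges, and
  there \<open>h x - h y\<close> is zero. This is the source of uniformity in the coupling.\<close>

lemma laplacian_H_eq:
  assumes h: "cluster_constant h"
  shows "laplacian H h = laplacian G h"
proof
  show "laplacian H h x = laplacian G h x" for x
  proof (cases "x \<in> V")
    case True
    have "(\<Sum>\<^sub>\<infinity>y\<in>V. weight H x y *\<^sub>R (h x - h y)) = (\<Sum>\<^sub>\<infinity>y\<in>V. a x y *\<^sub>R (h x - h y))"
    proof (rule infsum_cong)
      show "weight H x y *\<^sub>R (h x - h y) = a x y *\<^sub>R (h x - h y)" if "y \<in> V" for y
        using h H_weight[OF True that] by (cases "(x, y) \<in> F") (auto simp: cluster_constant_def)
    qed
    then show ?thesis
      using True laplacian_graph.laplacian_infsum[OF H, of x h] by (simp add: laplacian_infsum)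
  qed (simp add: laplacian_def)
qed

text \<open>On the vertex set a kernel function is constant along every edge of \<open>F\<close>,
  hence fixed by \<open>P\<close>; on the other coordinates \<open>Proj\<close> is the identity by
  construction.\<close>

lemma B_kernel:
  assumes "B \<phi> = 0"
  shows "Proj \<phi> = \<phi>"
proof -
  let ?f = "of_lsq G \<phi>"
  have "of_lsq G (B \<phi>) = laplacian (restrict_edges H F) ?f"
    by (simp add: lift_operator_def of_to_lsq bounded_operator_ell2[OF bounded_B])
  then have "laplacian (restrict_edges H F) ?f = (\<lambda>_. 0)" using assms by (simp add: of_lsq_zero)
  then have "?f x = ?f y" if "(x, y) \<in> F" for x y
    using laplacian_graph.laplacian_kernel_edge[OF H_restrict, of ?f x y] that
    by (simp add: same_space[of "restrict_edges H F" G])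
  then have "cluster_constant ?f" by (auto simp: cluster_constant_def)
  then show ?thesis using P_cluster_constant[of ?f] by (simp add: Proj_def lift_operator_def)
qed

lemma B_Proj: "B (Proj \<phi>) = 0"
proof -
  interpret R: laplacian_graph "restrict_edges H F" C' by (rule H_restrict)
  have "laplacian (restrict_edges H F) (P f) x = 0" for f x
  proof (cases "x \<in> V")
    case True
    have "(\<Sum>\<^sub>\<infinity>y\<in>V. weight (restrict_edges H F) x y *\<^sub>R (P f x - P f y)) = (\<Sum>\<^sub>\<infinity>y\<in>V. 0)"
      by (rule infsum_cong) (use cluster_constant_P[of f] in
        \<open>auto simp: cluster_constant_def restrict_edges_def indicator_def\<close>)
    then show ?thesis using R.laplacian_infsum[of x] True by simp
  qed (simp add: laplacian_def)
  then have "laplacian (restrict_edges H F) (P f) = (\<lambda>_. 0)" for f by blast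
  then have "B (Proj \<phi>) = to_lsq G (\<lambda>_. 0)" by (simp add: lift_operator_def of_Proj)
  also have "\<dots> = 0" by (rule lsq_eqI) (simp add: coord_to_lsq ell2_def)
  finally show ?thesis .
qed

lemma gap_bound:
  assumes gap: "spectral_gap G (laplacian (restrict_edges H F)) > 0" (is "?\<gamma> > 0")
  shows "?\<gamma> * (norm (\<phi> - Proj \<phi>))\<^sup>2 \<le> 2 * (L \<phi> \<bullet> \<phi>)"
proof -
  interpret Proj: orthogonal_projection Proj by (rule orthogonal_projection_Proj)
  interpret B: bounded_linear B by (rule positive_operatorD[OF positive_B])
  have "(\<phi> - Proj \<phi>) \<bullet> \<psi> = 0" if "B \<psi> = 0" for \<psi>
  proof -
    have "(\<phi> - Proj \<phi>) \<bullet> Proj \<psi> = 0" by (simp add: inner_diff_left Proj.adj)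
    then show ?thesis by (simp only: B_kernel[OF that])
  qed
  then have "?\<gamma> * (norm (\<phi> - Proj \<phi>))\<^sup>2 \<le> 2 * (B (\<phi> - Proj \<phi>) \<bullet> (\<phi> - Proj \<phi>))"
    by (rule spectral_gap_bound[OF bounded_B positive_B gap])
  \<comment> \<open>\<open>B\<close> annihilates the range of \<open>Proj\<close>, so no cross term
    survives and \<open>\<phi> - Proj \<phi>\<close> has the same cluster energy as
    \<open>\<phi>\<close>.\<close>
  also have "B (\<phi> - Proj \<phi>) \<bullet> (\<phi> - Proj \<phi>) = B \<phi> \<bullet> \<phi> - \<phi> \<bullet> B (Proj \<phi>)"
    by (simp add: B.diff B_Proj inner_diff_right positive_operatorD(2)[OF positive_B, of \<phi> "Proj \<phi>"])
  also have "\<dots> \<le> L \<phi> \<bullet> \<phi>" using B_le_L[of \<phi>] by (simp add: B_Proj)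
  finally show ?thesis by simp
qed

lemma L_Proj_le: "norm (L (Proj \<phi>)) \<le> 2 * C * norm \<phi>"
proof -
  interpret Proj: orthogonal_projection Proj by (rule orthogonal_projection_Proj)
  have "L (Proj \<phi>) = lift_operator G (laplacian G) (Proj \<phi>)"
    by (simp add: lift_operator_def of_Proj laplacian_H_eq cluster_constant_P)
  also have "norm \<dots> \<le> 2 * C * norm (Proj \<phi>)" by (rule norm_lift_laplacian_le)
  also have "\<dots> \<le> 2 * C * norm \<phi>" using C_nonneg by (intro mult_left_mono Proj.norm_le) auto
  finally show ?thesis .
qed

lemma compressed_lift: "Proj (L (Proj \<phi>)) = lift_operator G (\<lambda>f. P (laplacian H (P f))) \<phi>"
  by (simp add: lift_operator_def of_Proj Proj_to_lsq bounded_operator_ell2[OF bounded_L] P_ell2)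

lemma bounded_compressed: "bounded_operator G (\<lambda>f. P (laplacian H (P f)))"
  by (intro bounded_operator_compose[OF bounded_operator_P] bounded_operator_compose[OF bounded_L]
      bounded_operator_P)

text \<open>On cluster-constant functions \<open>J_down\<close> intertwines the compressed operator
  with the reduced Laplacian, so the two exponential series agree term by term at every
  vertex.\<close>

lemma reduced_heat:
  assumes f: "f \<in> ell2 G"
  shows "J_up G F (heat (reduced_graph G F) t (J_down G F f)) =
    exp_on (\<lambda>f. P (laplacian H (P f))) (- t) (P f)"
proof
  fix x
  let ?N = "\<lambda>f. P (laplacian H (P f))" and ?R = "laplacian (reduced_graph G F)"
  \<comment> \<open>The induction carries along that the iterates are square-summable and fixed by
    \<open>P\<close>, because the intertwining relation holds for such functions.\<close>
  have pw: "(?N ^^ n) (P f) \<in> ell2 G \<and> P ((?N ^^ n) (P f)) = (?N ^^ n) (P f) \<and>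
      (?R ^^ n) (J_down G F f) = J_down G F ((?N ^^ n) (P f))" for n
  proof (induction n)
    case 0
    show ?case by (simp add: f P_ell2 P_idem J_down_P)
  next
    case (Suc n)
    define h where "h = (?N ^^ n) (P f)"
    have h: "h \<in> ell2 G" "P h = h" "(?R ^^ n) (J_down G F f) = J_down G F h"
      using Suc by (simp_all add: h_def)
    have hc: "cluster_constant h" using cluster_constant_P[of h] by (simp add: h)
    have Lh: "laplacian H h \<in> ell2 G" by (rule bounded_operator_ell2[OF bounded_L h(1)])
    have "?R (J_down G F h) = J_down G F (P (laplacian H h))"
      by (simp add: laplacian_reduced[OF h(1) hc] laplacian_H_eq[OF hc, symmetric] J_down_P Lh)
    then show ?case
      by (simp add: h h_def[symmetric] P_ell2 Lh P_idem)
  qed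
  show "J_up G F (heat (reduced_graph G F) t (J_down G F f)) x = exp_on ?N (- t) (P f) x"
  proof (cases "x \<in> V")
    case True
    have "J_up G F (heat (reduced_graph G F) t (J_down G F f)) x =
        (\<Sum>n. ((- t) ^ n / fact n) *\<^sub>R J_down G F ((?N ^^ n) (P f)) (comp x))"
      using pw by (simp add: J_up_eq True heat_eq)
    also have "\<dots> = (\<Sum>n. ((- t) ^ n / fact n) *\<^sub>R (?N ^^ n) (P f) x)"
      using pw by (metis (no_types, lifting) P_eq True)
    also have "\<dots> = exp_on ?N (- t) (P f) x"
      by (rule sums_unique[OF exp_on_sums[OF bounded_compressed P_ell2[OF f]], symmetric])
    finally show ?thesis .
  qed (simp add: J_up_eq exp_on_def of_lsq_def)
qed

definition diff_heat :: "real \<Rightarrow> ('v \<Rightarrow> complex) \<Rightarrow> 'v \<Rightarrow> complex" where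
  "diff_heat t f x = heat H t f x - J_up G F (heat (reduced_graph G F) t (J_down G F f)) x"

lemma diff_heat_eq:
  assumes f: "f \<in> ell2 G"
  shows "diff_heat t f = of_lsq G (op_exp L (- t) (to_lsq G f) -
      op_exp (\<lambda>\<phi>. Proj (L (Proj \<phi>))) (- t) (Proj (to_lsq G f)))"
proof -
  interpret H: mass_space H by standard (use mass_pos in simp)
  have "heat H t f = of_lsq G (op_exp L (- t) (to_lsq G f))"
    using laplacian_graph.heat_eq_exp_on[OF H, of f t] f by (simp add: same_space[of H G] H.exp_on_def)
  moreover have "J_up G F (heat (reduced_graph G F) t (J_down G F f)) =
      of_lsq G (op_exp (\<lambda>\<phi>. Proj (L (Proj \<phi>))) (- t) (Proj (to_lsq G f)))"
    unfolding reduced_heat[OF f] exp_on_def compressed_lift[abs_def] Proj_to_lsq[OF f] ..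
  ultimately show ?thesis by (simp add: diff_heat_def of_lsq_simps fun_eq_iff)
qed

lemma diff_heat_norm:
  assumes f: "f \<in> ell2 G" and t: "t > 0"
  shows "diff_heat t f \<in> ell2 G" "ell2_norm G (diff_heat t f) \<le> 2 * ell2_norm G f"
    and "spectral_gap G (laplacian (restrict_edges H F)) > 0 \<Longrightarrow>
      ell2_norm G (diff_heat t f) \<le>
        (1 / sqrt t + 4 * C * sqrt t) / sqrt (spectral_gap G (laplacian (restrict_edges H F))) * ell2_norm G f"
proof -
  interpret Proj: orthogonal_projection Proj by (rule orthogonal_projection_Proj)
  let ?M = "\<lambda>\<phi>. Proj (L (Proj \<phi>))" and ?\<phi> = "to_lsq G f"
  let ?d = "op_exp L (- t) ?\<phi> - op_exp ?M (- t) (Proj ?\<phi>)"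
  show ell2: "diff_heat t f \<in> ell2 G" unfolding diff_heat_eq[OF f] by (rule of_lsq_ell2)
  have le: "ell2_norm G (diff_heat t f) \<le> norm ?d"
    using norm_to_of_le[of ?d] norm_to_lsq[OF ell2] unfolding diff_heat_eq[OF f] by simp
  have "norm ?d \<le> norm (op_exp L (- t) ?\<phi>) + norm (op_exp ?M (- t) (Proj ?\<phi>))"
    by (rule norm_triangle_ineq4)
  also have "\<dots> \<le> norm ?\<phi> + norm (Proj ?\<phi>)"
    by (intro add_mono heat_contraction positive_L Proj.positive_compression) (use t in auto)
  also have "\<dots> \<le> 2 * ell2_norm G f" using Proj.norm_le[of ?\<phi>] norm_to_lsq[OF f] by simp
  finally show "ell2_norm G (diff_heat t f) \<le> 2 * ell2_norm G f" using le by linarith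
  assume "spectral_gap G (laplacian (restrict_edges H F)) > 0" (is "?\<gamma> > 0")
  \<comment> \<open>The bound \<open>2 * C\<close> for \<open>L\<close> on the range of
    \<open>Proj\<close> takes the place of \<open>K\<close>, hence \<open>4 * C\<close> in the
    result.\<close>
  then have "norm ?d \<le> (1 / sqrt t + 2 * (2 * C) * sqrt t) / sqrt ?\<gamma> * norm ?\<phi>"
    by (intro Proj.heat_compression_bound[OF positive_L _ L_Proj_le _ gap_bound t]) (use C_nonneg in auto)
  then show "ell2_norm G (diff_heat t f) \<le> (1 / sqrt t + 4 * C * sqrt t) / sqrt ?\<gamma> * ell2_norm G f"
    using le by (simp add: norm_to_lsq[OF f])
qed

text \<open>Required besides the norm estimate, since the supremum in \<open>operator_norm\<close>
  is meaningful for bounded operators only. Complex linearity comes from the two series, the bound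
  from contractivity.\<close>

lemma bounded_diff_heat:
  assumes t: "t > 0"
  shows "bounded_operator G (diff_heat t)"
proof -
  interpret H: mass_space H by standard (use mass_pos in simp)
  let ?E = "exp_on (laplacian H) (- t)" and ?N = "exp_on (\<lambda>f. P (laplacian H (P f))) (- t)"
  have eq: "diff_heat t f = (\<lambda>x. ?E f x - ?N (P f) x)" if "f \<in> ell2 G" for f
    using laplacian_graph.heat_eq_exp_on[OF H, of f t] that reduced_heat[OF that, of t]
    by (simp add: diff_heat_def fun_eq_iff same_space[of H G] H.exp_on_def exp_on_def)
  have P_add: "P (\<lambda>x. f x + g x) = (\<lambda>x. P f x + P g x)" if "f \<in> ell2 G" "g \<in> ell2 G" for f g
    using bounded_operator_P that unfolding bounded_operator_def by blast
  have P_scale: "P (\<lambda>x. c * f x) = (\<lambda>x. c * P f x)" if "f \<in> ell2 G" for c f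
    using bounded_operator_P that unfolding bounded_operator_def by blast
  show ?thesis
    unfolding bounded_operator_def
  proof (intro conjI ballI allI exI)
    fix f g c assume f: "f \<in> ell2 G"
    show "diff_heat t f \<in> ell2 G" "ell2_norm G (diff_heat t f) \<le> 2 * ell2_norm G f"
      using diff_heat_norm[OF f t] by auto
    show "diff_heat t (\<lambda>x. f x + g x) = (\<lambda>x. diff_heat t f x + diff_heat t g x)" if g: "g \<in> ell2 G"
      by (rule ext) (simp add: eq f g ell2_add P_add P_ell2 exp_on_add bounded_L bounded_compressed)
    show "diff_heat t (\<lambda>x. c * f x) = (\<lambda>x. c * diff_heat t f x)"
      by (simp add: eq f ell2_scale P_scale P_ell2 exp_on_scale bounded_L bounded_compressed right_diff_distrib)
  qed
qed

end

section \<open>Operator norms and components of cluster families\<close>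

lemma (in mass_space) operator_norm_le:
  assumes "c \<ge> 0" "\<And>f. f \<in> ell2 G \<Longrightarrow> ell2_norm G (T f) \<le> c * ell2_norm G f"
  shows "operator_norm G T \<le> c"
  unfolding operator_norm_def
proof (rule cSUP_least)
  have "(\<lambda>_. 0) \<in> ell2 G" by (simp add: ell2_def)
  then show "ell2 G \<noteq> {}" by blast
  fix f assume f: "f \<in> ell2 G"
  have "0 \<le> ell2_norm G f" using norm_ge_zero[of "to_lsq G f"] by (simp only: norm_to_lsq[OF f])
  \<comment> \<open>For \<open>f\<close> of norm zero the quotient is \<open>0\<close> by the
    convention on division.\<close>
  then show "ell2_norm G (T f) / ell2_norm G f \<le> c"
    using assms(2)[OF f] assms(1) by (cases "ell2_norm G f = 0") (auto simp: pos_divide_le_eq)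
qed

text \<open>A path cannot change cluster: consecutive edges share a vertex, and vertex sets of
  different clusters are disjoint. The path without edges accounts for \<open>y = x\<close>.\<close>

lemma clusters_component_subset:
  assumes "disjoint_family_on (\<lambda>i. Field (E i)) I" and "(x, y) \<in> (\<Union>i\<in>I. E i)\<^sup>*"
  shows "y = x \<or> (\<exists>i\<in>I. x \<in> Field (E i) \<and> y \<in> Field (E i))"
  using assms(2)
proof (induction rule: rtrancl_induct)
  case (step y z)
  then obtain j where j: "j \<in> I" "(y, z) \<in> E j" by blast
  then have yz: "y \<in> Field (E j)" "z \<in> Field (E j)" by (auto simp: Field_def)
  from step.IH show ?case
  proof
    assume "\<exists>i\<in>I. x \<in> Field (E i) \<and> y \<in> Field (E i)"
    then obtain i where i: "i \<in> I" "x \<in> Field (E i)" "y \<in> Field (E i)" by blast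
    then have "i = j" using disjoint_family_onD[OF assms(1) i(1) j(1)] yz by blast
    then show ?thesis using i yz by blast
  qed (use j yz in blast)
qed simp

text \<open>A component either lies in the vertex set of one cluster, which has finite mass, or is a
  single vertex.\<close>

lemma clusters_component_summable:
  assumes "undirected_clusters G I E" "x \<in> verts G"
  shows "mass G summable_on {w \<in> verts G. (x, w) \<in> (\<Union>i\<in>I. E i)\<^sup>*}" (is "_ summable_on ?X")
proof -
  have disj: "disjoint_family_on (\<lambda>i. Field (E i)) I"
    and summ: "\<And>i. i \<in> I \<Longrightarrow> mass G summable_on Field (E i)"
    using assms(1) by (auto simp: undirected_clusters_def)
  show ?thesis
  proof (cases "\<exists>i\<in>I. x \<in> Field (E i)")
    case True
    then obtain i where i: "i \<in> I" "x \<in> Field (E i)" by blast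
    have "?X \<subseteq> Field (E i)"
    proof
      fix y assume "y \<in> ?X"
      then have "y = x \<or> (\<exists>j\<in>I. x \<in> Field (E j) \<and> y \<in> Field (E j))"
        by (intro clusters_component_subset[OF disj]) simp
      then show "y \<in> Field (E i)" using i disjoint_family_onD[OF disj i(1)] by blast
    qed
    then show ?thesis by (rule summable_on_subset[OF summ[OF i(1)]])
  next
    case False
    have "?X \<subseteq> {x}"
      using clusters_component_subset[OF disj, of x] False by blast
    then have "finite ?X" by (rule finite_subset) simp
    then show ?thesis by (rule summable_on_finite)
  qed
qed

theorem corollary3p18:
  fixes G :: "'v wgraph"
    and I :: "'i set"
    and Eh :: "'i \<Rightarrow> ('v \<times> 'v) set"
    and E_hat :: "('v \<times> 'v) set"
    and a :: "real \<Rightarrow> 'v \<Rightarrow> 'v \<Rightarrow> real"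
    and G_beta :: "real \<Rightarrow> 'v wgraph"
  defines "E_hat \<equiv> (\<Union>i\<in>I. Eh i)"
    and "G_beta \<equiv> (\<lambda>\<beta>. G\<lparr>weight := a \<beta>\<rparr>)"
  assumes "weighted_graph G" and "undirected G" and "degree_bounded G"
    and "undirected_clusters G I Eh"
    and "\<And>\<beta>. \<beta> \<ge> 0 \<Longrightarrow>
           weighted_graph (G_beta \<beta>) \<and> undirected (G_beta \<beta>) \<and> degree_bounded (G_beta \<beta>)"
    and "\<And>v w. v \<in> verts G \<Longrightarrow> w \<in> verts G \<Longrightarrow> a 0 v w = weight G v w"
    and "\<And>\<beta> \<beta>' v w. 0 \<le> \<beta> \<Longrightarrow> \<beta> < \<beta>' \<Longrightarrow> (v, w) \<in> edges G - E_hat \<Longrightarrow> a \<beta>' v w = weight G v w"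
    and "\<And>\<beta> \<beta>' v w. 0 \<le> \<beta> \<Longrightarrow> \<beta> < \<beta>' \<Longrightarrow> (v, w) \<in> E_hat \<Longrightarrow> a \<beta>' v w > a \<beta> v w"
    and "\<And>v w. (v, w) \<in> E_hat \<Longrightarrow> filterlim (\<lambda>\<beta>. a \<beta> v w) at_top at_top"
    and "\<And>\<beta>. \<beta> \<ge> 0 \<Longrightarrow> \<exists>f\<in>ell2 G. laplacian (restrict_edges (G_beta \<beta>) E_hat) f \<noteq> (\<lambda>_. 0)"
  shows "\<forall>t>0. \<exists>C>0. \<exists>F :: real \<Rightarrow> real.
           continuous_on {0..} F \<and> bounded (F ` {0..}) \<and> (\<forall>\<gamma>\<ge>0. F \<gamma> \<ge> 0) \<and>
           (F \<longlongrightarrow> 0) at_top \<and>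
           (\<forall>\<beta>\<ge>0.
              let D = (\<lambda>f x. heat (G_beta \<beta>) t f x -
                             J_up G E_hat (heat (reduced_graph G E_hat) t (J_down G E_hat f)) x);
                  L_hat = laplacian (restrict_edges (G_beta \<beta>) E_hat)
              in bounded_operator G D \<and> operator_norm G D \<le> C * F (spectral_gap G L_hat))"
proof (intro allI impI)
  fix t :: real assume t: "t > 0"
  obtain C0 where C0: "C0 > 0" "\<And>v. v \<in> verts G \<Longrightarrow> degree G v \<le> C0 * mass G v"
    using \<open>degree_bounded G\<close> by (auto simp: degree_bounded_def)
  have E_hat: "E_hat \<subseteq> edges G" "sym E_hat"
    using \<open>undirected_clusters G I Eh\<close> by (auto simp: undirected_clusters_def E_hat_def intro: sym_UNION)
  have clusters: "cluster_graph G C0 E_hat"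
  proof
    show "mass G summable_on {w \<in> verts G. (x, w) \<in> E_hat\<^sup>*}" if "x \<in> verts G" for x
      unfolding E_hat_def by (rule clusters_component_summable[OF \<open>undirected_clusters G I Eh\<close> that])
  qed (use assms(3,4) C0 E_hat in auto)
  \<comment> \<open>The constant of the compression estimate with \<open>K = 2 * C0\<close>. As
    \<open>C0\<close> belongs to \<open>G\<close>, nothing here depends on \<open>\<beta>\<close>;
    the maximum with \<open>2\<close> covers the crude bound by two contractions.\<close>
  define c where "c = 1 / sqrt t + 4 * C0 * sqrt t"
  define C where "C = max 2 c"
  \<comment> \<open>Replacing \<open>\<gamma>\<close> by \<open>max 1 \<gamma>\<close> keeps
    \<open>1 / sqrt \<gamma>\<close> bounded and continuous down to \<open>0\<close> without
    affecting its decay.\<close>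
  define F :: "real \<Rightarrow> real" where "F \<gamma> = 1 / sqrt (max 1 \<gamma>)" for \<gamma>
  have C: "C > 0" "2 \<le> C" "c \<le> C" by (auto simp: C_def)
  have F0: "0 \<le> F \<gamma>" "F \<gamma> \<le> 1" for \<gamma> by (auto simp: F_def)
  have "continuous_on {0..} F" unfolding F_def by (intro continuous_intros) auto
  moreover have "bounded (F ` {0..})" by (rule boundedI[of _ 1]) (use F0 in auto)
  moreover have "(F \<longlongrightarrow> 0) at_top"
  proof -
    have "((\<lambda>\<gamma>. 1 / sqrt \<gamma>) \<longlongrightarrow> 0) at_top"
      by (intro real_tendsto_divide_at_top[OF tendsto_const] filterlim_compose[OF sqrt_at_top] filterlim_ident)
    moreover have "\<forall>\<^sub>F \<gamma> in at_top. 1 / sqrt \<gamma> = F \<gamma>"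
      using eventually_ge_at_top[of 1] by eventually_elim (simp add: F_def max_def)
    ultimately show ?thesis by (rule Lim_transform_eventually)
  qed
  moreover have "let D = (\<lambda>f x. heat (G_beta \<beta>) t f x -
                             J_up G E_hat (heat (reduced_graph G E_hat) t (J_down G E_hat f)) x);
                  L_hat = laplacian (restrict_edges (G_beta \<beta>) E_hat)
              in bounded_operator G D \<and> operator_norm G D \<le> C * F (spectral_gap G L_hat)"
    if \<beta>: "\<beta> \<ge> 0" for \<beta>
  proof -
    have graph_\<beta>: "weighted_graph (G_beta \<beta>)" "undirected (G_beta \<beta>)" "degree_bounded (G_beta \<beta>)"
      using assms(7)[OF \<beta>] by auto
    have same: "verts (G_beta \<beta>) = verts G" "mass (G_beta \<beta>) = mass G" "edges (G_beta \<beta>) = edges G"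
        "weight (G_beta \<beta>) = a \<beta>"
      by (simp_all add: G_beta_def)
    obtain C1 where C1: "C1 > 0" "\<And>v. v \<in> verts G \<Longrightarrow> degree (G_beta \<beta>) v \<le> C1 * mass G v"
      using graph_\<beta>(3) by (auto simp: degree_bounded_def same)
    have "laplacian_graph (G_beta \<beta>) C1"
      by standard (use graph_\<beta> C1 in \<open>auto simp: same\<close>)
    \<comment> \<open>For \<open>\<beta> > 0\<close> the assumption on unchanged weights is used
      with \<open>0\<close> as the smaller parameter; \<open>\<beta> = 0\<close> is the initial
      condition. Off the common edge set both weights vanish.\<close>
    moreover have "a \<beta> x y = weight G x y" if xy: "x \<in> verts G" "y \<in> verts G" "(x, y) \<notin> E_hat" for x y
    proof (cases "\<beta> = 0")
      case True
      then show ?thesis using assms(8) xy by simp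
    next
      case False
      show ?thesis
      proof (cases "(x, y) \<in> edges G")
        case True
        then show ?thesis using assms(9)[of 0 \<beta> x y] False \<beta> xy by simp
      next
        case False
        then have "\<not> 0 < weight G x y" "0 \<le> weight G x y" "\<not> 0 < a \<beta> x y" "0 \<le> a \<beta> x y"
          using assms(3) graph_\<beta>(1) xy(1,2) by (simp_all add: weighted_graph_def same)
        then show ?thesis by linarith
      qed
    qed
    ultimately interpret coupled_graph G C0 E_hat "G_beta \<beta>" C1
      using clusters by (simp add: coupled_graph_def coupled_graph_axioms_def same)
    let ?\<gamma> = "spectral_gap G (laplacian (restrict_edges (G_beta \<beta>) E_hat))"
    have "operator_norm G (diff_heat t) \<le> C * F ?\<gamma>"
    proof (rule operator_norm_le)
      show "0 \<le> C * F ?\<gamma>" using C F0 by simp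
      fix f assume f: "f \<in> ell2 G"
      have f0: "0 \<le> ell2_norm G f" using norm_to_lsq[OF f] norm_ge_zero by metis
      show "ell2_norm G (diff_heat t f) \<le> C * F ?\<gamma> * ell2_norm G f"
      \<comment> \<open>For a gap below \<open>1\<close> the value of \<open>F\<close> is
        \<open>1\<close>, and contractivity of both semigroups suffices.\<close>
      proof (cases "?\<gamma> \<ge> 1")
        case True
        then have "ell2_norm G (diff_heat t f) \<le> c / sqrt ?\<gamma> * ell2_norm G f"
          using diff_heat_norm(3)[OF f t] by (simp add: c_def)
        also have "\<dots> \<le> C * F ?\<gamma> * ell2_norm G f"
          using True C f0 by (intro mult_right_mono) (auto simp: F_def max_def divide_right_mono)
        finally show ?thesis .
      next
        case False
        have "ell2_norm G (diff_heat t f) \<le> 2 * ell2_norm G f" by (rule diff_heat_norm(2)[OF f t])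
        also have "\<dots> \<le> C * F ?\<gamma> * ell2_norm G f"
          using False C f0 by (intro mult_right_mono) (auto simp: F_def max_def)
        finally show ?thesis .
      qed
    qed
    moreover have "(\<lambda>f x. heat (G_beta \<beta>) t f x -
        J_up G E_hat (heat (reduced_graph G E_hat) t (J_down G E_hat f)) x) = diff_heat t"
      by (simp add: diff_heat_def fun_eq_iff)
    ultimately show ?thesis using bounded_diff_heat[OF t] by (simp add: Let_def)
  qed
  ultimately show "\<exists>C>0. \<exists>F :: real \<Rightarrow> real.
           continuous_on {0..} F \<and> bounded (F ` {0..}) \<and> (\<forall>\<gamma>\<ge>0. F \<gamma> \<ge> 0) \<and>
           (F \<longlongrightarrow> 0) at_top \<and>
           (\<forall>\<beta>\<ge>0.
              let D = (\<lambda>f x. heat (G_beta \<beta>) t f x -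
                             J_up G E_hat (heat (reduced_graph G E_hat) t (J_down G E_hat f)) x);
                  L_hat = laplacian (restrict_edges (G_beta \<beta>) E_hat)
              in bounded_operator G D \<and> operator_norm G D \<le> C * F (spectral_gap G L_hat))"
    using C(1) F0(1) by blast
qed

end
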